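(* Let $X$ be a Banach space with a basis $(e_i)$ and let $\gamma=(\gamma_\alpha)_{\alpha<\omega_1}\in\Delta(X)$. Then there exists $(y_i)\prec(e_i)$ such that $(y_i)$ $\Delta$-stabilizes $\gamma$ and such that for all $\alpha<\omega_1$, $$\ddot\delta_\alpha(y_i)=\lim_{n\to\infty}(\gamma_{\alpha\cdot n})^{1/n}.$$
   Context: Spaces are separable infinite-dimensional Banach spaces; ordinal sums and products are the usual ones. For a basic sequence $(x_i)$, $(y_i)\prec(x_i)$ means that $(y_i)$ is a (finite or infinite) block basis of $(x_i)$, $[x_i]$ is the closed linear span, and supports of vectors are taken w.r.t. $(x_i)$. For finite $F,G\subseteq\mathbb N$, $F<G$ means $\max F<\min G$ (or one is empty); $F\ge n$ means $\min F\ge n$. Schreier classes: for sets $\mathcal F,\mathcal G$ of finite subsets of $\mathbb N$, $\mathcal F[\mathcal G]=\{\bigcup_1^nG_i: n\in\mathbb N, G_1<\dots<G_n, G_i\in\mathcal G, (\min G_i)_1^n\in\mathcal F\}$. $\mathcal S_0=\{\{n\}:n\in\mathbb N\}\cup\{\emptyset\}$, $\mathcal S_1=\{F:\min F\ge|F|\}\cup\{\emptyset\}$, $\mathcal S_{\alpha+1}=\mathcal S_1[\mathcal S_\alpha]$, and for a limit ordinal $\alpha<\omega_1$ one fixes $\alpha_n\uparrow\alpha$ and sets $\mathcal S_\alpha=\{F:\text{for some }n,\ F\in\mathcal S_{\alpha_n}\text{ and }F\ge n\}$. A finite block sequence $(y_i)_1^k\prec(x_i)$ is $\alpha$-admissible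 w.r.t. $(x_i)$ if $(\min\operatorname{supp}(y_i))_{i=1}^k\in\mathcal S_\alpha$. $\delta_\alpha(x_i)$ is the supremum of $\delta\ge0$ such that $\|\sum_1^ky_i\|\ge\delta\sum_1^k\|y_i\|$ for all $(y_i)_1^k\prec(x_i)$ $\alpha$-admissible w.r.t. $(x_i)$; $\delta_\alpha((x_i),|\cdot|)$ is the same quantity for an equivalent norm $|\cdot|$. For a basic sequence $(y_i)$, $\dot\delta_\alpha((y_i),|\cdot|)=\sup\{\delta_\alpha((x_i),|\cdot|):(x_i)\prec(y_i)\}$ and $\ddot\delta_\alpha(y_i)=\sup\{\dot\delta_\alpha((y_i),|\cdot|):|\cdot|\text{ an equivalent norm on }[y_i]\}$. A basic sequence $(x_i)$ $\Delta$-stabilizes $\gamma=(\gamma_\alpha)_{\alpha<\omega_1}\subseteq\mathbb R$ if there exist $\varepsilon_n\downarrow0$ so that for every $\alpha<\omega_1$ there is $m\in\mathbb N$ such that for all $n\ge m$, if $(y_i)\prec(x_i)_n^\infty$ then $|\delta_\alpha(y_i)-\gamma_\alpha|<\varepsilon_n$. $\Delta(X)$ is the set of all $\gamma$ such that some $(x_i)\prec(e_i)$ $\Delta$-stabilizes $\gamma$. For $\gamma\in\Delta(X)$ one has $\gamma_\alpha\gamma_\beta\le\gamma_{\beta+\alpha}$, so that the limit $\lim_n(\gamma_{\alpha\cdot n})^{1/n}$ exists. *)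

theory Defs
  imports "HOL-Analysis.Analysis" "HOL-Library.Countable_Set_Type"
begin

section \<open>Countable ordinals\<close>

text \<open>The type of all ordinals below \<open>\<omega>\<^sub>1\<close>: the well-order \<open>cardSuc natLeq\<close> is
  (a representative of) the first uncountable cardinal.\<close>

typedef omega1 = "Field (cardSuc natLeq)"
proof -
  have "Field (cardSuc natLeq) \<noteq> {}"
    using Field_natLeq cardSuc_finite[OF natLeq_Card_order] by (metis finite.emptyI infinite_UNIV_nat)
  thus ?thesis by blast
qed

setup_lifting type_definition_omega1

lemma omega1_Card_order: "Card_order (cardSuc natLeq)"
  by (rule cardSuc_Card_order[OF natLeq_Card_order])

lemma omega1_Well_order: "Well_order (cardSuc natLeq)"
  using omega1_Card_order card_order_on_well_order_on by blast

instantiation omega1 :: wellorder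
begin

lift_definition less_eq_omega1 :: "omega1 \<Rightarrow> omega1 \<Rightarrow> bool"
  is "\<lambda>x y. (x, y) \<in> cardSuc natLeq" .

definition less_omega1 :: "omega1 \<Rightarrow> omega1 \<Rightarrow> bool"
  where "less_omega1 x y \<longleftrightarrow> x \<le> y \<and> \<not> y \<le> x"

instance
proof -
  have wo: "wo_rel (cardSuc natLeq)"
    using omega1_Well_order by (simp add: wo_rel_def)
  have antisym: "x = y" if "x \<le> y" "y \<le> x" for x y :: omega1
    using that wo_rel.ANTISYM[OF wo]
    by transfer (auto simp: antisym_def)
  have wf: "wf {(x, y :: omega1). x < y}"
  proof -
    have "wf (cardSuc natLeq - Id)" using wo_rel.WF[OF wo] .
    hence "wf (inv_image (cardSuc natLeq - Id) Rep_omega1)" by (rule wf_inv_image)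
    moreover have "{(x, y :: omega1). x < y} \<subseteq> inv_image (cardSuc natLeq - Id) Rep_omega1"
      by (auto simp: inv_image_def less_omega1_def less_eq_omega1.rep_eq Rep_omega1_inject)
    ultimately show ?thesis by (rule wf_subset)
  qed
  show "OFCLASS(omega1, wellorder_class)"
  proof (intro_classes, goal_cases)
    case (1 x y) show ?case by (rule less_omega1_def)
  next
    case (2 x) show ?case
      by transfer (use wo_rel.REFL[OF wo] in \<open>auto simp: refl_on_def\<close>)
  next
    case (3 x y z) thus ?case
      by transfer (use wo_rel.TRANS[OF wo] in \<open>auto elim: transE\<close>)
  next
    case (4 x y) thus ?case by (rule antisym)
  next
    case (5 x y) show ?case
      by transfer (use wo_rel.TOTALS[OF wo] in auto)
  next
    case (6 P x)
    show ?case by (rule wf_induct_rule[OF wf]) (use 6 in auto)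
  qed
qed

end

lemma countable_below_omega1:
  includes cardinal_syntax
  shows "countable {..<\<alpha> :: omega1}"
proof -
  let ?r = "cardSuc natLeq"
  have "|underS ?r (Rep_omega1 \<alpha>)| <o ?r"
    by (rule card_of_underS[OF omega1_Card_order Rep_omega1])
  hence "|underS ?r (Rep_omega1 \<alpha>)| \<le>o natLeq"
    using cardSuc_ordLeq_ordLess[OF natLeq_Card_order card_of_Card_order] by blast
  hence c: "countable (underS ?r (Rep_omega1 \<alpha>))"
    by (simp add: countable_card_le_natLeq)
  have "Rep_omega1 ` {..<\<alpha>} \<subseteq> underS ?r (Rep_omega1 \<alpha>)"
    by (auto simp: underS_def less_omega1_def less_eq_omega1.rep_eq Rep_omega1_inject)
  hence "countable (Rep_omega1 ` {..<\<alpha>})" using c countable_subset by blast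
  thus ?thesis
    by (rule countable_image_inj_on) (simp add: inj_on_def Rep_omega1_inject)
qed

lemma uncountable_omega1:
  includes cardinal_syntax
  shows "uncountable (UNIV :: omega1 set)"
proof
  assume "countable (UNIV :: omega1 set)"
  hence "countable (Field (cardSuc natLeq))"
    by (metis countable_image type_definition.Rep_range type_definition_omega1)
  hence "|Field (cardSuc natLeq)| \<le>o natLeq" by (simp add: countable_card_le_natLeq)
  hence "cardSuc natLeq \<le>o natLeq"
    using card_of_Field_ordIso[OF omega1_Card_order] ordIso_ordLeq_trans ordIso_symmetric by blast
  thus False
    using cardSuc_greater[OF natLeq_Card_order] not_ordLess_ordLeq by blast
qed

lemma countable_bounded_omega1:
  fixes A :: "omega1 set"
  assumes "countable A"
  shows "\<exists>\<beta>. \<forall>\<alpha>\<in>A. \<alpha> < \<beta>"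
proof (rule ccontr)
  assume "\<not> ?thesis"
  hence "UNIV \<subseteq> (\<Union>\<alpha>\<in>A. insert \<alpha> {..<\<alpha>})" by (auto simp: not_less le_less)
  moreover have "countable (\<Union>\<alpha>\<in>A. insert \<alpha> {..<\<alpha>})"
    using assms countable_below_omega1 by auto
  ultimately show False using uncountable_omega1 countable_subset by blast
qed

definition osuc :: "omega1 \<Rightarrow> omega1" where
  "osuc \<alpha> = (LEAST \<beta>. \<alpha> < \<beta>)"

instantiation omega1 :: zero
begin
definition zero_omega1 :: omega1 where "zero_omega1 = (LEAST \<alpha>. True)"
instance ..
end

definition limit_ord :: "omega1 \<Rightarrow> bool" where
  "limit_ord \<alpha> \<longleftrightarrow> \<alpha> \<noteq> 0 \<and> (\<forall>\<beta>. \<alpha> \<noteq> osuc \<beta>)"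

definition opred :: "omega1 \<Rightarrow> omega1" where
  "opred \<alpha> = (THE \<beta>. osuc \<beta> = \<alpha>)"

lemma zero_le_omega1 [simp]: "0 \<le> (\<alpha> :: omega1)"
  unfolding zero_omega1_def by (rule Least_le) simp

lemma osuc_greater: "\<alpha> < osuc \<alpha>"
  unfolding osuc_def using countable_bounded_omega1[of "{\<alpha>}"] by (auto intro: LeastI)

lemma osuc_leI: "\<alpha> < \<beta> \<Longrightarrow> osuc \<alpha> \<le> \<beta>"
  unfolding osuc_def by (rule Least_le)

lemma less_osuc_iff: "\<alpha> < osuc \<beta> \<longleftrightarrow> \<alpha> \<le> \<beta>"
  by (meson leD leI le_less_trans osuc_greater osuc_leI)

lemma osuc_inject [simp]: "osuc \<alpha> = osuc \<beta> \<longleftrightarrow> \<alpha> = \<beta>"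
  by (metis less_osuc_iff order.antisym order.refl)

lemma osuc_nonzero [simp]: "osuc \<alpha> \<noteq> 0"
  by (metis leD osuc_greater zero_le_omega1)

lemma opred_osuc [simp]: "opred (osuc \<alpha>) = \<alpha>"
  by (simp add: opred_def)

lemma not_limit_ord_osuc [simp]: "\<not> limit_ord (osuc \<alpha>)"
  by (auto simp: limit_ord_def)

lemma opred_less: "\<alpha> \<noteq> 0 \<Longrightarrow> \<not> limit_ord \<alpha> \<Longrightarrow> opred \<alpha> < \<alpha>"
  by (auto simp: limit_ord_def osuc_greater)

text \<open>Ordinal sum: \<open>\<alpha> + \<beta>\<close> is the least ordinal that is at least \<open>\<alpha>\<close> and exceeds all
  \<open>\<alpha> + \<delta>\<close> with \<open>\<delta> < \<beta>\<close>.  The usual recursion equations are derived below.\<close>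

function oadd :: "omega1 \<Rightarrow> omega1 \<Rightarrow> omega1" where
  "oadd \<alpha> \<beta> = (LEAST \<gamma>. \<alpha> \<le> \<gamma> \<and> (\<forall>\<delta>. \<delta> < \<beta> \<longrightarrow> oadd \<alpha> \<delta> < \<gamma>))"
  by auto
termination
  by (relation "inv_image {(x, y). x < y} snd") (auto intro!: wf_inv_image wf)

declare oadd.simps [simp del]

instantiation omega1 :: plus
begin
definition plus_omega1 :: "omega1 \<Rightarrow> omega1 \<Rightarrow> omega1" where "\<alpha> + \<beta> = oadd \<alpha> \<beta>"
instance ..
end

lemma add_omega1_ex: "\<exists>\<gamma>::omega1. \<alpha> \<le> \<gamma> \<and> (\<forall>\<delta>. \<delta> < \<beta> \<longrightarrow> \<alpha> + \<delta> < \<gamma>)"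
proof -
  have "countable (insert \<alpha> ((\<lambda>\<delta>. \<alpha> + \<delta>) ` {..<\<beta>}))"
    using countable_below_omega1 by auto
  from countable_bounded_omega1[OF this] show ?thesis by (auto intro: less_imp_le)
qed

lemma add_omega1_unfold:
  "(\<alpha>::omega1) + \<beta> = (LEAST \<gamma>. \<alpha> \<le> \<gamma> \<and> (\<forall>\<delta>. \<delta> < \<beta> \<longrightarrow> \<alpha> + \<delta> < \<gamma>))"
  unfolding plus_omega1_def by (rule oadd.simps)

lemma add_omega1_ge: "(\<alpha>::omega1) \<le> \<alpha> + \<beta>"
  and add_omega1_strict_mono: "\<delta> < \<beta> \<Longrightarrow> (\<alpha>::omega1) + \<delta> < \<alpha> + \<beta>"
  using LeastI_ex[OF add_omega1_ex[of \<alpha> \<beta>]] by (simp_all add: add_omega1_unfold[symmetric])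

lemma add_omega1_least:
  assumes "(\<alpha>::omega1) \<le> \<gamma>" "\<And>\<delta>. \<delta> < \<beta> \<Longrightarrow> \<alpha> + \<delta> < \<gamma>"
  shows "\<alpha> + \<beta> \<le> \<gamma>"
  by (subst add_omega1_unfold, rule Least_le) (use assms in auto)

lemma add_zero_omega1: "(\<alpha>::omega1) + 0 = \<alpha>"
  by (rule order.antisym, rule add_omega1_least) (auto simp: add_omega1_ge leD)

lemma add_osuc_omega1: "(\<alpha>::omega1) + osuc \<beta> = osuc (\<alpha> + \<beta>)"
proof (rule order.antisym)
  show "\<alpha> + osuc \<beta> \<le> osuc (\<alpha> + \<beta>)"
  proof (rule add_omega1_least)
    show "\<alpha> \<le> osuc (\<alpha> + \<beta>)"
      using add_omega1_ge osuc_greater by (meson less_imp_le order_trans)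
    show "\<alpha> + \<delta> < osuc (\<alpha> + \<beta>)" if "\<delta> < osuc \<beta>" for \<delta>
      using that add_omega1_strict_mono[of \<delta> \<beta> \<alpha>] by (auto simp: less_osuc_iff le_less)
  qed
  show "osuc (\<alpha> + \<beta>) \<le> \<alpha> + osuc \<beta>"
    by (intro osuc_leI add_omega1_strict_mono osuc_greater)
qed

lemma add_limit_omega1:
  assumes "limit_ord \<beta>"
  shows "(\<alpha>::omega1) + \<beta> \<le> \<gamma> \<longleftrightarrow> (\<forall>\<delta><\<beta>. \<alpha> + \<delta> \<le> \<gamma>)"
proof
  assume "\<alpha> + \<beta> \<le> \<gamma>"
  thus "\<forall>\<delta><\<beta>. \<alpha> + \<delta> \<le> \<gamma>"
    using add_omega1_strict_mono by (meson less_imp_le order_less_le_trans)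
next
  assume *: "\<forall>\<delta><\<beta>. \<alpha> + \<delta> \<le> \<gamma>"
  show "\<alpha> + \<beta> \<le> \<gamma>"
  proof (rule add_omega1_least)
    have "0 < \<beta>" using assms by (auto simp: limit_ord_def less_le)
    thus "\<alpha> \<le> \<gamma>" using * by (metis add_zero_omega1)
    fix \<delta> assume "\<delta> < \<beta>"
    hence "osuc \<delta> < \<beta>" using assms by (metis limit_ord_def osuc_leI order.not_eq_order_implies_strict)
    thus "\<alpha> + \<delta> < \<gamma>" using * add_omega1_strict_mono osuc_greater
      by (meson order_less_le_trans)
  qed
qed

text \<open>The ordinal product \<open>\<alpha> \<cdot> n\<close> for finite \<open>n\<close>.\<close>

primrec omul :: "omega1 \<Rightarrow> nat \<Rightarrow> omega1" where
  "omul \<alpha> 0 = 0"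
| "omul \<alpha> (Suc n) = omul \<alpha> n + \<alpha>"

section \<open>Schreier classes\<close>

text \<open>Schreier sets consist of positive integers.\<close>

definition set_before :: "nat set \<Rightarrow> nat set \<Rightarrow> bool" where
  "set_before F G \<longleftrightarrow> (\<forall>i\<in>F. \<forall>j\<in>G. i < j)"

text \<open>The sets \<open>G\<^sub>i\<close> are taken nonempty so that their minima exist; the case \<open>n = 0\<close> puts
  the empty set into the composition.\<close>

definition family_comp :: "nat set set \<Rightarrow> nat set set \<Rightarrow> nat set set" where
  "family_comp \<F> \<G> = {\<Union>i<n. G i | (n::nat) G.
     (\<forall>i<n. G i \<in> \<G> \<and> G i \<noteq> {}) \<and>
     (\<forall>i j. i < j \<and> j < n \<longrightarrow> set_before (G i) (G j)) \<and>
     (\<lambda>i. Min (G i)) ` {..<n} \<in> \<F>}"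

definition schreier0 :: "nat set set" where
  "schreier0 = {{n} | n. 1 \<le> n} \<union> {{}}"

definition schreier1 :: "nat set set" where
  "schreier1 = {F. finite F \<and> F \<noteq> {} \<and> F \<subseteq> {1..} \<and> card F \<le> Min F} \<union> {{}}"

text \<open>A choice of sequences \<open>\<alpha>\<^sub>n \<up> \<alpha>\<close>, \<open>n \<ge> 1\<close>, for every limit ordinal \<open>\<alpha> < \<omega>\<^sub>1\<close>.\<close>

definition fundamental_sequences :: "(omega1 \<Rightarrow> nat \<Rightarrow> omega1) \<Rightarrow> bool" where
  "fundamental_sequences a \<longleftrightarrow> (\<forall>\<alpha>. limit_ord \<alpha> \<longrightarrow>
     strict_mono_on {1..} (a \<alpha>) \<and> (\<forall>n\<ge>1. a \<alpha> n < \<alpha>) \<and> (\<forall>\<beta><\<alpha>. \<exists>n\<ge>1. \<beta> < a \<alpha> n))"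

text \<open>The condition \<open>a \<alpha> n < \<alpha>\<close> only serves termination; see \<open>schreier_limit\<close>.\<close>

function schreier :: "(omega1 \<Rightarrow> nat \<Rightarrow> omega1) \<Rightarrow> omega1 \<Rightarrow> nat set set" where
  "schreier a \<alpha> =
     (if \<alpha> = 0 then schreier0
      else if limit_ord \<alpha> then
        (\<Union>n\<in>{n. 1 \<le> n \<and> a \<alpha> n < \<alpha>}. {F \<in> schreier a (a \<alpha> n). \<forall>k\<in>F. n \<le> k})
      else family_comp schreier1 (schreier a (opred \<alpha>)))"
  by auto
termination
  by (relation "inv_image {(x, y). x < y} snd") (auto intro!: wf_inv_image wf opred_less)

declare schreier.simps [simp del]

lemma schreier_0: "schreier a 0 = schreier0"
  by (simp add: schreier.simps)

lemma schreier_osuc: "schreier a (osuc \<alpha>) = family_comp schreier1 (schreier a \<alpha>)"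
  by (subst schreier.simps) simp

lemma schreier_limit:
  assumes "fundamental_sequences a" "limit_ord \<alpha>"
  shows "schreier a \<alpha> = {F. \<exists>n\<ge>1. F \<in> schreier a (a \<alpha> n) \<and> (\<forall>k\<in>F. n \<le> k)}"
  using assms by (subst schreier.simps) (auto simp: limit_ord_def fundamental_sequences_def)

lemma schreier_1: "schreier a (osuc 0) = schreier1"
proof (intro set_eqI iffI)
  fix F assume "F \<in> schreier a (osuc 0)"
  then obtain n :: nat and G where F: "F = (\<Union>i<n. G i)"
    and G: "\<forall>i<n. G i \<in> schreier0 \<and> G i \<noteq> {}"
    and S: "(\<lambda>i. Min (G i)) ` {..<n} \<in> schreier1"
    by (auto simp: schreier_osuc schreier_0 family_comp_def)
  have "\<forall>i<n. G i = {Min (G i)}" using G by (fastforce simp: schreier0_def)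
  hence "F = (\<lambda>i. Min (G i)) ` {..<n}" unfolding F by blast
  with S show "F \<in> schreier1" by simp
next
  fix F assume F: "F \<in> schreier1"
  hence fin: "finite F" by (auto simp: schreier1_def)
  define l where "l = sorted_list_of_set F"
  have l: "sorted_wrt (<) l" "set l = F" using fin by (auto simp: l_def)
  have im: "(\<lambda>i. l ! i) ` {..<length l} = F"
    using l by (auto simp: set_conv_nth)
  have "F = (\<Union>i<length l. {l ! i})" using im by auto
  moreover have "\<forall>i<length l. {l ! i} \<in> schreier0 \<and> {l ! i} \<noteq> {}"
    using F im by (force simp: schreier0_def schreier1_def)
  moreover have "\<forall>i j. i < j \<and> j < length l \<longrightarrow> set_before {l ! i} {l ! j}"
    using l by (auto simp: set_before_def sorted_wrt_iff_nth_less)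
  moreover have "(\<lambda>i. Min {l ! i}) ` {..<length l} \<in> schreier1" using F im by simp
  ultimately show "F \<in> schreier a (osuc 0)"
    unfolding schreier_osuc schreier_0 family_comp_def by blast
qed

section \<open>Bases and block sequences\<close>

text \<open>Sequences of vectors are indexed from 0: the term written \<open>x\<^sub>i\<close> (\<open>i \<ge> 1\<close>) in the usual
  numbering is \<open>x (i - 1)\<close>.\<close>

abbreviation closed_span :: "(nat \<Rightarrow> 'a::banach) \<Rightarrow> 'a set" where
  "closed_span x \<equiv> closure (span (range x))"

definition schauder_basis :: "(nat \<Rightarrow> 'a::banach) \<Rightarrow> bool" where
  "schauder_basis x \<longleftrightarrow> (\<forall>v. \<exists>!c. (\<lambda>i. c i *\<^sub>R x i) sums v)"

text \<open>Coordinates and supports are only meaningful when \<open>x\<close> is a basic sequence and \<open>v\<close> lies in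
  its closed linear span; below, \<open>x\<close> is always a block basis of a basis or a tail of one.\<close>

definition coord :: "(nat \<Rightarrow> 'a::banach) \<Rightarrow> 'a \<Rightarrow> nat \<Rightarrow> real" where
  "coord x v = (THE c. (\<lambda>i. c i *\<^sub>R x i) sums v)"

definition supp :: "(nat \<Rightarrow> 'a::banach) \<Rightarrow> 'a \<Rightarrow> nat set" where
  "supp x v = {i. coord x v i \<noteq> 0}"

text \<open>Here \<open>k = \<infinity>\<close> gives infinite block bases, and \<open>k = enat n\<close> gives block sequences of
  length \<open>n\<close>, for which only the values \<open>y 0, \<dots>, y (n - 1)\<close> matter.\<close>

definition block_seq :: "(nat \<Rightarrow> 'a::banach) \<Rightarrow> enat \<Rightarrow> (nat \<Rightarrow> 'a) \<Rightarrow> bool" where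
  "block_seq x k y \<longleftrightarrow>
     (\<forall>i. enat i < k \<longrightarrow> y i \<in> span (range x) \<and> y i \<noteq> 0) \<and>
     (\<forall>i. enat (Suc i) < k \<longrightarrow> set_before (supp x (y i)) (supp x (y (Suc i))))"

abbreviation block_basis :: "(nat \<Rightarrow> 'a::banach) \<Rightarrow> (nat \<Rightarrow> 'a) \<Rightarrow> bool" where
  "block_basis x y \<equiv> block_seq x \<infinity> y"

section \<open>The constants \<open>\<delta>\<close> and the spectrum \<open>\<Delta>\<close>\<close>

text \<open>The \<open>Suc\<close> converts 0-based positions to the numbering by positive integers.\<close>

definition admissible ::
  "(omega1 \<Rightarrow> nat \<Rightarrow> omega1) \<Rightarrow> omega1 \<Rightarrow> (nat \<Rightarrow> 'a::banach) \<Rightarrow> nat \<Rightarrow> (nat \<Rightarrow> 'a) \<Rightarrow> bool" where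
  "admissible a \<alpha> x k y \<longleftrightarrow>
     block_seq x (enat k) y \<and> (\<lambda>i. Suc (Min (supp x (y i)))) ` {..<k} \<in> schreier a \<alpha>"

definition delta ::
  "(omega1 \<Rightarrow> nat \<Rightarrow> omega1) \<Rightarrow> omega1 \<Rightarrow> ('a::banach \<Rightarrow> real) \<Rightarrow> (nat \<Rightarrow> 'a) \<Rightarrow> real" where
  "delta a \<alpha> N x = Sup {d. 0 \<le> d \<and>
     (\<forall>k y. admissible a \<alpha> x k y \<longrightarrow> N (\<Sum>i<k. y i) \<ge> d * (\<Sum>i<k. N (y i)))}"

definition equivalent_norm_on :: "'a::banach set \<Rightarrow> ('a \<Rightarrow> real) \<Rightarrow> bool" where
  "equivalent_norm_on V N \<longleftrightarrow>
     (\<forall>u\<in>V. \<forall>v\<in>V. N (u + v) \<le> N u + N v) \<and>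
     (\<forall>c. \<forall>v\<in>V. N (c *\<^sub>R v) = \<bar>c\<bar> * N v) \<and>
     (\<exists>c>0. \<exists>C. \<forall>v\<in>V. c * norm v \<le> N v \<and> N v \<le> C * norm v)"

definition delta_dot ::
  "(omega1 \<Rightarrow> nat \<Rightarrow> omega1) \<Rightarrow> omega1 \<Rightarrow> ('a::banach \<Rightarrow> real) \<Rightarrow> (nat \<Rightarrow> 'a) \<Rightarrow> real" where
  "delta_dot a \<alpha> N y = Sup {delta a \<alpha> N x | x. block_basis y x}"

definition delta_ddot ::
  "(omega1 \<Rightarrow> nat \<Rightarrow> omega1) \<Rightarrow> omega1 \<Rightarrow> (nat \<Rightarrow> 'a::banach) \<Rightarrow> real" where
  "delta_ddot a \<alpha> y = Sup {delta_dot a \<alpha> N y | N. equivalent_norm_on (closed_span y) N}"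

definition Delta_stabilizes ::
  "(omega1 \<Rightarrow> nat \<Rightarrow> omega1) \<Rightarrow> (nat \<Rightarrow> 'a::banach) \<Rightarrow> (omega1 \<Rightarrow> real) \<Rightarrow> bool" where
  "Delta_stabilizes a x \<gamma> \<longleftrightarrow>
     (\<exists>\<epsilon>. decseq \<epsilon> \<and> \<epsilon> \<longlonglongrightarrow> 0 \<and>
        (\<forall>\<alpha>. \<exists>m. \<forall>n\<ge>m. \<forall>y. block_basis (\<lambda>i. x (i + n)) y \<longrightarrow>
           \<bar>delta a \<alpha> norm y - \<gamma> \<alpha>\<bar> < \<epsilon> n))"

definition Delta ::
  "(omega1 \<Rightarrow> nat \<Rightarrow> omega1) \<Rightarrow> (nat \<Rightarrow> 'a::banach) \<Rightarrow> (omega1 \<Rightarrow> real) set" where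
  "Delta a e = {\<gamma>. \<exists>x. block_basis e x \<and> Delta_stabilizes a x \<gamma>}"

end

theory Submission
  imports Defs
begin

text \<open>Every basic sequence \<open>y\<close> that stabilizes \<open>\<gamma>\<close> works.

  If \<open>d \<le> \<delta>\<^sub>\<alpha>(x, N)\<close> for an equivalent norm \<open>N\<close> and a block basis \<open>x\<close> of \<open>y\<close>, then \<open>d\<close> can be iterated:
  sets of the class \<open>\<alpha> \<cdot> (n + 1)\<close>, spread far enough, decompose as unions of sets of the class
  \<open>\<alpha> \<cdot> n\<close> whose minima form a set of the class \<open>\<alpha>\<close>. So a subsequence of \<open>x\<close> satisfies the lower
  estimate with constant \<open>d\<^sup>n\<close> for the class \<open>\<alpha> \<cdot> n\<close>, and hence \<open>\<gamma>\<close> at \<open>\<alpha> \<cdot> n\<close> is at least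
  \<open>c d\<^sup>n\<close> with \<open>c\<close> independent of \<open>n\<close>.

  Conversely, let \<open>K\<close> bound the basis projections and let \<open>\<gamma>\<close> at \<open>\<alpha> \<cdot> n\<close> exceed \<open>K (1 + K) d\<^sup>n\<close>.
  Let \<open>A\<^sub>j v\<close> be the supremum of the sums of the norms of the restrictions of \<open>v\<close> to disjoint
  intervals whose left ends form a set of the class \<open>\<alpha> \<cdot> j\<close>. For \<open>\<alpha>\<close>-admissible sequences \<open>z\<close> of
  blocks of a sparse subsequence, the sum of the \<open>A\<^sub>j z\<^sub>i\<close> is at most \<open>A\<close> at \<open>j + 1\<close> of the
  sum of the \<open>z\<^sub>i\<close>, while \<open>d\<^sup>n A\<^sub>n \<le> norm \<le> A\<^sub>0\<close>. So the sum of \<open>d\<^sup>j A\<^sub>j\<close> over \<open>j < n\<close> is an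
  equivalent norm for which the lower estimate for the class \<open>\<alpha>\<close> holds with the constant \<open>d\<close>.\<close>

section \<open>Schreier families\<close>

lemma limit_ord_add:
  assumes "limit_ord \<alpha>"
  shows "limit_ord (\<beta> + \<alpha>)"
proof -
  have pos: "0 < \<alpha>"
    using assms by (auto simp: limit_ord_def less_le)
  have "\<beta> + \<alpha> \<noteq> osuc \<delta>" for \<delta>
  proof
    assume eq: "\<beta> + \<alpha> = osuc \<delta>"
    have "\<not> \<beta> + \<alpha> \<le> \<delta>"
      using eq osuc_greater[of \<delta>] by simp
    then obtain \<delta>' where "\<delta>' < \<alpha>" "\<delta> < \<beta> + \<delta>'"
      using add_limit_omega1[OF assms] by (auto simp: not_le)
    then show False
      using eq osuc_leI[of \<delta> "\<beta> + \<delta>'"] add_omega1_strict_mono[of \<delta>' \<alpha> \<beta>] by simp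
  qed
  moreover have "\<beta> + \<alpha> \<noteq> 0"
    using add_omega1_strict_mono[OF pos, of \<beta>] zero_le_omega1[of "\<beta> + 0"] by (auto simp: not_less[symmetric])
  ultimately show ?thesis by (simp add: limit_ord_def)
qed

lemma omega1_cases:
  obtains "\<alpha> = 0" | \<beta> where "\<alpha> = osuc \<beta>" | "limit_ord \<alpha>"
  by (auto simp: limit_ord_def)

lemma omega1_induct [case_names zero osuc limit]:
  assumes "P 0" "\<And>\<alpha>. P \<alpha> \<Longrightarrow> P (osuc \<alpha>)"
    "\<And>\<alpha>. limit_ord \<alpha> \<Longrightarrow> (\<And>\<beta>. \<beta> < \<alpha> \<Longrightarrow> P \<beta>) \<Longrightarrow> P \<alpha>"
  shows "P (\<alpha> :: omega1)"
proof (induction \<alpha> rule: less_induct)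
  case (less \<alpha>)
  show ?case
    by (cases \<alpha> rule: omega1_cases) (use assms less osuc_greater in auto)
qed

lemma omul_mono: "m \<le> n \<Longrightarrow> omul \<alpha> m \<le> omul \<alpha> n"
  by (induction n rule: dec_induct) (auto intro: order_trans add_omega1_ge)

section \<open>Spreading hereditary families and their composition\<close>

lemma set_before_mono: "set_before A B \<Longrightarrow> A' \<subseteq> A \<Longrightarrow> B' \<subseteq> B \<Longrightarrow> set_before A' B'"
  by (auto simp: set_before_def)

text \<open>The sets are indexed by a set of integers rather than by an initial segment, so that the
  index set itself can be the member of a Schreier class that controls them.\<close>

definition ordered_on :: "nat set \<Rightarrow> (nat \<Rightarrow> nat set) \<Rightarrow> bool" where
  "ordered_on I G \<longleftrightarrow> (\<forall>i\<in>I. \<forall>j\<in>I. i < j \<longrightarrow> set_before (G i) (G j))"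

lemma ordered_onD: "ordered_on I G \<Longrightarrow> i \<in> I \<Longrightarrow> j \<in> I \<Longrightarrow> i < j \<Longrightarrow> set_before (G i) (G j)"
  by (simp add: ordered_on_def)

lemma ordered_on_mono:
  "ordered_on I G \<Longrightarrow> J \<subseteq> I \<Longrightarrow> (\<And>i. i \<in> J \<Longrightarrow> H i \<subseteq> G i) \<Longrightarrow> ordered_on J H"
  unfolding ordered_on_def using set_before_mono by (meson subsetD)

text \<open>Hereditary and spreading in a single condition: \<open>\<phi>\<close> moves the points
  of a subset \<open>H\<close> to the right. Monotonicity is required on \<open>H\<close> only, so
  the parts of a set can be moved separately.\<close>

definition regular_family :: "nat set set \<Rightarrow> bool" where
  "regular_family \<F> \<longleftrightarrow> {} \<in> \<F> \<and> (\<forall>F\<in>\<F>. finite F \<and> F \<subseteq> {1..} \<and>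
     (\<forall>H \<phi>. H \<subseteq> F \<longrightarrow> strict_mono_on H \<phi> \<longrightarrow> (\<forall>i\<in>H. i \<le> \<phi> i) \<longrightarrow> \<phi> ` H \<in> \<F>))"

lemma regular_family_empty: "regular_family \<F> \<Longrightarrow> {} \<in> \<F>"
  and regular_family_finite: "regular_family \<F> \<Longrightarrow> F \<in> \<F> \<Longrightarrow> finite F"
  and regular_family_ge_1: "regular_family \<F> \<Longrightarrow> F \<in> \<F> \<Longrightarrow> i \<in> F \<Longrightarrow> 1 \<le> i"
  and regular_family_spread: "regular_family \<F> \<Longrightarrow> F \<in> \<F> \<Longrightarrow> H \<subseteq> F \<Longrightarrow> strict_mono_on H \<phi> \<Longrightarrow>
    (\<And>i. i \<in> H \<Longrightarrow> i \<le> \<phi> i) \<Longrightarrow> \<phi> ` H \<in> \<F>"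
  unfolding regular_family_def by auto

text \<open>Each block is relabelled by its minimum, so that the set of minima becomes the index set
  \<open>I\<close> itself.\<close>

lemma family_compE:
  assumes "F \<in> family_comp \<F> \<G>" "regular_family \<G>"
  obtains I G where "I \<in> \<F>" "F = (\<Union>i\<in>I. G i)" "\<And>i. i \<in> I \<Longrightarrow> G i \<in> \<G>"
    "\<And>i. i \<in> I \<Longrightarrow> i \<in> G i" "\<And>i. i \<in> I \<Longrightarrow> G i \<subseteq> {i..}" "ordered_on I G"
proof -
  obtain n :: nat and G where F: "F = (\<Union>i<n. G i)"
    and G: "\<And>i. i < n \<Longrightarrow> G i \<in> \<G>" "\<And>i. i < n \<Longrightarrow> G i \<noteq> {}"
    and ord: "\<And>i j. i < j \<Longrightarrow> j < n \<Longrightarrow> set_before (G i) (G j)"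
    and I: "(\<lambda>i. Min (G i)) ` {..<n} \<in> \<F>"
    using assms(1) unfolding family_comp_def by blast
  define \<mu> where "\<mu> i = Min (G i)" for i
  have fin: "finite (G i)" if "i < n" for i
    using regular_family_finite[OF assms(2) G(1)[OF that]] .
  have \<mu>: "\<mu> i \<in> G i" "G i \<subseteq> {\<mu> i..}" if "i < n" for i
    using fin[OF that] G(2)[OF that] by (auto simp: \<mu>_def)
  have mono: "\<mu> i < \<mu> j" if "i < j" "j < n" for i j
    using ord[OF that] \<mu>(1)[of i] \<mu>(1)[of j] that by (auto simp: set_before_def)
  have inj: "inj_on \<mu> {..<n}"
    by (rule linorder_inj_onI) (use mono in force)+
  define \<nu> where "\<nu> = inv_into {..<n} \<mu>"
  have \<nu>: "\<nu> (\<mu> i) = i" if "i < n" for i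
    unfolding \<nu>_def using inj that by (intro inv_into_f_f) auto
  have "F = (\<Union>i\<in>\<mu> ` {..<n}. G (\<nu> i))"
    by (auto simp: F \<nu>)
  moreover have "ordered_on (\<mu> ` {..<n}) (\<lambda>i. G (\<nu> i))"
  proof -
    have "i < j" if "\<mu> i < \<mu> j" "i < n" "j < n" for i j
      using mono[of j i] that by (metis not_less_iff_gr_or_eq order_less_asym)
    then show ?thesis
      by (auto simp: ordered_on_def \<nu> intro: ord)
  qed
  moreover have "\<mu> ` {..<n} \<in> \<F>" using I by (simp add: \<mu>_def)
  ultimately show ?thesis
    by (intro that[of "\<mu> ` {..<n}" "\<lambda>i. G (\<nu> i)"]) (use G \<mu> in \<open>auto simp: \<nu> subset_iff\<close>)
qed

text \<open>Here blocks may be empty and may start after their label. Once the empty ones are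
  discarded, the true minima are a rightward spread of a subset of \<open>I\<close>, and regularity
  keeps them in \<open>\<F>\<close>.\<close>

lemma family_compI:
  assumes \<F>: "regular_family \<F>" and \<G>: "regular_family \<G>" and I: "I \<in> \<F>"
    and G: "\<And>i. i \<in> I \<Longrightarrow> G i \<in> \<G>" "\<And>i. i \<in> I \<Longrightarrow> G i \<subseteq> {i..}" and ord: "ordered_on I G"
  shows "(\<Union>i\<in>I. G i) \<in> family_comp \<F> \<G>"
proof -
  define J where "J = {i \<in> I. G i \<noteq> {}}"
  have finI: "finite I" using regular_family_finite[OF \<F> I] .
  have finG: "finite (G i)" if "i \<in> I" for i
    using regular_family_finite[OF \<G> G(1)[OF that]] .
  define l where "l = sorted_list_of_set J"
  have l: "sorted_wrt (<) l" "set l = J"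
    using finI by (auto simp: l_def J_def)
  have im: "(!) l ` {..<length l} = J"
    using l by (auto simp: set_conv_nth)
  have J: "l ! i \<in> I" "G (l ! i) \<noteq> {}" if "i < length l" for i
    using im that by (auto simp: J_def)
  have "(\<Union>i\<in>I. G i) = (\<Union>i\<in>J. G i)" by (auto simp: J_def)
  also have "\<dots> = (\<Union>i<length l. G (l ! i))" by (simp flip: im)
  finally have un: "(\<Union>i\<in>I. G i) = (\<Union>i<length l. G (l ! i))" .
  have ord': "set_before (G (l ! i)) (G (l ! j))" if "i < j" "j < length l" for i j
    using ordered_onD[OF ord J(1) J(1), of i j] that l by (auto simp: sorted_wrt_iff_nth_less)
  have Min_in: "Min (G i) \<in> G i" if "i \<in> J" for i
    using that finG by (auto simp: J_def)
  have "(\<lambda>i. Min (G i)) ` J \<in> \<F>"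
  proof (rule regular_family_spread[OF \<F> I])
    show "J \<subseteq> I" by (auto simp: J_def)
    then show "strict_mono_on J (\<lambda>i. Min (G i))"
      using ord Min_in unfolding strict_mono_on_def ordered_on_def set_before_def by (meson subsetD)
    show "i \<le> Min (G i)" if "i \<in> J" for i
      using Min_in[OF that] G(2)[of i] that by (auto simp: J_def)
  qed
  also have "(\<lambda>i. Min (G i)) ` J = (\<lambda>i. Min (G (l ! i))) ` {..<length l}"
    by (simp flip: im add: image_image)
  finally have "(\<lambda>i. Min (G (l ! i))) ` {..<length l} \<in> \<F>" .
  then show ?thesis
    unfolding family_comp_def un using J G(1) ord' by blast
qed

lemma regular_schreier0: "regular_family schreier0"
  by (force simp: regular_family_def schreier0_def subset_singleton_iff)

lemma regular_schreier1: "regular_family schreier1"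
proof -
  have "\<phi> ` H \<in> schreier1" if F: "F \<in> schreier1" and H: "H \<subseteq> F" and \<phi>: "strict_mono_on H \<phi>" "\<forall>i\<in>H. i \<le> \<phi> i"
    for F H and \<phi> :: "nat \<Rightarrow> nat"
  proof (cases "H = {}")
    case True
    then show ?thesis by (simp add: schreier1_def)
  next
    case False
    then have F': "finite F" "F \<subseteq> {1..}" "card F \<le> Min F"
      using F H by (auto simp: schreier1_def)
    have finH: "finite H" using F' H finite_subset by blast
    have "card F \<le> \<phi> i" if "i \<in> H" for i
      using F' that H \<phi>(2) Min_le[of F i] by (meson order_trans subsetD)
    moreover have "card (\<phi> ` H) \<le> card F"
      using card_image_le[OF finH] card_mono[OF F'(1) H] order_trans by blast
    ultimately have "card (\<phi> ` H) \<le> Min (\<phi> ` H)"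
      using False finH by (auto intro: order_trans)
    moreover have "\<phi> ` H \<subseteq> {1..}"
      using F'(2) H \<phi>(2) by force
    ultimately show ?thesis
      using False finH by (auto simp: schreier1_def)
  qed
  then show ?thesis
    by (auto simp: regular_family_def) (auto simp: schreier1_def)
qed

text \<open>The image of \<open>H \<inter> G i\<close> under \<open>\<phi>\<close> stays in
  \<open>\<G>\<close> and to the right of \<open>i\<close>, so the old index set \<open>I\<close>
  still serves.\<close>

lemma regular_family_comp:
  assumes \<F>: "regular_family \<F>" and \<G>: "regular_family \<G>"
  shows "regular_family (family_comp \<F> \<G>)"
  unfolding regular_family_def
proof (intro conjI ballI allI impI)
  show "{} \<in> family_comp \<F> \<G>"
    using family_compI[OF \<F> \<G> regular_family_empty[OF \<F>], of "\<lambda>_. {}"] by (simp add: ordered_on_def)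
  fix F assume F: "F \<in> family_comp \<F> \<G>"
  obtain I G where I: "I \<in> \<F>" "F = (\<Union>i\<in>I. G i)" and G: "\<And>i. i \<in> I \<Longrightarrow> G i \<in> \<G>"
    "\<And>i. i \<in> I \<Longrightarrow> i \<in> G i" "\<And>i. i \<in> I \<Longrightarrow> G i \<subseteq> {i..}" "ordered_on I G"
    by (rule family_compE[OF F \<G>]) (rule that; blast)
  show "finite F"
    using I G regular_family_finite[OF \<F>] regular_family_finite[OF \<G>] by blast
  show "F \<subseteq> {1..}"
    using I G regular_family_ge_1[OF \<G>] by force
  fix H \<phi> assume H: "H \<subseteq> F" and \<phi>: "strict_mono_on H \<phi>" "\<forall>i\<in>H. i \<le> \<phi> i"
  have "(\<Union>i\<in>I. \<phi> ` (H \<inter> G i)) \<in> family_comp \<F> \<G>"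
  proof (rule family_compI[OF \<F> \<G> I(1)])
    fix i assume i: "i \<in> I"
    show "\<phi> ` (H \<inter> G i) \<in> \<G>"
      using regular_family_spread[OF \<G> G(1)[OF i], of "H \<inter> G i" \<phi>] \<phi>
      by (auto intro: monotone_on_subset)
    show "\<phi> ` (H \<inter> G i) \<subseteq> {i..}"
      using G(3)[OF i] \<phi>(2) by force
  next
    show "ordered_on I (\<lambda>i. \<phi> ` (H \<inter> G i))"
      using G(4) \<phi>(1) unfolding ordered_on_def set_before_def strict_mono_on_def by blast
  qed
  moreover have "(\<Union>i\<in>I. \<phi> ` (H \<inter> G i)) = \<phi> ` H"
    using H I(2) by blast
  ultimately show "\<phi> ` H \<in> family_comp \<F> \<G>" by simp
qed

text \<open>A two-level decomposition is flattened: the labels \<open>J i\<close> of the inner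
  blocks of \<open>G i\<close> are collected over all \<open>i\<close>. Since \<open>J i\<close>
  lies in \<open>G i\<close>, this collection belongs to the composition of \<open>\<A>\<close> and
  \<open>\<B>\<close>.\<close>

lemma family_comp_assoc:
  assumes \<A>: "regular_family \<A>" and \<B>: "regular_family \<B>" and \<C>: "regular_family \<C>"
  shows "family_comp \<A> (family_comp \<B> \<C>) \<subseteq> family_comp (family_comp \<A> \<B>) \<C>"
proof
  note \<B>\<C> = regular_family_comp[OF \<B> \<C>] and \<A>\<B> = regular_family_comp[OF \<A> \<B>]
  fix F assume F: "F \<in> family_comp \<A> (family_comp \<B> \<C>)"
  obtain I G where I: "I \<in> \<A>" "F = (\<Union>i\<in>I. G i)" and G: "\<And>i. i \<in> I \<Longrightarrow> G i \<in> family_comp \<B> \<C>"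
    "\<And>i. i \<in> I \<Longrightarrow> i \<in> G i" "\<And>i. i \<in> I \<Longrightarrow> G i \<subseteq> {i..}" "ordered_on I G"
    by (rule family_compE[OF F \<B>\<C>]) (rule that; blast)
  have "\<forall>i\<in>I. \<exists>J H. J \<in> \<B> \<and> G i = (\<Union>j\<in>J. H j) \<and> (\<forall>j\<in>J. H j \<in> \<C> \<and> j \<in> H j \<and> H j \<subseteq> {j..})
     \<and> ordered_on J H"
    using family_compE[OF G(1) \<C>] by metis
  then obtain J H where J: "\<And>i. i \<in> I \<Longrightarrow> J i \<in> \<B>" "\<And>i. i \<in> I \<Longrightarrow> G i = (\<Union>j\<in>J i. H i j)"
    and H: "\<And>i j. i \<in> I \<Longrightarrow> j \<in> J i \<Longrightarrow> H i j \<in> \<C> \<and> j \<in> H i j \<and> H i j \<subseteq> {j..}"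
    and ordH: "\<And>i. i \<in> I \<Longrightarrow> ordered_on (J i) (H i)"
    unfolding bchoice_iff by metis
  have JG: "J i \<subseteq> G i" if "i \<in> I" for i
    using J(2)[OF that] H[OF that] by blast
  have ordJ: "ordered_on I J"
    using ordered_on_mono[OF G(4)] JG by blast
  \<comment> \<open>The sets \<open>J i\<close> are disjoint because the \<open>G i\<close> are
    ordered, so \<open>\<mu> j\<close> recovers the outer block from the label of an inner
    one.\<close>
  define \<mu> where "\<mu> j = (SOME i. i \<in> I \<and> j \<in> J i)" for j
  have \<mu>: "\<mu> j = i" if "i \<in> I" "j \<in> J i" for i j
    unfolding \<mu>_def
  proof (rule some_equality)
    show "i' = i" if "i' \<in> I \<and> j \<in> J i'" for i'
      using ordJ that \<open>i \<in> I\<close> \<open>j \<in> J i\<close> unfolding ordered_on_def set_before_def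
      by (metis less_irrefl linorder_neqE_nat)
  qed (use that in auto)
  have "(\<Union>j\<in>(\<Union>i\<in>I. J i). H (\<mu> j) j) \<in> family_comp (family_comp \<A> \<B>) \<C>"
  proof (rule family_compI[OF \<A>\<B> \<C>])
    show "(\<Union>i\<in>I. J i) \<in> family_comp \<A> \<B>"
      using family_compI[OF \<A> \<B> I(1) J(1) _ ordJ] JG G(3) by blast
    show "H (\<mu> j) j \<in> \<C>" "H (\<mu> j) j \<subseteq> {j..}" if j: "j \<in> (\<Union>i\<in>I. J i)" for j
    proof -
      obtain i where "i \<in> I" "j \<in> J i" using j by blast
      then show "H (\<mu> j) j \<in> \<C>" "H (\<mu> j) j \<subseteq> {j..}" using H by (simp_all add: \<mu>)
    qed
    show "ordered_on (\<Union>i\<in>I. J i) (\<lambda>j. H (\<mu> j) j)"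
      unfolding ordered_on_def
    proof (intro ballI impI)
      fix j j' assume "j \<in> (\<Union>i\<in>I. J i)" "j' \<in> (\<Union>i\<in>I. J i)" and less: "j < j'"
      then obtain i i' where i: "i \<in> I" "j \<in> J i" "i' \<in> I" "j' \<in> J i'" by blast
      show "set_before (H (\<mu> j) j) (H (\<mu> j') j')"
      proof (cases "i = i'")
        case True
        then show ?thesis
          using i less ordH by (auto simp: \<mu> ordered_on_def)
      next
        case False
        have "\<not> i' < i"
          using ordered_onD[OF ordJ, of i' i] i less by (metis set_before_def less_asym)
        then have "set_before (G i) (G i')"
          using ordered_onD[OF G(4), of i i'] False i by auto
        then show ?thesis
          by (rule set_before_mono) (use i J(2) in \<open>auto simp: \<mu>\<close>)
      qed
    qed
  qed
  moreover have "(\<Union>j\<in>(\<Union>i\<in>I. J i). H (\<mu> j) j) = F"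
    using I(2) J(2) by (auto simp: \<mu>)
  ultimately show "F \<in> family_comp (family_comp \<A> \<B>) \<C>" by simp
qed

section \<open>Schreier classes and ordinal sums\<close>

locale schreier_classes =
  fixes a :: "omega1 \<Rightarrow> nat \<Rightarrow> omega1"
  assumes fund: "fundamental_sequences a"
begin

abbreviation \<S> :: "omega1 \<Rightarrow> nat set set" where "\<S> \<equiv> schreier a"

lemma fund_less: "limit_ord \<alpha> \<Longrightarrow> 1 \<le> n \<Longrightarrow> a \<alpha> n < \<alpha>"
  and fund_cofinal: "limit_ord \<alpha> \<Longrightarrow> \<beta> < \<alpha> \<Longrightarrow> \<exists>n\<ge>1. \<beta> < a \<alpha> n"
  using fund by (auto simp: fundamental_sequences_def)

lemma schreier_limitE:
  assumes "limit_ord \<alpha>" "F \<in> \<S> \<alpha>"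
  obtains n where "1 \<le> n" "F \<in> \<S> (a \<alpha> n)" "F \<subseteq> {n..}"
  using assms schreier_limit[OF fund, of \<alpha>] by (auto intro: that)

lemma schreier_limitI:
  "limit_ord \<alpha> \<Longrightarrow> 1 \<le> n \<Longrightarrow> F \<in> \<S> (a \<alpha> n) \<Longrightarrow> F \<subseteq> {n..} \<Longrightarrow> F \<in> \<S> \<alpha>"
  using schreier_limit[OF fund] by auto

text \<open>At a limit, rightward spreads of a set in \<open>{n..}\<close> stay in
  \<open>{n..}\<close>, so they enter the class through the same \<open>n\<close>.\<close>

lemma regular_schreier: "regular_family (\<S> \<alpha>)"
proof (induction \<alpha> rule: omega1_induct)
  case zero
  then show ?case by (simp add: schreier_0 regular_schreier0)
next
  case (osuc \<alpha>)
  then show ?case by (simp add: schreier_osuc regular_family_comp regular_schreier1)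
next
  case (limit \<alpha>)
  have IH: "regular_family (\<S> (a \<alpha> n))" if "1 \<le> n" for n
    using limit fund_less that by blast
  show ?case
    unfolding regular_family_def
  proof (intro conjI ballI allI impI)
    show "{} \<in> \<S> \<alpha>"
      by (rule schreier_limitI[OF limit(1), of 1]) (use regular_family_empty IH in auto)
    fix F assume "F \<in> \<S> \<alpha>"
    then obtain n where n: "1 \<le> n" "F \<in> \<S> (a \<alpha> n)" "F \<subseteq> {n..}"
      using schreier_limitE limit(1) by blast
    show "finite F" "F \<subseteq> {1..}"
      using regular_family_finite[OF IH] regular_family_ge_1[OF IH] n by auto
    fix H and \<phi> :: "nat \<Rightarrow> nat"
    assume "H \<subseteq> F" "strict_mono_on H \<phi>" "\<forall>i\<in>H. i \<le> \<phi> i"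
    then show "\<phi> ` H \<in> \<S> \<alpha>"
      using n by (intro schreier_limitI[OF limit(1), of n] regular_family_spread[OF IH]) force+
  qed
qed

lemmas schreier_finite = regular_family_finite[OF regular_schreier]
  and schreier_ge_1 = regular_family_ge_1[OF regular_schreier]
  and schreier_empty = regular_family_empty[OF regular_schreier]
  and schreier_spread = regular_family_spread[OF regular_schreier]

text \<open>The whole set is taken as one block, labelled by its minimum; a singleton of a positive
  integer is in \<open>schreier1\<close>.\<close>

lemma schreier_Suc_mono: "\<S> \<alpha> \<subseteq> \<S> (osuc \<alpha>)"
proof
  fix F assume F: "F \<in> \<S> \<alpha>"
  show "F \<in> \<S> (osuc \<alpha>)"
  proof (cases "F = {}")
    case False
    define m where "m = Min F"
    have m: "m \<in> F" "F \<subseteq> {m..}"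
      using False schreier_finite[OF F] by (auto simp: m_def)
    have "{m} \<in> schreier1"
      using schreier_ge_1[OF F m(1)] by (auto simp: schreier1_def)
    then show ?thesis
      using family_compI[OF regular_schreier1 regular_schreier, of "{m}" "\<lambda>_. F" \<alpha>] F m
      by (simp add: schreier_osuc ordered_on_def)
  qed (simp add: schreier_empty)
qed

lemma schreier_almost_mono:
  assumes "\<alpha> \<le> \<beta>"
  shows "\<exists>p. \<forall>F\<in>\<S> \<alpha>. F \<subseteq> {p..} \<longrightarrow> F \<in> \<S> \<beta>"
  using assms
proof (induction \<beta> rule: omega1_induct)
  case zero
  then have "\<alpha> = 0" by (simp add: order.antisym)
  then show ?case by auto
next
  case (osuc \<beta>)
  show ?case
  proof (cases "\<alpha> = osuc \<beta>")
    case False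
    then show ?thesis
      using osuc schreier_Suc_mono[of \<beta>] by (metis less_osuc_iff order.not_eq_order_implies_strict subsetD)
  qed auto
next
  case (limit \<beta>)
  show ?case
  proof (cases "\<alpha> = \<beta>")
    case False
    then obtain n where n: "1 \<le> n" "\<alpha> < a \<beta> n"
      using fund_cofinal[OF limit(1)] limit.prems by (meson order.not_eq_order_implies_strict)
    obtain p where p: "\<forall>F\<in>\<S> \<alpha>. F \<subseteq> {p..} \<longrightarrow> F \<in> \<S> (a \<beta> n)"
      using limit.IH[OF fund_less[OF limit(1) n(1)] less_imp_le[OF n(2)]] by blast
    show ?thesis
      by (intro exI[of _ "max p n"] ballI impI schreier_limitI[OF limit(1) n(1)]) (use p in force)+
  qed auto
qed

lemma schreier_singleton: "1 \<le> n \<Longrightarrow> {n} \<in> \<S> \<alpha>"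
proof (induction \<alpha> rule: omega1_induct)
  case zero
  then show ?case by (simp add: schreier_0 schreier0_def)
next
  case (osuc \<alpha>)
  then show ?case using schreier_Suc_mono by blast
next
  case (limit \<alpha>)
  then show ?case
    using fund_less[of \<alpha> 1] by (intro schreier_limitI[of \<alpha> 1]) auto
qed

text \<open>The blocks have to start beyond \<open>f i\<close>, not merely beyond \<open>i\<close>,
  because the fundamental sequences of \<open>\<alpha>\<close> and \<open>\<beta> + \<alpha>\<close>
  are unrelated. For \<open>\<alpha> = 0\<close> there is at most one block; at a successor the
  blocks are grouped along the \<open>schreier1\<close> decomposition of \<open>I\<close>; at a
  limit, the functions of the stages are diagonalized.\<close>

lemma family_comp_schreier_subset:
  "\<exists>f. (\<forall>i. i \<le> f i) \<and> (\<forall>I\<in>\<S> \<alpha>. \<forall>G. (\<forall>i\<in>I. G i \<in> \<S> \<beta> \<and> G i \<subseteq> {f i..}) \<longrightarrow> ordered_on I G \<longrightarrow>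
     (\<Union>i\<in>I. G i) \<in> \<S> (\<beta> + \<alpha>))"
proof (induction \<alpha> rule: omega1_induct)
  case zero
  have "(\<Union>i\<in>I. G i) \<in> \<S> (\<beta> + 0)" if "I \<in> \<S> 0" "\<forall>i\<in>I. G i \<in> \<S> \<beta> \<and> G i \<subseteq> {i..}" for I G
    using that schreier_empty[of \<beta>] by (auto simp: schreier_0 schreier0_def add_zero_omega1)
  then show ?case by (intro exI[of _ "\<lambda>i. i"]) auto
next
  case (osuc \<alpha>)
  then obtain f where f: "\<And>i. i \<le> f i" and un: "\<And>I G. I \<in> \<S> \<alpha> \<Longrightarrow>
    (\<And>i. i \<in> I \<Longrightarrow> G i \<in> \<S> \<beta> \<and> G i \<subseteq> {f i..}) \<Longrightarrow> ordered_on I G \<Longrightarrow> (\<Union>i\<in>I. G i) \<in> \<S> (\<beta> + \<alpha>)"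
    by (metis (no_types))
  have "(\<Union>i\<in>I. G i) \<in> \<S> (\<beta> + osuc \<alpha>)"
    if I: "I \<in> \<S> (osuc \<alpha>)" and G: "\<forall>i\<in>I. G i \<in> \<S> \<beta> \<and> G i \<subseteq> {f i..}" and ord: "ordered_on I G" for I G
  proof -
    obtain M J where M: "M \<in> schreier1" "I = (\<Union>m\<in>M. J m)" and J: "\<And>m. m \<in> M \<Longrightarrow> J m \<in> \<S> \<alpha>"
      "\<And>m. m \<in> M \<Longrightarrow> m \<in> J m" "\<And>m. m \<in> M \<Longrightarrow> J m \<subseteq> {m..}" "ordered_on M J"
      by (rule family_compE[OF I[unfolded schreier_osuc] regular_schreier]) (rule that; blast)
    have "(\<Union>m\<in>M. \<Union>i\<in>J m. G i) \<in> family_comp schreier1 (\<S> (\<beta> + \<alpha>))"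
    proof (rule family_compI[OF regular_schreier1 regular_schreier M(1)])
      fix m assume m: "m \<in> M"
      show "(\<Union>i\<in>J m. G i) \<in> \<S> (\<beta> + \<alpha>)"
      proof (rule un[OF J(1)[OF m]])
        show "ordered_on (J m) G"
          using ordered_on_mono[OF ord] m M(2) by blast
      qed (use m M(2) G in blast)
      show "(\<Union>i\<in>J m. G i) \<subseteq> {m..}"
      proof
        fix k assume "k \<in> (\<Union>i\<in>J m. G i)"
        then obtain i where i: "i \<in> J m" "k \<in> G i" by blast
        then have "m \<le> i" "f i \<le> k"
          using J(3)[OF m] G M(2) m by auto
        with f[of i] show "k \<in> {m..}" by simp
      qed
    next
      show "ordered_on M (\<lambda>m. \<Union>i\<in>J m. G i)"
        unfolding ordered_on_def
      proof (intro ballI impI)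
        fix m m' assume m: "m \<in> M" "m' \<in> M" "m < m'"
        have "set_before (G i) (G i')" if "i \<in> J m" "i' \<in> J m'" for i i'
          using ordered_onD[OF ord, of i i'] ordered_onD[OF J(4) m] that m M(2)
          by (auto simp: set_before_def)
        then show "set_before (\<Union>i\<in>J m. G i) (\<Union>i\<in>J m'. G i)"
          unfolding set_before_def by blast
      qed
    qed
    moreover have "(\<Union>m\<in>M. \<Union>i\<in>J m. G i) = (\<Union>i\<in>I. G i)" using M(2) by blast
    ultimately show ?thesis by (simp add: add_osuc_omega1 schreier_osuc)
  qed
  then show ?case using f by blast
next
  case (limit \<alpha>)
  note lim = limit_ord_add[OF limit(1), of \<beta>]
  \<comment> \<open>Stage \<open>k\<close> of \<open>\<alpha>\<close> is matched with a stage
    \<open>l\<close> of \<open>\<beta> + \<alpha>\<close> whose index exceeds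
    \<open>\<beta> + a \<alpha> k\<close>; \<open>p\<close> is the threshold for passing from one
    class to the other.\<close>
  have "\<exists>f p l. 1 \<le> l \<and> (\<forall>I\<in>\<S> (a \<alpha> k). \<forall>G. (\<forall>i\<in>I. G i \<in> \<S> \<beta> \<and> G i \<subseteq> {f i..}) \<longrightarrow> ordered_on I G \<longrightarrow>
     (\<Union>i\<in>I. G i) \<subseteq> {p..} \<longrightarrow> (\<Union>i\<in>I. G i) \<in> \<S> (a (\<beta> + \<alpha>) l))" if k: "1 \<le> k" for k
  proof -
    note less = fund_less[OF limit(1) k]
    obtain f where f: "\<forall>I\<in>\<S> (a \<alpha> k). \<forall>G. (\<forall>i\<in>I. G i \<in> \<S> \<beta> \<and> G i \<subseteq> {f i..}) \<longrightarrow> ordered_on I G \<longrightarrow>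
     (\<Union>i\<in>I. G i) \<in> \<S> (\<beta> + a \<alpha> k)"
      using limit.IH[OF less] by blast
    obtain l where l: "1 \<le> l" "\<beta> + a \<alpha> k < a (\<beta> + \<alpha>) l"
      using fund_cofinal[OF lim add_omega1_strict_mono[OF less]] by blast
    obtain p where p: "\<forall>F\<in>\<S> (\<beta> + a \<alpha> k). F \<subseteq> {p..} \<longrightarrow> F \<in> \<S> (a (\<beta> + \<alpha>) l)"
      using schreier_almost_mono l(2) by (metis less_imp_le)
    show ?thesis
      by (rule exI[of _ f], rule exI[of _ p], rule exI[of _ l]) (use l f p in blast)
  qed
  then obtain f p l where l: "\<And>k. 1 \<le> k \<Longrightarrow> 1 \<le> l k"
    and un: "\<And>k I G. 1 \<le> k \<Longrightarrow> I \<in> \<S> (a \<alpha> k) \<Longrightarrow> (\<forall>i\<in>I. G i \<in> \<S> \<beta> \<and> G i \<subseteq> {f k i..}) \<Longrightarrow>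
      ordered_on I G \<Longrightarrow> (\<Union>i\<in>I. G i) \<subseteq> {p k..} \<Longrightarrow> (\<Union>i\<in>I. G i) \<in> \<S> (a (\<beta> + \<alpha>) (l k))"
    by metis
  \<comment> \<open>The stage \<open>k\<close> through which \<open>I\<close> enters the limit class
    is at most every \<open>i \<in> I\<close>, so it suffices that \<open>g i\<close> dominates the
    data of the stages \<open>k \<le> i\<close>.\<close>
  define g where "g i = i + (\<Sum>k\<le>i. f k i + p k + l k)" for i :: nat
  have g: "f k i \<le> g i" "p k \<le> g i" "l k \<le> g i" if "k \<le> i" for k i
  proof -
    have "f k i + p k + l k \<le> (\<Sum>k\<le>i. f k i + p k + l k)"
      by (rule member_le_sum) (use that in auto)
    then show "f k i \<le> g i" "p k \<le> g i" "l k \<le> g i" by (auto simp: g_def)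
  qed
  have "(\<Union>i\<in>I. G i) \<in> \<S> (\<beta> + \<alpha>)"
    if I: "I \<in> \<S> \<alpha>" and G: "\<forall>i\<in>I. G i \<in> \<S> \<beta> \<and> G i \<subseteq> {g i..}" and ord: "ordered_on I G" for I G
  proof -
    obtain k where k: "1 \<le> k" "I \<in> \<S> (a \<alpha> k)" "I \<subseteq> {k..}"
      using schreier_limitE[OF limit(1) I] .
    have *: "f k i \<le> x \<and> p k \<le> x \<and> l k \<le> x" if "i \<in> I" "x \<in> G i" for i x
      using g[of k i] that k(3) G by (meson atLeast_iff order_trans subsetD)
    show ?thesis
      by (rule schreier_limitI[OF lim l[OF k(1)] un[OF k(1,2) _ ord]]) (use * G in auto)
  qed
  then show ?case by (intro exI[of _ g]) (auto simp: g_def)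
qed

text \<open>A converse to the previous inclusion, again up to spreading. Since \<open>\<phi>\<close>
  is arbitrary above \<open>g\<close>, one map can be restricted to all blocks in the successor
  step, where associativity of the composition regroups the result.\<close>

lemma schreier_subset_family_comp:
  "\<exists>g. (\<forall>i. i \<le> g i) \<and> (\<forall>G\<in>\<S> (\<beta> + \<alpha>). \<forall>\<phi>. strict_mono_on G \<phi> \<longrightarrow> (\<forall>i\<in>G. g i \<le> \<phi> i) \<longrightarrow>
     \<phi> ` G \<in> family_comp (\<S> \<alpha>) (\<S> \<beta>))"
proof (induction \<alpha> rule: omega1_induct)
  case zero
  have "\<phi> ` G \<in> family_comp (\<S> 0) (\<S> \<beta>)"
    if G: "G \<in> \<S> (\<beta> + 0)" and \<phi>: "strict_mono_on G \<phi>" "\<forall>i\<in>G. i \<le> \<phi> i" for G \<phi>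
  proof -
    have *: "\<phi> ` G \<in> \<S> \<beta>"
      using schreier_spread[of G \<beta> G \<phi>] G \<phi> by (simp add: add_zero_omega1)
    show ?thesis
    proof (cases "G = {}")
      case True
      then show ?thesis
        using regular_family_empty regular_family_comp regular_schreier by simp
    next
      case False
      let ?m = "Min (\<phi> ` G)"
      have m: "?m \<in> \<phi> ` G" "\<phi> ` G \<subseteq> {?m..}"
        using False schreier_finite[OF *] by (auto simp del: Min_le_iff)
      then show ?thesis
        using family_compI[OF regular_schreier regular_schreier schreier_singleton[of ?m],
            of "\<lambda>_. \<phi> ` G" \<beta> 0] * schreier_ge_1[OF * m(1)]
        by (simp add: ordered_on_def)
    qed
  qed
  then show ?case by (intro exI[of _ "\<lambda>i. i"]) blast
next
  case (osuc \<alpha>)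
  then obtain g where g: "\<And>i. i \<le> g i" and IH: "\<And>G \<phi>. G \<in> \<S> (\<beta> + \<alpha>) \<Longrightarrow> strict_mono_on G \<phi> \<Longrightarrow>
      (\<And>i. i \<in> G \<Longrightarrow> g i \<le> \<phi> i) \<Longrightarrow> \<phi> ` G \<in> family_comp (\<S> \<alpha>) (\<S> \<beta>)"
    by (metis (no_types))
  note reg = regular_schreier1 regular_schreier
  have "\<phi> ` G \<in> family_comp (\<S> (osuc \<alpha>)) (\<S> \<beta>)"
    if G: "G \<in> \<S> (\<beta> + osuc \<alpha>)" and \<phi>: "strict_mono_on G \<phi>" "\<forall>i\<in>G. g i \<le> \<phi> i" for G \<phi>
  proof -
    obtain M J where M: "M \<in> schreier1" "G = (\<Union>m\<in>M. J m)" and J: "\<And>m. m \<in> M \<Longrightarrow> J m \<in> \<S> (\<beta> + \<alpha>)"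
      "\<And>m. m \<in> M \<Longrightarrow> m \<in> J m" "\<And>m. m \<in> M \<Longrightarrow> J m \<subseteq> {m..}" "ordered_on M J"
      by (rule family_compE[OF G[unfolded add_osuc_omega1 schreier_osuc] regular_schreier]) (rule that; blast)
    have "(\<Union>m\<in>M. \<phi> ` J m) \<in> family_comp schreier1 (family_comp (\<S> \<alpha>) (\<S> \<beta>))"
    proof (rule family_compI[OF _ _ M(1)])
      fix m assume m: "m \<in> M"
      then have sub: "J m \<subseteq> G" using M(2) by blast
      show "\<phi> ` J m \<in> family_comp (\<S> \<alpha>) (\<S> \<beta>)"
        by (rule IH[OF J(1)[OF m]]) (use sub \<phi> monotone_on_subset in blast)+
      show "\<phi> ` J m \<subseteq> {m..}"
      proof clarsimp
        fix i assume "i \<in> J m"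
        then have "m \<le> i" "g i \<le> \<phi> i" using J(3)[OF m] sub \<phi>(2) by auto
        with g[of i] show "m \<le> \<phi> i" by simp
      qed
    next
      show "ordered_on M (\<lambda>m. \<phi> ` J m)"
        using J(4) \<phi>(1) M(2) unfolding ordered_on_def set_before_def strict_mono_on_def by blast
    qed (auto intro: reg regular_family_comp)
    also have "(\<Union>m\<in>M. \<phi> ` J m) = \<phi> ` G" using M(2) by blast
    finally show ?thesis
      using family_comp_assoc[OF reg(1) reg(2) reg(2)] by (auto simp: schreier_osuc)
  qed
  then show ?case using g by blast
next
  case (limit \<alpha>)
  note lim = limit_ord_add[OF limit(1), of \<beta>]
  have "\<exists>k g p. 1 \<le> k \<and> (\<forall>G\<in>\<S> (a (\<beta> + \<alpha>) l). G \<subseteq> {p..} \<longrightarrow> (\<forall>\<phi>. strict_mono_on G \<phi> \<longrightarrow>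
      (\<forall>i\<in>G. g i \<le> \<phi> i) \<longrightarrow> \<phi> ` G \<in> family_comp (\<S> (a \<alpha> k)) (\<S> \<beta>)))" if l: "1 \<le> l" for l
  proof -
    \<comment> \<open>A stage of \<open>\<beta> + \<alpha>\<close> lies below some
      \<open>\<beta> + \<delta>\<close> with \<open>\<delta> < \<alpha>\<close>, and hence below
      \<open>\<beta> + a \<alpha> k\<close> for a stage \<open>k\<close> of \<open>\<alpha>\<close>
      beyond \<open>\<delta>\<close>.\<close>
    obtain \<delta> where \<delta>: "\<delta> < \<alpha>" "a (\<beta> + \<alpha>) l < \<beta> + \<delta>"
      using fund_less[OF lim l] add_limit_omega1[OF limit(1)] by (meson not_le)
    obtain k where k: "1 \<le> k" "\<delta> < a \<alpha> k"
      using fund_cofinal[OF limit(1) \<delta>(1)] by blast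
    have "a (\<beta> + \<alpha>) l \<le> \<beta> + a \<alpha> k"
      using \<delta>(2) add_omega1_strict_mono[OF k(2)] by (meson less_imp_le less_trans)
    then obtain p where p: "\<forall>F\<in>\<S> (a (\<beta> + \<alpha>) l). F \<subseteq> {p..} \<longrightarrow> F \<in> \<S> (\<beta> + a \<alpha> k)"
      using schreier_almost_mono by blast
    obtain g where "\<forall>G\<in>\<S> (\<beta> + a \<alpha> k). \<forall>\<phi>. strict_mono_on G \<phi> \<longrightarrow> (\<forall>i\<in>G. g i \<le> \<phi> i) \<longrightarrow>
        \<phi> ` G \<in> family_comp (\<S> (a \<alpha> k)) (\<S> \<beta>)"
      using limit.IH[OF fund_less[OF limit(1) k(1)]] by blast
    then have "1 \<le> k \<and> (\<forall>G\<in>\<S> (a (\<beta> + \<alpha>) l). G \<subseteq> {p..} \<longrightarrow> (\<forall>\<phi>. strict_mono_on G \<phi> \<longrightarrow>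
      (\<forall>i\<in>G. g i \<le> \<phi> i) \<longrightarrow> \<phi> ` G \<in> family_comp (\<S> (a \<alpha> k)) (\<S> \<beta>)))"
      using k(1) p by (intro conjI ballI impI) simp_all
    then show ?thesis by (intro exI)
  qed
  then have "\<forall>l. \<exists>k g p. 1 \<le> l \<longrightarrow> 1 \<le> k \<and> (\<forall>G\<in>\<S> (a (\<beta> + \<alpha>) l). G \<subseteq> {p..} \<longrightarrow>
      (\<forall>\<phi>. strict_mono_on G \<phi> \<longrightarrow> (\<forall>i\<in>G. g i \<le> \<phi> i) \<longrightarrow>
        \<phi> ` G \<in> family_comp (\<S> (a \<alpha> k)) (\<S> \<beta>)))" (is "\<forall>l. \<exists>k g p. ?P l k g p")
    by auto
  then obtain k g p where kgp: "\<And>l. ?P l (k l) (g l) (p l)"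
    unfolding choice_iff by auto
  have k: "1 \<le> k l" if "1 \<le> l" for l
    using kgp that by auto
  have IH: "\<phi> ` G \<in> family_comp (\<S> (a \<alpha> (k l))) (\<S> \<beta>)" if "1 \<le> l" "G \<in> \<S> (a (\<beta> + \<alpha>) l)"
    "G \<subseteq> {p l..}" "strict_mono_on G \<phi>" "\<And>i. i \<in> G \<Longrightarrow> g l i \<le> \<phi> i" for l G \<phi>
    using kgp[of l] that by simp
  \<comment> \<open>The function \<open>g l\<close> is evaluated at \<open>i + p l\<close> because
    it will be applied to a translate of the set by \<open>p l\<close>. The summand
    \<open>k l\<close> pushes the labels of the blocks beyond \<open>k l\<close>, as membership in
    the limit class demands.\<close>
  define h where "h i = i + (\<Sum>l\<le>i. g l (i + p l) + k l)" for i
  have h: "g l (i + p l) \<le> h i" "k l \<le> h i" if "l \<le> i" for l i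
  proof -
    have "g l (i + p l) + k l \<le> (\<Sum>l\<le>i. g l (i + p l) + k l)"
      by (rule member_le_sum) (use that in auto)
    then show "g l (i + p l) \<le> h i" "k l \<le> h i" by (auto simp: h_def)
  qed
  have "\<phi> ` G \<in> family_comp (\<S> \<alpha>) (\<S> \<beta>)"
    if G: "G \<in> \<S> (\<beta> + \<alpha>)" and \<phi>: "strict_mono_on G \<phi>" "\<forall>i\<in>G. h i \<le> \<phi> i" for G \<phi>
  proof -
    obtain l where l: "1 \<le> l" "G \<in> \<S> (a (\<beta> + \<alpha>) l)" "G \<subseteq> {l..}"
      using schreier_limitE[OF lim G] .
    \<comment> \<open>Translating \<open>G\<close> by \<open>p l\<close> makes it large enough to lie in the class of index \<open>\<beta> + a \<alpha> (k l)\<close>.\<close>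
    define \<phi>' where "\<phi>' i = \<phi> (i - p l)" for i
    have im: "\<phi>' ` (\<lambda>i. i + p l) ` G = \<phi> ` G"
      by (auto simp: \<phi>'_def image_image)
    have "\<phi>' ` (\<lambda>i. i + p l) ` G \<in> family_comp (\<S> (a \<alpha> (k l))) (\<S> \<beta>)"
    proof (rule IH[OF l(1)])
      show "(\<lambda>i. i + p l) ` G \<in> \<S> (a (\<beta> + \<alpha>) l)"
        by (rule schreier_spread[OF l(2)]) (auto simp: strict_mono_on_def)
      show "strict_mono_on ((\<lambda>i. i + p l) ` G) \<phi>'"
        using \<phi>(1) by (auto simp: strict_mono_on_def \<phi>'_def)
      show "g l i \<le> \<phi>' i" if i: "i \<in> (\<lambda>i. i + p l) ` G" for i
      proof -
        obtain j where j: "j \<in> G" "i = j + p l" using i by blast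
        with l(3) have "l \<le> j" by auto
        with j \<phi>(2) h(1)[of l j] show ?thesis by (auto simp: \<phi>'_def intro: order_trans)
      qed
    qed auto
    then obtain I H where I: "I \<in> \<S> (a \<alpha> (k l))" "\<phi> ` G = (\<Union>i\<in>I. H i)"
      and H: "\<And>i. i \<in> I \<Longrightarrow> H i \<in> \<S> \<beta>" "\<And>i. i \<in> I \<Longrightarrow> i \<in> H i" "\<And>i. i \<in> I \<Longrightarrow> H i \<subseteq> {i..}"
        "ordered_on I H"
      using family_compE[OF _ regular_schreier] unfolding im by metis
    have "k l \<le> i" if "i \<in> I" for i
    proof -
      obtain j where j: "j \<in> G" "i = \<phi> j" using I(2) H(2) \<open>i \<in> I\<close> by blast
      with l(3) have "l \<le> j" by auto
      with j \<phi>(2) h(2)[of l j] show ?thesis by (auto intro: order_trans)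
    qed
    then have "I \<in> \<S> \<alpha>"
      by (intro schreier_limitI[OF limit(1) k[OF l(1)] I(1)]) auto
    then show ?thesis
      unfolding I(2) by (intro family_compI regular_schreier H)
  qed
  then show ?case by (intro exI[of _ h]) (auto simp: h_def)
qed

end

section \<open>Basis projections\<close>

lemma span_range_finite_sum:
  assumes "v \<in> span (range (x :: nat \<Rightarrow> 'a::real_vector))"
  obtains c n where "v = (\<Sum>i<n. c i *\<^sub>R x i)" "\<And>i. n \<le> i \<Longrightarrow> c i = 0"
proof -
  have "\<exists>c n. v = (\<Sum>i<n. c i *\<^sub>R x i) \<and> (\<forall>i\<ge>n. c i = 0)"
    using assms
  proof (induction rule: span_induct_alt)
    case base
    show ?case by (intro exI[of _ "\<lambda>_. 0"] exI[of _ 0]) auto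
  next
    case (step k w v)
    then obtain j c n where j: "w = x j" and v: "v = (\<Sum>i<n. c i *\<^sub>R x i)" "\<forall>i\<ge>n. c i = 0"
      by blast
    define n' where "n' = max n (Suc j)"
    define c' where "c' i = c i + (if i = j then k else 0)" for i
    have "v = (\<Sum>i<n'. c i *\<^sub>R x i)"
      unfolding v(1) by (rule sum.mono_neutral_left) (use v(2) in \<open>auto simp: n'_def\<close>)
    moreover have "(\<Sum>i<n'. (if i = j then k else 0) *\<^sub>R x i) = k *\<^sub>R x j"
    proof -
      have "(\<Sum>i<n'. (if i = j then k else 0) *\<^sub>R x i) = (\<Sum>i\<in>{j}. (if i = j then k else 0) *\<^sub>R x i)"
        by (rule sum.mono_neutral_right) (auto simp: n'_def)
      then show ?thesis by simp
    qed
    ultimately have "k *\<^sub>R w + v = (\<Sum>i<n'. c' i *\<^sub>R x i)"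
      by (simp add: c'_def j scaleR_add_left sum.distrib)
    moreover have "\<forall>i\<ge>n'. c' i = 0"
      using v(2) by (auto simp: c'_def n'_def)
    ultimately show ?case by blast
  qed
  then show ?thesis using that by blast
qed

text \<open>The partial-sum projections of \<open>x\<close> are assumed to extend to the whole space. For a block
  basis of a Schauder basis of the space they do, which avoids expansions of vectors in the closed
  span of \<open>x\<close>.\<close>

locale projections =
  fixes x :: "nat \<Rightarrow> 'a::banach" and Q :: "nat \<Rightarrow> 'a \<Rightarrow> 'a" and K :: real
  assumes nonzero: "x i \<noteq> 0"
    and bounded_linear_Q: "bounded_linear (Q m)"
    and norm_Q: "norm (Q m v) \<le> K * norm v"
    and Q_basis: "Q m (x i) = (if i < m then x i else 0)"
begin

lemma linear_Q: "linear (Q m)"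
  using bounded_linear_Q by (rule bounded_linear.linear)

lemma K_ge_1: "1 \<le> K"
proof -
  have "norm (x 0) \<le> K * norm (x 0)"
    using norm_Q[of 1 "x 0"] by (simp add: Q_basis)
  then show ?thesis using nonzero[of 0] by simp
qed

lemma Q_sums:
  assumes "(\<lambda>i. c i *\<^sub>R x i) sums v"
  shows "Q m v = (\<Sum>i<m. c i *\<^sub>R x i)"
proof -
  have "(\<lambda>i. Q m (c i *\<^sub>R x i)) sums Q m v"
    using bounded_linear.sums[OF bounded_linear_Q assms] .
  moreover have "(\<lambda>i. Q m (c i *\<^sub>R x i)) sums (\<Sum>i<m. Q m (c i *\<^sub>R x i))"
    by (rule sums_finite) (auto simp: linear_cmul[OF linear_Q] Q_basis)
  moreover have "(\<Sum>i<m. Q m (c i *\<^sub>R x i)) = (\<Sum>i<m. c i *\<^sub>R x i)"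
    by (rule sum.cong) (auto simp: linear_cmul[OF linear_Q] Q_basis)
  ultimately show ?thesis using sums_unique2 by metis
qed

text \<open>The projections determine all partial sums and hence the coefficients, so the definite
  description in \<open>coord\<close> has a unique solution wherever an expansion exists.\<close>

lemma coord_sums:
  assumes "(\<lambda>i. c i *\<^sub>R x i) sums v"
  shows "coord x v = c"
  unfolding coord_def
proof (rule the_equality)
  show "(\<lambda>i. c i *\<^sub>R x i) sums v" by fact
  fix d assume "(\<lambda>i. d i *\<^sub>R x i) sums v"
  then have eq: "(\<Sum>i<m. d i *\<^sub>R x i) = (\<Sum>i<m. c i *\<^sub>R x i)" for m
    using Q_sums assms by metis
  have "d i *\<^sub>R x i = c i *\<^sub>R x i" for i
    using eq[of i] eq[of "Suc i"] by simp
  then show "d = c"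
    using nonzero by (auto simp: fun_eq_iff)
qed

lemma coord_finite_sum:
  assumes "finite A"
  shows "coord x (\<Sum>i\<in>A. c i *\<^sub>R x i) = (\<lambda>i. if i \<in> A then c i else 0)"
proof (rule coord_sums)
  have "(\<lambda>i. (if i \<in> A then c i else 0) *\<^sub>R x i) sums (\<Sum>i\<in>A. (if i \<in> A then c i else 0) *\<^sub>R x i)"
    by (rule sums_finite[OF assms]) auto
  then show "(\<lambda>i. (if i \<in> A then c i else 0) *\<^sub>R x i) sums (\<Sum>i\<in>A. c i *\<^sub>R x i)"
    by (simp cong: sum.cong)
qed

lemma supp_finite_sum_subset: "finite A \<Longrightarrow> supp x (\<Sum>i\<in>A. c i *\<^sub>R x i) \<subseteq> A"
  by (auto simp: supp_def coord_finite_sum)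

lemma span_coord:
  assumes "v \<in> span (range x)"
  shows finite_supp: "finite (supp x v)"
    and supp_expansion: "v = (\<Sum>i\<in>supp x v. coord x v i *\<^sub>R x i)"
proof -
  obtain c n where c: "v = (\<Sum>i<n. c i *\<^sub>R x i)" "\<And>i. n \<le> i \<Longrightarrow> c i = 0"
    using span_range_finite_sum[OF assms] by blast
  have coord: "coord x v = c"
    using c(2) by (subst c(1), subst coord_finite_sum) (auto simp: fun_eq_iff)
  have "supp x v \<subseteq> {..<n}"
    using c(1) supp_finite_sum_subset[of "{..<n}" c] by simp
  then show "finite (supp x v)" "v = (\<Sum>i\<in>supp x v. coord x v i *\<^sub>R x i)"
    unfolding coord
    by (auto simp: finite_subset) (subst c(1), rule sum.mono_neutral_right, auto simp: supp_def coord)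
qed

lemma Q_expansion:
  assumes "v \<in> span (range x)"
  shows "Q m v = (\<Sum>i\<in>supp x v \<inter> {..<m}. coord x v i *\<^sub>R x i)"
proof -
  have "Q m v = (\<Sum>i\<in>supp x v. coord x v i *\<^sub>R Q m (x i))"
    by (subst supp_expansion[OF assms])
      (simp add: linear_sum[OF linear_Q] linear_cmul[OF linear_Q])
  also have "\<dots> = (\<Sum>i\<in>supp x v \<inter> {..<m}. coord x v i *\<^sub>R Q m (x i))"
    by (rule sum.mono_neutral_right) (auto simp: Q_basis finite_supp[OF assms])
  also have "\<dots> = (\<Sum>i\<in>supp x v \<inter> {..<m}. coord x v i *\<^sub>R x i)"
    by (rule sum.cong) (auto simp: Q_basis)
  finally show ?thesis .
qed

lemma Q_eq_self: "v \<in> span (range x) \<Longrightarrow> supp x v \<subseteq> {..<m} \<Longrightarrow> Q m v = v"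
  by (metis Q_expansion inf.absorb1 supp_expansion)

lemma Q_eq_0: "v \<in> span (range x) \<Longrightarrow> supp x v \<subseteq> {m..} \<Longrightarrow> Q m v = 0"
proof -
  assume v: "v \<in> span (range x)" and "supp x v \<subseteq> {m..}"
  then have "supp x v \<inter> {..<m} = {}" by auto
  with Q_expansion[OF v] show "Q m v = 0" by simp
qed

lemma supp_zero [simp]: "supp x 0 = {}"
  using supp_finite_sum_subset[of "{}"] by simp

lemma supp_empty_iff: "v \<in> span (range x) \<Longrightarrow> supp x v = {} \<longleftrightarrow> v = 0"
  using supp_expansion[of v] by auto

lemma Q_in_span: "v \<in> span (range x) \<Longrightarrow> Q m v \<in> span (range x)"
  by (simp add: Q_expansion span_sum span_scale span_base)

lemma supp_sum_subset:
  assumes "finite J" "\<And>j. j \<in> J \<Longrightarrow> z j \<in> span (range x)"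
  shows "supp x (\<Sum>j\<in>J. z j) \<subseteq> (\<Union>j\<in>J. supp x (z j))"
proof -
  define A where "A = (\<Union>j\<in>J. supp x (z j))"
  have A: "finite A"
    unfolding A_def using assms finite_supp by blast
  have "z j = (\<Sum>i\<in>A. coord x (z j) i *\<^sub>R x i)" if "j \<in> J" for j
    by (subst supp_expansion[OF assms(2)[OF that]], rule sum.mono_neutral_left)
      (use A that in \<open>auto simp: A_def supp_def\<close>)
  then have "(\<Sum>j\<in>J. z j) = (\<Sum>j\<in>J. \<Sum>i\<in>A. coord x (z j) i *\<^sub>R x i)"
    by (rule sum.cong[OF refl])
  also have "\<dots> = (\<Sum>i\<in>A. (\<Sum>j\<in>J. coord x (z j) i) *\<^sub>R x i)"
    by (subst sum.swap) (simp add: scaleR_sum_left)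
  finally show ?thesis
    using supp_finite_sum_subset[OF A] by (simp add: A_def)
qed

lemma supp_Q_diff:
  assumes "v \<in> span (range x)" "m \<le> r"
  shows "supp x (Q r v - Q m v) \<subseteq> supp x v \<inter> {m..<r}"
proof -
  have "Q r v - Q m v = (\<Sum>i\<in>supp x v \<inter> {..<r} - supp x v \<inter> {..<m}. coord x v i *\<^sub>R x i)"
    unfolding Q_expansion[OF assms(1)]
    by (rule sum_diff[symmetric]) (use assms finite_supp in auto)
  then show ?thesis
    using supp_finite_sum_subset[of "supp x v \<inter> {..<r} - supp x v \<inter> {..<m}" "coord x v"]
      finite_supp[OF assms(1)] by auto
qed

section \<open>Block bases, subsequences and tails\<close>

lemma block_seq_set_before:
  assumes "block_seq x k y" "i < j" "enat j < k"
  shows "set_before (supp x (y i)) (supp x (y j))"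
  using assms(2,3)
proof (induction j rule: less_induct)
  case (less j)
  show ?case
  proof (cases j)
    case 0
    then show ?thesis using less by simp
  next
    case (Suc l)
    have l: "set_before (supp x (y l)) (supp x (y j))"
      using assms(1) less.prems Suc by (auto simp: block_seq_def)
    show ?thesis
    proof (cases "i = l")
      case False
      have lk: "enat l < k"
        using less.prems Suc by (meson enat_ord_simps(2) lessI less_trans)
      \<comment> \<open>The relation \<open>set_before\<close> can be chained only through a
        nonempty set.\<close>
      then have "supp x (y l) \<noteq> {}"
        using assms(1) by (subst supp_empty_iff) (auto simp: block_seq_def)
      moreover have "set_before (supp x (y i)) (supp x (y l))"
        using less.IH[of l] less.prems Suc False lk by auto
      ultimately show ?thesis
        using l unfolding set_before_def by (meson all_not_in_conv less_trans)
    qed (use l in simp)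
  qed
qed

lemma block_seqD:
  assumes "block_seq x k y" "enat i < k"
  shows "y i \<in> span (range x)" "y i \<noteq> 0" "finite (supp x (y i))" "supp x (y i) \<noteq> {}"
    and "Min (supp x (y i)) \<in> supp x (y i)" "supp x (y i) \<subseteq> {Min (supp x (y i))..}"
proof -
  show y: "y i \<in> span (range x)" "y i \<noteq> 0"
    using assms by (auto simp: block_seq_def)
  show s: "finite (supp x (y i))" "supp x (y i) \<noteq> {}"
    using y finite_supp supp_empty_iff by auto
  show "Min (supp x (y i)) \<in> supp x (y i)" "supp x (y i) \<subseteq> {Min (supp x (y i))..}"
    using s by auto
qed

lemma block_basis_span: "block_basis x y \<Longrightarrow> span (range y) \<subseteq> span (range x)"
  by (rule span_minimal) (auto intro: block_seqD)

text \<open>Cutting at the first support point of \<open>y m\<close> keeps the blocks before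
  \<open>m\<close> and kills the others. The block basis thus inherits projections of the whole
  space with the same constant \<open>K\<close>.\<close>

lemma projections_block_basis:
  assumes "block_basis x y"
  shows "projections y (\<lambda>m. Q (Min (supp x (y m)))) K"
proof (rule projections.intro)
  note y = block_seqD[OF assms, simplified]
  show "y i \<noteq> 0" for i by (rule y)
  show "bounded_linear (Q (Min (supp x (y m))))" for m by (rule bounded_linear_Q)
  show "norm (Q (Min (supp x (y m))) v) \<le> K * norm v" for m v by (rule norm_Q)
  show "Q (Min (supp x (y m))) (y i) = (if i < m then y i else 0)" for m i
  proof (cases "i < m")
    case True
    have "supp x (y i) \<subseteq> {..<Min (supp x (y m))}"
      using block_seq_set_before[OF assms True] y(5)[of m] by (auto simp: set_before_def)
    then show ?thesis using True y(1) by (simp add: Q_eq_self)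
  next
    case False
    have "Min (supp x (y m)) \<le> Min (supp x (y i))"
      using block_seq_set_before[OF assms, of m i] y(5)[of m] y(5)[of i] False
      by (cases "m = i") (auto simp: set_before_def intro: less_imp_le)
    then have "supp x (y i) \<subseteq> {Min (supp x (y m))..}"
      using y(6)[of i] by auto
    then show ?thesis using False y(1) by (simp add: Q_eq_0)
  qed
qed

lemma block_basis_supp_ge:
  assumes "block_basis x y"
  shows "supp x (y i) \<subseteq> {i..}"
proof (induction i)
  case (Suc i)
  have "set_before (supp x (y i)) (supp x (y (Suc i)))"
    by (rule block_seq_set_before[OF assms]) auto
  moreover have "Min (supp x (y i)) \<in> supp x (y i)"
    using block_seqD[OF assms] by simp
  ultimately show ?case
    using Suc by (fastforce simp: set_before_def)
qed auto

lemma projections_subseq: "strict_mono f \<Longrightarrow> projections (\<lambda>i. x (f i)) (\<lambda>m. Q (f m)) K"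
  by (rule projections.intro) (auto simp: nonzero bounded_linear_Q norm_Q Q_basis strict_mono_less)

lemma supp_subseq:
  assumes "strict_mono f" "v \<in> span (range (\<lambda>i. x (f i)))"
  shows "supp x v = f ` supp (\<lambda>i. x (f i)) v"
proof -
  interpret sub: projections "\<lambda>i. x (f i)" "\<lambda>m. Q (f m)" K
    by (rule projections_subseq) fact
  define S where "S = supp (\<lambda>i. x (f i)) v"
  define c where "c = coord (\<lambda>i. x (f i)) v"
  have inj: "inj f" using assms(1) by (rule strict_mono_imp_inj_on)
  have fin: "finite S" using sub.finite_supp[OF assms(2)] by (simp add: S_def)
  have "v = (\<Sum>i\<in>S. c i *\<^sub>R x (f i))"
    using sub.supp_expansion[OF assms(2)] by (simp add: S_def c_def)
  also have "\<dots> = (\<Sum>i\<in>f ` S. c (inv f i) *\<^sub>R x i)"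
    by (subst sum.reindex) (use inj in \<open>auto simp: inj_on_def\<close>)
  finally have "coord x v = (\<lambda>i. if i \<in> f ` S then c (inv f i) else 0)"
    using coord_finite_sum fin by simp
  then show ?thesis
    using inj by (auto simp: supp_def S_def c_def)
qed

lemma block_basis_subseq:
  assumes "block_basis x y" "strict_mono f"
  shows "block_basis x (\<lambda>i. y (f i))"
  unfolding block_seq_def
  using block_seqD[OF assms(1)] block_seq_set_before[OF assms(1)] strict_monoD[OF assms(2)] by simp

lemma block_basis_self: "block_basis x x"
proof -
  have "supp x (x i) \<subseteq> {i}" for i
    using supp_finite_sum_subset[of "{i}" "\<lambda>_. 1"] by simp
  then have "set_before (supp x (x i)) (supp x (x (Suc i)))" for i
    unfolding set_before_def by blast
  then show ?thesis
    by (simp add: block_seq_def nonzero span_base)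
qed

lemma span_tail:
  assumes "v \<in> span (range x)" "supp x v \<subseteq> {n..}"
  shows "v \<in> span (range (\<lambda>i. x (i + n)))"
proof -
  have "v = (\<Sum>j\<in>supp x v. coord x v j *\<^sub>R x (j - n + n))"
    using assms by (subst supp_expansion) (auto intro!: sum.cong)
  then show ?thesis
    by (metis (no_types, lifting) rangeI span_base span_scale span_sum)
qed

lemma block_basis_tail:
  assumes y: "block_basis x y" and ge: "\<And>i. supp x (y i) \<subseteq> {n..}"
  shows "block_basis (\<lambda>i. x (i + n)) y"
proof -
  have mono: "strict_mono (\<lambda>i. i + n)" by (simp add: strict_mono_def)
  have span: "y i \<in> span (range (\<lambda>i. x (i + n)))" for i
    using block_seqD(1)[OF y, of i] ge[of i] by (simp add: span_tail)
  have "set_before (supp (\<lambda>i. x (i + n)) (y i)) (supp (\<lambda>i. x (i + n)) (y (Suc i)))" for i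
    using block_seq_set_before[OF y, of i "Suc i"] supp_subseq[OF mono span]
    by (simp add: set_before_def)
  then show ?thesis
    using span block_seqD[OF y] by (simp add: block_seq_def)
qed

end

text \<open>Continuity of the partial-sum maps is part of the claim, so the uniform boundedness
  principle does not apply to them. Baire category and successive approximation are used instead, as
  in the proof of the open mapping theorem.\<close>

lemma schauder_basis_projections:
  assumes e: "schauder_basis (e :: nat \<Rightarrow> 'a::banach)"
  obtains Q K where "projections e Q K"
proof -
  have ex: "\<exists>!c. (\<lambda>i. c i *\<^sub>R e i) sums v" for v
    using e by (simp add: schauder_basis_def)
  have coordI: "coord e v = c" if "(\<lambda>i. c i *\<^sub>R e i) sums v" for c v
    unfolding coord_def by (rule the1_equality[where P="\<lambda>c. (\<lambda>i. c i *\<^sub>R e i) sums v", OF ex that])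
  have coord: "(\<lambda>i. coord e v i *\<^sub>R e i) sums v" for v
    unfolding coord_def using theI'[OF ex[of v]] .
  define Q where "Q m v = (\<Sum>i<m. coord e v i *\<^sub>R e i)" for m v
  have coord_add: "coord e (u + v) = (\<lambda>i. coord e u i + coord e v i)" for u v
    by (rule coordI) (use sums_add[OF coord[of u] coord[of v]] in \<open>simp add: scaleR_add_left\<close>)
  have coord_scale: "coord e (r *\<^sub>R v) = (\<lambda>i. r * coord e v i)" for r v
    by (rule coordI) (use bounded_linear.sums[OF bounded_linear_scaleR_right coord[of v], of r] in simp)
  have coord_e: "coord e (e j) = (\<lambda>i. if i = j then 1 else 0)" for j
  proof (rule coordI)
    have "(\<lambda>i. (if i = j then 1 else 0) *\<^sub>R e i) sums (\<Sum>i\<in>{j}. (if i = j then 1 else 0) *\<^sub>R e i)"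
      by (rule sums_finite) auto
    then show "(\<lambda>i. (if i = j then 1 else 0) *\<^sub>R e i) sums e j" by simp
  qed
  have e_nz: "e j \<noteq> 0" for j
  proof
    assume "e j = 0"
    then have "coord e (e j) = coord e 0" by simp
    also have "coord e 0 = (\<lambda>_. 0)" by (rule coordI) simp
    finally show False by (simp add: coord_e fun_eq_iff split: if_splits)
  qed
  have lin: "linear (Q m)" for m
    by (rule linearI) (simp_all add: Q_def coord_add coord_scale scaleR_add_left sum.distrib scaleR_sum_right)
  have Q_e: "Q m (e j) = (if j < m then e j else 0)" for m j
  proof -
    have "Q m (e j) = (\<Sum>i\<in>{..<m} \<inter> {j}. coord e (e j) i *\<^sub>R e i)"
      unfolding Q_def by (rule sum.mono_neutral_right) (auto simp: coord_e)
    then show ?thesis by (auto simp: coord_e)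
  qed
  have Q_lim: "(\<lambda>m. Q m v) \<longlonglongrightarrow> v" for v
    using coord[of v] by (simp add: sums_def Q_def)
  \<comment> \<open>Every vector lies in some \<open>A k\<close> because its partial sums converge.
    The \<open>A k\<close> are not known to be closed, so Baire's theorem is applied to their
    closures.\<close>
  define A where "A k = {v. \<forall>m. norm (Q m v) \<le> real k}" for k
  have "(\<Union>k. closure (A k)) = UNIV"
  proof -
    have "\<exists>k. v \<in> A k" for v
    proof -
      have "Bseq (\<lambda>m. Q m v)" using Q_lim[of v] convergent_imp_Bseq convergentI by blast
      then obtain B where "\<forall>m. norm (Q m v) \<le> B" using BseqE by blast
      moreover obtain k where "B \<le> real k" using real_arch_simple by blast
      ultimately show ?thesis by (auto simp: A_def intro: order_trans)
    qed
    then show ?thesis using closure_subset by blast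
  qed
  then have "interior (\<Union>k. closure (A k)) \<noteq> {}" by simp
  then obtain k where "interior (closure (A k)) \<noteq> {}"
    using Met_TC.metric_Baire_category_alt[of "range (\<lambda>k. closure (A k))"] complete_UNIV by auto
  then obtain w r where r: "r > 0" "cball w r \<subseteq> closure (A k)"
    by (metis all_not_in_conv interior_subset mem_interior_cball order_trans interior_interior)
  define C where "C = 2 * real k / r"
  have C: "C \<ge> 0" using r(1) by (simp add: C_def)
  \<comment> \<open>The scaling by \<open>t\<close> makes the shift from \<open>w\<close> have norm
    \<open>r\<close>, so both end points are limits of points of \<open>A k\<close>. The rescaled
    difference of two approximants misses \<open>v\<close> by at most half its norm.\<close>
  have "\<exists>u. norm (v - u) \<le> norm v / 2 \<and> (\<forall>m. norm (Q m u) \<le> C * norm v)" for v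
  proof (cases "v = 0")
    case True
    then show ?thesis by (intro exI[of _ 0]) (simp add: linear_0[OF lin])
  next
    case False
    define t where "t = norm v / r"
    have t: "t > 0" using False r(1) by (simp add: t_def)
    have "w \<in> closure (A k)" "w + (1 / t) *\<^sub>R v \<in> closure (A k)"
      using r False by (auto simp: subset_iff dist_norm t_def)
    then obtain b c where b: "b \<in> A k" "dist b w < r / 4" and c: "c \<in> A k" "dist c (w + (1 / t) *\<^sub>R v) < r / 4"
      using r(1) by (metis closure_approachable divide_pos_pos zero_less_numeral)
    define u where "u = t *\<^sub>R (c - b)"
    have "v - u = t *\<^sub>R ((b - w) - (c - (w + (1 / t) *\<^sub>R v)))"
      using t by (simp add: u_def algebra_simps)
    then have "norm (v - u) \<le> t * (norm (b - w) + norm (c - (w + (1 / t) *\<^sub>R v)))"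
      using t norm_triangle_ineq4[of "b - w" "c - (w + (1 / t) *\<^sub>R v)"]
      by (simp del: diff_diff_add diff_add_eq_diff_diff_swap add: mult_left_mono)
    also have "\<dots> \<le> t * (r / 4 + r / 4)"
      using b(2) c(2) t by (intro mult_left_mono add_mono) (auto simp: dist_norm)
    also have "\<dots> = norm v / 2" using r(1) by (simp add: t_def)
    finally have 1: "norm (v - u) \<le> norm v / 2" .
    have "norm (Q m u) \<le> C * norm v" for m
    proof -
      have "Q m u = t *\<^sub>R (Q m c - Q m b)"
        by (simp add: u_def linear_cmul[OF lin] linear_diff[OF lin])
      then have "norm (Q m u) \<le> t * (norm (Q m c) + norm (Q m b))"
        using t norm_triangle_ineq4 by simp
      also have "\<dots> \<le> t * (real k + real k)"
        using b(1) c(1) t by (intro mult_left_mono add_mono) (auto simp: A_def)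
      also have "\<dots> = C * norm v" by (simp add: t_def C_def)
      finally show ?thesis .
    qed
    with 1 show ?thesis by blast
  qed
  then obtain U where U: "\<And>v. norm (v - U v) \<le> norm v / 2" "\<And>v m. norm (Q m (U v)) \<le> C * norm v"
    by metis
  have bound: "norm (Q m v) \<le> (2 * C) * norm v" for m v
  proof -
    \<comment> \<open>\<open>v\<close> is the sum of the series \<open>U (V 0) + U (V 1) + \<dots>\<close>, whose partial sums converge
      uniformly after applying all \<open>Q m\<close>.\<close>
    define V where "V n = ((\<lambda>v. v - U v) ^^ n) v" for n
    have V: "norm (V n) \<le> norm v * (1/2) ^ n" for n
    proof (induction n)
      case (Suc n)
      then show ?case using U(1)[of "V n"] by (simp add: V_def)
    qed (simp add: V_def)
    have V_sum: "(\<Sum>j<n. U (V j)) = v - V n" for n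
      by (induction n) (simp_all add: V_def)
    have V_lim: "V \<longlonglongrightarrow> 0"
    proof (rule Lim_null_comparison)
      show "(\<lambda>n. norm v * (1/2) ^ n) \<longlonglongrightarrow> 0"
        by (intro tendsto_mult_right_zero LIMSEQ_power_zero) simp
    qed (use V in auto)
    define M where "M n = C * (norm v * (1/2) ^ n)" for n
    have M: "norm (Q m (U (V n))) \<le> M n" for m n
      using order_trans[OF U(2) mult_left_mono[OF V C]] by (simp add: M_def)
    have sM: "M sums (C * (norm v * 2))"
      unfolding M_def by (intro sums_mult) (use geometric_sums[of "1/2 :: real"] in simp)
    have summable_Q: "summable (\<lambda>n. Q m (U (V n)))" for m
      by (rule summable_comparison_test'[OF sums_summable[OF sM]]) (rule M)
    define c where "c i = (\<Sum>n. coord e (U (V n)) i)" for i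
    have c: "(\<lambda>n. coord e (U (V n)) i *\<^sub>R e i) sums (c i *\<^sub>R e i)" for i
    proof -
      have Qd: "Q (Suc i) (U (V n)) - Q i (U (V n)) = coord e (U (V n)) i *\<^sub>R e i" for n
        by (simp add: Q_def)
      have "summable (\<lambda>n. coord e (U (V n)) i)"
      proof (rule summable_comparison_test')
        show "summable (\<lambda>n. 2 * M n / norm (e i))"
          using sums_summable[OF sM] by (intro summable_divide summable_mult)
        show "norm (coord e (U (V n)) i) \<le> 2 * M n / norm (e i)" if "n \<ge> 0" for n
        proof -
          have "norm (coord e (U (V n)) i *\<^sub>R e i) \<le> M n + M n"
            unfolding Qd[symmetric] using norm_triangle_ineq4 M by (meson add_mono order_trans)
          then show ?thesis using e_nz[of i] by (simp add: field_simps)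
        qed
      qed
      then show ?thesis unfolding c_def by (intro sums_scaleR_left summable_sums)
    qed
    have Q_c: "(\<lambda>n. Q m (U (V n))) sums (\<Sum>i<m. c i *\<^sub>R e i)" for m
      unfolding Q_def by (intro sums_sum c)
    \<comment> \<open>The series converges uniformly in \<open>m\<close>, so its sum may be
      interchanged with the limit in \<open>m\<close>. This identifies \<open>c\<close> as the
      coordinate sequence of \<open>v\<close> before continuity of the \<open>Q m\<close> is
      known.\<close>
    have "(\<lambda>m. \<Sum>n. Q m (U (V n))) \<longlonglongrightarrow> v"
    proof (rule swap_uniform_limit'[where S=UNIV and F=sequentially])
      show "\<forall>\<^sub>F N in sequentially. (\<lambda>m. \<Sum>n<N. Q m (U (V n))) \<longlonglongrightarrow> (\<Sum>n<N. U (V n))"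
        by (intro always_eventually allI tendsto_sum Q_lim)
      show "(\<lambda>N. \<Sum>n<N. U (V n)) \<longlonglongrightarrow> v"
        unfolding V_sum using tendsto_diff[OF tendsto_const V_lim, of v] by simp
      show "uniform_limit UNIV (\<lambda>N m. \<Sum>n<N. Q m (U (V n))) (\<lambda>m. \<Sum>n. Q m (U (V n))) sequentially"
        by (rule Weierstrass_m_test[OF _ sums_summable[OF sM]]) (rule M)
    qed auto
    then have "(\<lambda>i. c i *\<^sub>R e i) sums v"
      unfolding sums_def using sums_unique[OF Q_c] by simp
    then have "Q m v = (\<Sum>n. Q m (U (V n)))"
      unfolding sums_unique[OF Q_c, symmetric] by (simp add: Q_def coordI)
    also have "norm \<dots> \<le> (\<Sum>n. M n)"
      by (rule norm_suminf_le[OF M sums_summable[OF sM]])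
    also have "\<dots> = 2 * C * norm v"
      using sums_unique[OF sM] by simp
    finally show ?thesis .
  qed
  have "projections e Q (2 * C)"
  proof (rule projections.intro)
    show "bounded_linear (Q m)" for m
      using lin[of m] bound[of m] by (intro bounded_linear_intro[where K="2 * C"])
        (simp_all add: linear_add linear_cmul mult.commute)
  qed (use e_nz bound Q_e in auto)
  then show ?thesis by (rule that)
qed

section \<open>Lower estimates and their iteration\<close>

lemma
  assumes "equivalent_norm_on V N"
  shows equivalent_norm_nonneg: "v \<in> V \<Longrightarrow> 0 \<le> N v"
    and equivalent_norm_pos: "v \<in> V \<Longrightarrow> v \<noteq> 0 \<Longrightarrow> 0 < N v"
    and equivalent_norm_zero: "0 \<in> V \<Longrightarrow> N 0 = 0"
proof -
  obtain c where c: "c > 0" "\<And>v. v \<in> V \<Longrightarrow> c * norm v \<le> N v"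
    using assms unfolding equivalent_norm_on_def by blast
  show "0 \<le> N v" if "v \<in> V" for v
    using c(2)[OF that] c(1) by (meson mult_nonneg_nonneg less_imp_le norm_ge_zero order_trans)
  show "0 < N v" if "v \<in> V" "v \<noteq> 0" for v
    using c(2)[OF that(1)] c(1) that(2) by (meson mult_pos_pos zero_less_norm_iff less_le_trans)
  show "N 0 = 0" if "0 \<in> V"
  proof -
    have "N (0 *\<^sub>R 0) = \<bar>0\<bar> * N 0"
      using assms that unfolding equivalent_norm_on_def by blast
    then show ?thesis by simp
  qed
qed

lemma equivalent_norm_on_subset: "equivalent_norm_on V N \<Longrightarrow> W \<subseteq> V \<Longrightarrow> equivalent_norm_on W N"
  unfolding equivalent_norm_on_def by (meson subsetD)

lemma equivalent_norm_on_norm: "equivalent_norm_on V norm"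
  unfolding equivalent_norm_on_def
  by (auto intro: norm_triangle_ineq intro!: exI[of _ "1::real"])

lemma sum_UN_ordered:
  assumes "finite I" "\<And>i. i \<in> I \<Longrightarrow> finite (G i)" "ordered_on I G"
  shows "sum h (\<Union>i\<in>I. G i) = (\<Sum>i\<in>I. sum h (G i))"
proof (rule sum.UNION_disjoint)
  show "\<forall>i\<in>I. \<forall>j\<in>I. i \<noteq> j \<longrightarrow> G i \<inter> G j = {}"
    using assms(3) unfolding ordered_on_def set_before_def
    by (metis disjoint_iff less_irrefl linorder_neqE_nat)
qed (use assms in auto)

text \<open>Supports numbered by positive integers, as in the Schreier classes.\<close>

definition psupp :: "(nat \<Rightarrow> 'a::banach) \<Rightarrow> 'a \<Rightarrow> nat set" where
  "psupp x v = Suc ` supp x v"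

text \<open>Unlike in the definition of \<open>\<delta>\<close>, the vectors may vanish and their supports may begin
  after the index \<open>f i\<close>; for spreading families this makes no difference.\<close>

definition lower_estimate ::
  "('a::banach \<Rightarrow> real) \<Rightarrow> (nat \<Rightarrow> 'a) \<Rightarrow> (nat \<Rightarrow> nat) \<Rightarrow> nat set set \<Rightarrow> real \<Rightarrow> bool" where
  "lower_estimate N x f \<F> d \<longleftrightarrow> (\<forall>G\<in>\<F>. \<forall>z. (\<forall>i\<in>G. z i \<in> span (range x) \<and> psupp x (z i) \<subseteq> {f i..}) \<longrightarrow>
     ordered_on G (\<lambda>i. psupp x (z i)) \<longrightarrow> d * (\<Sum>i\<in>G. N (z i)) \<le> N (\<Sum>i\<in>G. z i))"

lemma lower_estimateD:
  "lower_estimate N x f \<F> d \<Longrightarrow> G \<in> \<F> \<Longrightarrow> (\<And>i. i \<in> G \<Longrightarrow> z i \<in> span (range x)) \<Longrightarrow>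
   (\<And>i. i \<in> G \<Longrightarrow> psupp x (z i) \<subseteq> {f i..}) \<Longrightarrow> ordered_on G (\<lambda>i. psupp x (z i)) \<Longrightarrow>
   d * (\<Sum>i\<in>G. N (z i)) \<le> N (\<Sum>i\<in>G. z i)"
  by (simp add: lower_estimate_def)

section \<open>Lower estimates for subsequences\<close>

context projections
begin

lemma psupp_subseq:
  assumes \<phi>: "strict_mono \<phi>" and f: "\<And>i j. i \<le> Suc j \<Longrightarrow> f i \<le> Suc (\<phi> j)"
    and v: "v \<in> span (range (\<lambda>i. x (\<phi> i)))" and i: "psupp (\<lambda>i. x (\<phi> i)) v \<subseteq> {i..}"
  shows "psupp x v \<subseteq> {f i..}"
  using i f unfolding psupp_def supp_subseq[OF \<phi> v] by auto

lemma ordered_on_psupp_subseq: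
  assumes \<phi>: "strict_mono \<phi>" and z: "\<And>i. i \<in> G \<Longrightarrow> z i \<in> span (range (\<lambda>i. x (\<phi> i)))"
    and ord: "ordered_on G (\<lambda>i. psupp (\<lambda>i. x (\<phi> i)) (z i))"
  shows "ordered_on G (\<lambda>i. psupp x (z i))"
  unfolding ordered_on_def
proof (intro ballI impI)
  fix i j assume ij: "i \<in> G" "j \<in> G" "i < j"
  note eq = supp_subseq[OF \<phi> z[OF ij(1)]] supp_subseq[OF \<phi> z[OF ij(2)]]
  show "set_before (psupp x (z i)) (psupp x (z j))"
    using ordered_onD[OF ord ij] unfolding psupp_def eq
    by (simp add: set_before_def strict_mono_less[OF \<phi>])
qed

lemma span_subseq: "span (range (\<lambda>i. x (\<phi> i))) \<subseteq> span (range x)"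
  by (rule span_mono) auto

text \<open>A sparse subsequence absorbs the starting condition \<open>f\<close>: index
  \<open>j\<close> carries the number \<open>Suc j\<close>, and once this is at least
  \<open>i\<close>, its number in the original sequence, \<open>Suc (\<phi> j)\<close>, is at least
  \<open>f i\<close>.\<close>

lemma lower_estimate_subseq:
  assumes \<phi>: "strict_mono \<phi>" and f: "\<And>i j. i \<le> Suc j \<Longrightarrow> f i \<le> Suc (\<phi> j)"
    and est: "lower_estimate N x f \<F> d"
  shows "lower_estimate N (\<lambda>i. x (\<phi> i)) (\<lambda>i. i) \<F> d"
  unfolding lower_estimate_def
proof (intro ballI allI impI)
  fix G z
  assume "G \<in> \<F>" and z: "\<forall>i\<in>G. z i \<in> span (range (\<lambda>i. x (\<phi> i))) \<and> psupp (\<lambda>i. x (\<phi> i)) (z i) \<subseteq> {i..}"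
    and ord: "ordered_on G (\<lambda>i. psupp (\<lambda>i. x (\<phi> i)) (z i))"
  show "d * (\<Sum>i\<in>G. N (z i)) \<le> N (\<Sum>i\<in>G. z i)"
  proof (rule lower_estimateD[OF est \<open>G \<in> \<F>\<close>])
    show "ordered_on G (\<lambda>i. psupp x (z i))"
      using z by (intro ordered_on_psupp_subseq[OF \<phi> _ ord]) blast
    fix i assume "i \<in> G"
    with z have zi: "z i \<in> span (range (\<lambda>i. x (\<phi> i)))" "psupp (\<lambda>i. x (\<phi> i)) (z i) \<subseteq> {i..}"
      by auto
    show "z i \<in> span (range x)" using zi(1) span_subseq by blast
    show "psupp x (z i) \<subseteq> {f i..}" using \<phi> f zi by (rule psupp_subseq)
  qed
qed

lemma psupp_sum_subset:
  assumes "finite J" "\<And>j. j \<in> J \<Longrightarrow> z j \<in> span (range x)"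
  shows "psupp x (\<Sum>j\<in>J. z j) \<subseteq> (\<Union>j\<in>J. psupp x (z j))"
  using supp_sum_subset[of J z] assms unfolding psupp_def by blast

end

section \<open>Attainment and boundedness of the suprema defining the constants\<close>

context schreier_classes
begin

text \<open>Blocks of an admissible sequence are labelled by the minima of their supports.
  Conversely, after zero vectors are dropped, the true minima spread a subset of \<open>G\<close> to
  the right, so the remaining sequence is admissible.\<close>

lemma admissible_estimate_iff:
  assumes "projections x Q K" and N: "equivalent_norm_on (span (range x)) N"
  shows "(\<forall>k y. admissible a \<alpha> x k y \<longrightarrow> d * (\<Sum>i<k. N (y i)) \<le> N (\<Sum>i<k. y i)) \<longleftrightarrow>
    lower_estimate N x (\<lambda>i. i) (\<S> \<alpha>) d"
proof (intro iffI allI impI)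
  interpret projections x Q K by fact
  {
    fix k y
    assume adm: "admissible a \<alpha> x k y" and est: "lower_estimate N x (\<lambda>i. i) (\<S> \<alpha>) d"
    define \<mu> where "\<mu> i = Suc (Min (supp x (y i)))" for i
    have blk: "block_seq x (enat k) y" and G: "\<mu> ` {..<k} \<in> \<S> \<alpha>"
      using adm by (auto simp: admissible_def \<mu>_def)
    note y = block_seqD[OF blk, simplified]
    have mono: "\<mu> i < \<mu> j" if "i < j" "j < k" for i j
      using block_seq_set_before[OF blk that(1)] y(5)[of i] y(5)[of j] that
      by (auto simp: set_before_def \<mu>_def)
    have inj: "inj_on \<mu> {..<k}"
      by (rule linorder_inj_onI) (use mono in force)+
    define \<nu> where "\<nu> = inv_into {..<k} \<mu>"
    have \<nu>: "\<nu> (\<mu> i) = i" if "i < k" for i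
      unfolding \<nu>_def using inj that by (intro inv_into_f_f) auto
    have "d * (\<Sum>m\<in>\<mu> ` {..<k}. N (y (\<nu> m))) \<le> N (\<Sum>m\<in>\<mu> ` {..<k}. y (\<nu> m))"
    proof (rule lower_estimateD[OF est G])
      show "ordered_on (\<mu> ` {..<k}) (\<lambda>m. psupp x (y (\<nu> m)))"
        unfolding ordered_on_def
      proof (intro ballI impI)
        fix m n assume "m \<in> \<mu> ` {..<k}" "n \<in> \<mu> ` {..<k}" "m < n"
        then obtain i j where ij: "m = \<mu> i" "n = \<mu> j" "i < k" "j < k" by blast
        have "i < j"
          using mono[of j i] ij \<open>m < n\<close> by (metis less_asym less_irrefl linorder_neqE_nat)
        then show "set_before (psupp x (y (\<nu> m))) (psupp x (y (\<nu> n)))"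
          using block_seq_set_before[OF blk, of i j] ij by (auto simp: \<nu> set_before_def psupp_def)
      qed
    next
      fix m assume "m \<in> \<mu> ` {..<k}"
      then obtain i where i: "i < k" "m = \<mu> i" by blast
      then have eq: "y (\<nu> m) = y i" by (simp add: \<nu>)
      show "y (\<nu> m) \<in> span (range x)" unfolding eq using i y(1) by simp
      show "psupp x (y (\<nu> m)) \<subseteq> {m..}" unfolding eq using i y(6)[of i] by (auto simp: psupp_def \<mu>_def)
    qed
    then show "d * (\<Sum>i<k. N (y i)) \<le> N (\<Sum>i<k. y i)"
      using \<nu> by (simp add: sum.reindex[OF inj] o_def)
  }
  assume *: "\<forall>k y. admissible a \<alpha> x k y \<longrightarrow> d * (\<Sum>i<k. N (y i)) \<le> N (\<Sum>i<k. y i)"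
  show "lower_estimate N x (\<lambda>i. i) (\<S> \<alpha>) d"
    unfolding lower_estimate_def
  proof (intro ballI allI impI)
    fix G z
    assume G: "G \<in> \<S> \<alpha>" and z: "\<forall>i\<in>G. z i \<in> span (range x) \<and> psupp x (z i) \<subseteq> {i..}"
      and ord: "ordered_on G (\<lambda>i. psupp x (z i))"
    define G' where "G' = {i \<in> G. z i \<noteq> 0}"
    have fin: "finite G" "finite G'" using schreier_finite[OF G] by (auto simp: G'_def)
    define l where "l = sorted_list_of_set G'"
    define k where "k = length l"
    have l: "sorted_wrt (<) l" "set l = G'" "distinct l"
      using fin by (auto simp: l_def)
    have bij: "bij_betw ((!) l) {..<k} G'"
      by (rule bij_betw_nth) (use l in \<open>auto simp: k_def\<close>)
    have lG: "l ! i \<in> G'" if "i < k" for i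
      using that l by (auto simp: k_def)
    have Min: "Min (supp x (z i)) \<in> supp x (z i)" "i \<le> Suc (Min (supp x (z i)))" if "i \<in> G'" for i
    proof -
      have zi: "z i \<in> span (range x)" "z i \<noteq> 0" using z that by (auto simp: G'_def)
      show Min: "Min (supp x (z i)) \<in> supp x (z i)"
        using zi finite_supp supp_empty_iff by (intro Min_in) auto
      then show "i \<le> Suc (Min (supp x (z i)))"
        using z that by (auto simp: G'_def psupp_def)
    qed
    have before: "set_before (supp x (z i)) (supp x (z j))" if "i \<in> G'" "j \<in> G'" "i < j" for i j
      using ordered_onD[OF ord, of i j] that by (auto simp: G'_def psupp_def set_before_def)
    have "admissible a \<alpha> x k (\<lambda>i. z (l ! i))"
      unfolding admissible_def
    proof
      show "block_seq x (enat k) (\<lambda>i. z (l ! i))"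
        unfolding block_seq_def
      proof (intro conjI allI impI)
        fix i assume "enat i < enat k"
        then show "z (l ! i) \<in> span (range x)" "z (l ! i) \<noteq> 0"
          using lG[of i] z by (auto simp: G'_def)
      next
        fix i assume "enat (Suc i) < enat k"
        then show "set_before (supp x (z (l ! i))) (supp x (z (l ! Suc i)))"
          using l(1) by (intro before lG) (auto simp: k_def sorted_wrt_iff_nth_less)
      qed
      have "(\<lambda>i. Suc (Min (supp x (z i)))) ` G' \<in> \<S> \<alpha>"
      proof (rule schreier_spread[OF G])
        show "G' \<subseteq> G" by (auto simp: G'_def)
        show "strict_mono_on G' (\<lambda>i. Suc (Min (supp x (z i))))"
          using before Min unfolding strict_mono_on_def set_before_def by blast
      qed (use Min in auto)
      then show "(\<lambda>i. Suc (Min (supp x (z (l ! i))))) ` {..<k} \<in> \<S> \<alpha>"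
        using bij_betw_imp_surj_on[OF bij] by (metis (no_types) image_image)
    qed
    then have "d * (\<Sum>i<k. N (z (l ! i))) \<le> N (\<Sum>i<k. z (l ! i))"
      using * by blast
    also have "(\<Sum>i<k. N (z (l ! i))) = (\<Sum>i\<in>G'. N (z i))"
      by (rule sum.reindex_bij_betw[OF bij])
    also have "\<dots> = (\<Sum>i\<in>G. N (z i))"
      using equivalent_norm_zero[OF N] span_zero
      by (intro sum.mono_neutral_left) (auto simp: G'_def fin)
    also have "(\<Sum>i<k. z (l ! i)) = (\<Sum>i\<in>G'. z i)"
      by (rule sum.reindex_bij_betw[OF bij])
    also have "\<dots> = (\<Sum>i\<in>G. z i)"
      by (intro sum.mono_neutral_left) (auto simp: G'_def fin)
    finally show "d * (\<Sum>i\<in>G. N (z i)) \<le> N (\<Sum>i\<in>G. z i)" .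
  qed
qed

text \<open>The inequalities defining \<open>delta\<close> are closed conditions on
  \<open>d\<close>, so the supremum is attained. The upper bound 1 comes from sequences with one
  term.\<close>

lemma
  assumes "projections x Q K" and N: "equivalent_norm_on (span (range x)) N"
  shows delta_nonneg: "0 \<le> delta a \<alpha> N x" and delta_le_1: "delta a \<alpha> N x \<le> 1"
    and le_delta_iff: "0 \<le> d \<Longrightarrow> d \<le> delta a \<alpha> N x \<longleftrightarrow> lower_estimate N x (\<lambda>i. i) (\<S> \<alpha>) d"
proof -
  interpret projections x Q K by fact
  let ?A = "{d. 0 \<le> d \<and> lower_estimate N x (\<lambda>i. i) (\<S> \<alpha>) d}"
  have delta: "delta a \<alpha> N x = Sup ?A"
    unfolding delta_def admissible_estimate_iff[OF assms] by simp
  have le_1: "d \<le> 1" if "d \<in> ?A" for d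
  proof -
    have "psupp x (x 0) \<subseteq> {1..}" by (auto simp: psupp_def)
    then have "d * (\<Sum>i\<in>{1::nat}. N (x 0)) \<le> N (\<Sum>i\<in>{1::nat}. x 0)"
      using that schreier_singleton[of 1 \<alpha>]
      by (intro lower_estimateD[of N x "\<lambda>i. i" "\<S> \<alpha>" d "{1}" "\<lambda>_. x 0"])
        (auto simp: span_base ordered_on_def)
    then show ?thesis
      using equivalent_norm_pos[OF N _ nonzero[of 0]] by (simp add: span_base)
  qed
  have sum_N: "0 \<le> (\<Sum>i\<in>G. N (z i))" "0 \<le> N (\<Sum>i\<in>G. z i)"
    if "\<forall>i\<in>G. z i \<in> span (range x) \<and> psupp x (z i) \<subseteq> {i..}" for G :: "nat set" and z
    using that by (auto intro!: sum_nonneg span_sum equivalent_norm_nonneg[OF N])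
  have zero: "0 \<in> ?A"
    using sum_N by (auto simp: lower_estimate_def)
  have bdd: "bdd_above ?A" using le_1 by (rule bdd_aboveI)
  show "0 \<le> delta a \<alpha> N x" unfolding delta by (rule cSup_upper[OF zero bdd])
  show "delta a \<alpha> N x \<le> 1" unfolding delta by (rule cSup_least) (use zero le_1 in auto)
  show "d \<le> delta a \<alpha> N x \<longleftrightarrow> lower_estimate N x (\<lambda>i. i) (\<S> \<alpha>) d" if d: "0 \<le> d"
  proof
    assume "lower_estimate N x (\<lambda>i. i) (\<S> \<alpha>) d"
    then show "d \<le> delta a \<alpha> N x"
      unfolding delta using d by (intro cSup_upper bdd) auto
  next
    assume le: "d \<le> delta a \<alpha> N x"
    show "lower_estimate N x (\<lambda>i. i) (\<S> \<alpha>) d"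
      unfolding lower_estimate_def
    proof (intro ballI allI impI)
      fix G z
      assume G: "G \<in> \<S> \<alpha>" and z: "\<forall>i\<in>G. z i \<in> span (range x) \<and> psupp x (z i) \<subseteq> {i..}"
        and ord: "ordered_on G (\<lambda>i. psupp x (z i))"
      show "d * (\<Sum>i\<in>G. N (z i)) \<le> N (\<Sum>i\<in>G. z i)"
      proof (cases "(\<Sum>i\<in>G. N (z i)) = 0")
        case False
        then have pos: "0 < (\<Sum>i\<in>G. N (z i))" using sum_N[OF z] by simp
        have "Sup ?A \<le> N (\<Sum>i\<in>G. z i) / (\<Sum>i\<in>G. N (z i))"
        proof (rule cSup_least)
          fix d' assume "d' \<in> ?A"
          then have "d' * (\<Sum>i\<in>G. N (z i)) \<le> N (\<Sum>i\<in>G. z i)"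
            using G z ord by (intro lower_estimateD[of N x "\<lambda>i. i" "\<S> \<alpha>"]) auto
          then show "d' \<le> N (\<Sum>i\<in>G. z i) / (\<Sum>i\<in>G. N (z i))"
            using pos by (simp add: pos_le_divide_eq)
        qed (use zero in auto)
        then have "d \<le> N (\<Sum>i\<in>G. z i) / (\<Sum>i\<in>G. N (z i))" using le delta by linarith
        then show ?thesis using pos by (simp add: pos_le_divide_eq)
      qed (use sum_N[OF z] in simp)
    qed
  qed
qed

text \<open>Bounds independent of the norm and of the block basis, which guarantee that the real
  suprema in \<open>delta_dot\<close> and \<open>delta_ddot\<close> are taken over bounded
  sets.\<close>

lemma delta_block_basis_bounds:
  assumes "projections y Q K" and N: "equivalent_norm_on (closed_span y) N" and x: "block_basis y x"
  shows "0 \<le> delta a \<alpha> N x" "delta a \<alpha> N x \<le> 1"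
proof -
  interpret projections y Q K by fact
  have "span (range x) \<subseteq> closed_span y"
    using block_basis_span[OF x] closure_subset by blast
  then have "equivalent_norm_on (span (range x)) N"
    by (rule equivalent_norm_on_subset[OF N])
  then show "0 \<le> delta a \<alpha> N x" "delta a \<alpha> N x \<le> 1"
    using delta_nonneg delta_le_1 projections_block_basis[OF x] by blast+
qed

lemma delta_dot_bounds:
  assumes "projections y Q K" and N: "equivalent_norm_on (closed_span y) N"
  shows "delta_dot a \<alpha> N y \<le> 1" and "block_basis y x \<Longrightarrow> delta a \<alpha> N x \<le> delta_dot a \<alpha> N y"
proof -
  interpret projections y Q K by fact
  note bounds = delta_block_basis_bounds[OF assms]
  show "delta_dot a \<alpha> N y \<le> 1"
    unfolding delta_dot_def by (rule cSup_least) (use block_basis_self bounds in auto)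
  show "delta a \<alpha> N x \<le> delta_dot a \<alpha> N y" if "block_basis y x"
    unfolding delta_dot_def by (rule cSup_upper) (use that bounds in \<open>auto intro!: bdd_aboveI\<close>)
qed

lemma delta_le_delta_ddot:
  assumes "projections y Q K" "equivalent_norm_on (closed_span y) N" "block_basis y x"
  shows "delta a \<alpha> N x \<le> delta_ddot a \<alpha> y"
proof -
  have "delta_dot a \<alpha> N y \<le> delta_ddot a \<alpha> y"
    unfolding delta_ddot_def
    by (rule cSup_upper) (use assms delta_dot_bounds(1) in \<open>auto intro!: bdd_aboveI\<close>)
  then show ?thesis
    using delta_dot_bounds(2)[OF assms] by (rule order_trans[rotated])
qed

lemma less_delta_ddotE:
  assumes "projections y Q K" "t < delta_ddot a \<alpha> y"
  obtains N x where "equivalent_norm_on (closed_span y) N" "block_basis y x" "t < delta a \<alpha> N x"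
proof -
  interpret projections y Q K by fact
  have "{delta_dot a \<alpha> N y |N. equivalent_norm_on (closed_span y) N} \<noteq> {}"
    using equivalent_norm_on_norm by blast
  from less_cSupE[OF assms(2)[unfolded delta_ddot_def] this]
  obtain N where N: "equivalent_norm_on (closed_span y) N" "t < delta_dot a \<alpha> N y" by blast
  have "{delta a \<alpha> N x |x. block_basis y x} \<noteq> {}"
    using block_basis_self by blast
  from less_cSupE[OF N(2)[unfolded delta_dot_def] this]
  obtain x where "block_basis y x" "t < delta a \<alpha> N x" by blast
  then show ?thesis using N(1) that by blast
qed

text \<open>One good block basis in each tail is enough, since far out \<open>delta\<close> of every
  block basis of a tail is within \<open>\<epsilon> n\<close> of
  \<open>\<gamma> \<alpha>\<close>.\<close>

lemma Delta_stabilizes_leI: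
  assumes "Delta_stabilizes a y \<gamma>"
    and "\<And>M. \<exists>u. block_basis (\<lambda>i. y (i + M)) u \<and> c \<le> delta a \<alpha> norm u"
  shows "c \<le> \<gamma> \<alpha>"
proof -
  obtain \<epsilon> m where \<epsilon>: "\<epsilon> \<longlonglongrightarrow> 0" and m: "\<And>n u. n \<ge> m \<Longrightarrow> block_basis (\<lambda>i. y (i + n)) u \<Longrightarrow>
      \<bar>delta a \<alpha> norm u - \<gamma> \<alpha>\<bar> < \<epsilon> n"
    using assms(1) unfolding Delta_stabilizes_def by blast
  have "c - \<gamma> \<alpha> \<le> \<epsilon> n" if "n \<ge> m" for n
    using assms(2)[of n] m[OF that] by fastforce
  then have "c - \<gamma> \<alpha> \<le> 0"
    using \<epsilon> by (intro LIMSEQ_le_const[where X=\<epsilon>]) auto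
  then show ?thesis by simp
qed

text \<open>A tail is a block basis of itself; it is taken so far out that the stabilization error
  is smaller than the gap \<open>\<gamma> \<alpha> - c\<close>.\<close>

lemma Delta_stabilizes_lessE:
  assumes "Delta_stabilizes a y \<gamma>" "projections y Q K" "c < \<gamma> \<alpha>"
  obtains M where "c < delta a \<alpha> norm (\<lambda>i. y (i + M))"
proof -
  obtain \<epsilon> m where \<epsilon>: "\<epsilon> \<longlonglongrightarrow> 0" and m: "\<And>n u. n \<ge> m \<Longrightarrow> block_basis (\<lambda>i. y (i + n)) u \<Longrightarrow>
      \<bar>delta a \<alpha> norm u - \<gamma> \<alpha>\<bar> < \<epsilon> n"
    using assms(1) unfolding Delta_stabilizes_def by blast
  have "eventually (\<lambda>n. \<epsilon> n < \<gamma> \<alpha> - c) sequentially"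
    using order_tendstoD(2)[OF \<epsilon>, of "\<gamma> \<alpha> - c"] assms(3) by simp
  then obtain M where M: "M \<ge> m" "\<epsilon> M < \<gamma> \<alpha> - c"
    by (metis eventually_sequentially le_cases order_refl)
  have "projections (\<lambda>i. y (i + M)) (\<lambda>k. Q (k + M)) K"
    by (rule projections.projections_subseq[OF assms(2)]) (simp add: strict_mono_def)
  then have "block_basis (\<lambda>i. y (i + M)) (\<lambda>i. y (i + M))"
    by (rule projections.block_basis_self)
  from m[OF M(1) this] M(2) show ?thesis using that[of M] by linarith
qed

text \<open>A set of the class \<open>omul \<alpha> n + \<alpha>\<close>, moved far enough to the
  right, splits into blocks of the class \<open>omul \<alpha> n\<close> with labels in the class
  \<open>\<alpha>\<close>. The induction hypothesis treats each block sum, and \<open>est\<close>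
  treats the sequence of block sums, which adds one factor \<open>d\<close>.\<close>

lemma lower_estimate_iterate:
  assumes "projections x Q K" "N 0 = 0" "0 \<le> d"
    and est: "lower_estimate N x (\<lambda>i. i) (\<S> \<alpha>) d"
  shows "\<exists>f. (\<forall>i. i \<le> f i) \<and> lower_estimate N x f (\<S> (omul \<alpha> n)) (d ^ n)"
proof (induction n)
  case 0
  have "lower_estimate N x (\<lambda>i. i) (\<S> (omul \<alpha> 0)) (d ^ 0)"
    using assms(2) by (auto simp: lower_estimate_def schreier_0 schreier0_def)
  then show ?case by (intro exI[of _ "\<lambda>i. i"]) simp
next
  case (Suc n)
  interpret projections x Q K by fact
  obtain f where f: "\<And>i. i \<le> f i" and est_n: "lower_estimate N x f (\<S> (omul \<alpha> n)) (d ^ n)"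
    using Suc by blast
  obtain g where g: "\<And>i. i \<le> g i" and comp: "\<forall>G\<in>\<S> (omul \<alpha> n + \<alpha>). \<forall>\<phi>. strict_mono_on G \<phi> \<longrightarrow>
      (\<forall>i\<in>G. g i \<le> \<phi> i) \<longrightarrow> \<phi> ` G \<in> family_comp (\<S> \<alpha>) (\<S> (omul \<alpha> n))"
    using schreier_subset_family_comp by blast
  \<comment> \<open>A strictly increasing map above \<open>g\<close>, which itself need not be
    monotone.\<close>
  define h where "h i = i + (\<Sum>k\<le>i. g k)" for i
  have h: "strict_mono h" by (auto simp: strict_mono_Suc_iff h_def)
  have gh: "g i \<le> h i" for i
    using member_le_sum[of i "{..i}" g] by (simp add: h_def)
  have "lower_estimate N x (\<lambda>i. f (h i)) (\<S> (omul \<alpha> (Suc n))) (d ^ Suc n)"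
    unfolding lower_estimate_def
  proof (intro ballI allI impI)
    fix G z
    assume G: "G \<in> \<S> (omul \<alpha> (Suc n))" and z: "\<forall>i\<in>G. z i \<in> span (range x) \<and> psupp x (z i) \<subseteq> {f (h i)..}"
      and ord: "ordered_on G (\<lambda>i. psupp x (z i))"
    have inj: "inj h" using h by (rule strict_mono_imp_inj_on)
    have "h ` G \<in> family_comp (\<S> \<alpha>) (\<S> (omul \<alpha> n))"
      using comp G gh monotone_on_subset[OF h subset_UNIV] by simp
    then obtain I H where I: "I \<in> \<S> \<alpha>" and un: "h ` G = (\<Union>i\<in>I. H i)"
      and H: "\<And>i. i \<in> I \<Longrightarrow> H i \<in> \<S> (omul \<alpha> n)" "\<And>i. i \<in> I \<Longrightarrow> i \<in> H i" "\<And>i. i \<in> I \<Longrightarrow> H i \<subseteq> {i..}"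
        and ordH: "ordered_on I H"
      by (rule family_compE[OF _ regular_schreier]) (rule that; blast)
    \<comment> \<open>Only the labels move, from \<open>i\<close> to \<open>h i\<close>, while the
      vectors stay the same. The starting condition \<open>f (h i)\<close> is the one that
      \<open>est_n\<close> demands at the new label.\<close>
    define z' where "z' m = z (inv h m)" for m
    have z'_h [simp]: "z' (h i) = z i" for i by (simp add: z'_def inj)
    have z': "z' m \<in> span (range x)" "psupp x (z' m) \<subseteq> {f m..}" if "m \<in> h ` G" for m
      using that z by (auto simp: subset_iff)
    have ord': "ordered_on (h ` G) (\<lambda>m. psupp x (z' m))"
      using ord by (auto simp: ordered_on_def strict_mono_less[OF h])
    have fin: "finite I" "\<And>i. i \<in> I \<Longrightarrow> finite (H i)"
      using schreier_finite I H(1) by auto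
    have sub: "m \<in> h ` G" if "i \<in> I" "m \<in> H i" for i m
      using un that by blast
    define Z where "Z i = (\<Sum>m\<in>H i. z' m)" for i
    have Z_supp: "psupp x (Z i) \<subseteq> (\<Union>m\<in>H i. psupp x (z' m))" if "i \<in> I" for i
      unfolding Z_def by (rule psupp_sum_subset) (use that fin sub z' in auto)
    have Z_est: "d ^ n * (\<Sum>m\<in>H i. N (z' m)) \<le> N (Z i)" if "i \<in> I" for i
      unfolding Z_def
    proof (rule lower_estimateD[OF est_n H(1)[OF that]])
      show "ordered_on (H i) (\<lambda>m. psupp x (z' m))"
        by (rule ordered_on_mono[OF ord']) (use sub that in auto)
    qed (use sub that z' in blast)+
    have "d * (\<Sum>i\<in>I. N (Z i)) \<le> N (\<Sum>i\<in>I. Z i)"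
    proof (rule lower_estimateD[OF est I])
      fix i assume i: "i \<in> I"
      show "Z i \<in> span (range x)"
        unfolding Z_def by (rule span_sum) (use sub z' i in blast)
      show "psupp x (Z i) \<subseteq> {i..}"
      proof
        fix k assume "k \<in> psupp x (Z i)"
        then obtain m where m: "m \<in> H i" "k \<in> psupp x (z' m)" using Z_supp[OF i] by blast
        then have "i \<le> m" "f m \<le> k" using H(3)[OF i] z'(2)[OF sub[OF i]] by auto
        with f[of m] show "k \<in> {i..}" by simp
      qed
    next
      show "ordered_on I (\<lambda>i. psupp x (Z i))"
        unfolding ordered_on_def
      proof (intro ballI impI)
        fix i j assume ij: "i \<in> I" "j \<in> I" "i < j"
        have "set_before (psupp x (z' m)) (psupp x (z' m'))" if "m \<in> H i" "m' \<in> H j" for m m'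
          using ordered_onD[OF ordH ij] that sub ij
          by (intro ordered_onD[OF ord']) (auto simp: set_before_def)
        then have "set_before (\<Union>m\<in>H i. psupp x (z' m)) (\<Union>m\<in>H j. psupp x (z' m))"
          unfolding set_before_def by blast
        then show "set_before (psupp x (Z i)) (psupp x (Z j))"
          by (rule set_before_mono) (use Z_supp ij in auto)
      qed
    qed
    moreover have "d ^ n * (\<Sum>i\<in>G. N (z i)) \<le> (\<Sum>i\<in>I. N (Z i))"
    proof -
      have "(\<Sum>i\<in>G. N (z i)) = (\<Sum>m\<in>h ` G. N (z' m))"
        by (subst sum.reindex) (use inj in \<open>auto simp: inj_on_def\<close>)
      also have "\<dots> = (\<Sum>i\<in>I. \<Sum>m\<in>H i. N (z' m))"
        unfolding un by (rule sum_UN_ordered[OF fin ordH])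
      finally show ?thesis
        using Z_est by (simp add: sum_distrib_left sum_mono)
    qed
    moreover have "(\<Sum>i\<in>I. Z i) = (\<Sum>i\<in>G. z i)"
    proof -
      have "(\<Sum>i\<in>G. z i) = (\<Sum>m\<in>h ` G. z' m)"
        by (subst sum.reindex) (use inj in \<open>auto simp: inj_on_def\<close>)
      also have "\<dots> = (\<Sum>i\<in>I. Z i)"
        unfolding un Z_def by (rule sum_UN_ordered[OF fin ordH])
      finally show ?thesis by simp
    qed
    ultimately show "d ^ Suc n * (\<Sum>i\<in>G. N (z i)) \<le> N (\<Sum>i\<in>G. z i)"
      using mult_left_mono[of "d ^ n * (\<Sum>i\<in>G. N (z i))" "\<Sum>i\<in>I. N (Z i)" d] assms(3)
      by (simp add: mult.assoc)
  qed
  moreover have "i \<le> f (h i)" for i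
    using f[of "h i"] by (simp add: h_def)
  ultimately show ?case by (intro exI[of _ "\<lambda>i. f (h i)"]) blast
qed

text \<open>The iteration takes place in the norm \<open>N\<close>, and only its final result is
  transferred to the original norm. The equivalence constants therefore enter once, as
  \<open>c / C\<close>, whatever \<open>n\<close> is.\<close>

lemma Delta_stabilizes_ge_power:
  assumes stab: "Delta_stabilizes a y \<gamma>" and "projections y Q K"
    and N: "equivalent_norm_on (closed_span y) N" and x: "block_basis y x"
    and d: "0 \<le> d" "d \<le> delta a \<alpha> N x"
  shows "\<exists>c>0. \<forall>n. c * d ^ n \<le> \<gamma> (omul \<alpha> n)"
proof -
  interpret y: projections y Q K by fact
  interpret x: projections x "\<lambda>m. Q (Min (supp y (x m)))" K
    by (rule y.projections_block_basis[OF x])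
  have sub: "span (range x) \<subseteq> closed_span y"
    using y.block_basis_span[OF x] closure_subset by blast
  note N' = equivalent_norm_on_subset[OF N sub]
  obtain c C where c: "c > 0" and cC: "\<And>v. v \<in> closed_span y \<Longrightarrow> c * norm v \<le> N v \<and> N v \<le> C * norm v"
    using N unfolding equivalent_norm_on_def by blast
  have "c * norm (x 0) \<le> C * norm (x 0)"
    using cC[of "x 0"] sub span_base[of "x 0" "range x"] by force
  then have C: "C > 0" using c x.nonzero[of 0] by simp
  have "c / C * d ^ n \<le> \<gamma> (omul \<alpha> n)" for n
  proof (rule Delta_stabilizes_leI[OF stab])
    fix M
    have "lower_estimate N x (\<lambda>i. i) (\<S> \<alpha>) d"
      using le_delta_iff[OF x.projections_axioms N' d(1)] d(2) by blast
    then obtain f where f: "lower_estimate N x f (\<S> (omul \<alpha> n)) (d ^ n)"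
      using lower_estimate_iterate[OF x.projections_axioms _ d(1)] equivalent_norm_zero[OF N']
      by (metis span_zero)
    \<comment> \<open>The summand \<open>M\<close> moves the subsequence into the prescribed tail;
      the sum makes it sparse enough to absorb \<open>f\<close>.\<close>
    define \<phi> where "\<phi> j = M + j + (\<Sum>k\<le>Suc j. f k)" for j
    have \<phi>: "strict_mono \<phi>" by (auto simp: strict_mono_Suc_iff \<phi>_def)
    have f\<phi>: "f i \<le> Suc (\<phi> j)" if "i \<le> Suc j" for i j
      using member_le_sum[of i "{..Suc j}" f] that by (simp add: \<phi>_def)
    define u where "u = (\<lambda>i. x (\<phi> i))"
    interpret u: projections u "\<lambda>m. Q (Min (supp y (x (\<phi> m))))" K
      unfolding u_def by (rule x.projections_subseq[OF \<phi>])
    have est_N: "lower_estimate N u (\<lambda>i. i) (\<S> (omul \<alpha> n)) (d ^ n)"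
      unfolding u_def by (rule x.lower_estimate_subseq[OF \<phi> f\<phi> f])
    have u_sub: "span (range u) \<subseteq> closed_span y"
      using x.span_subseq sub unfolding u_def by blast
    have "lower_estimate norm u (\<lambda>i. i) (\<S> (omul \<alpha> n)) (c / C * d ^ n)"
      unfolding lower_estimate_def
    proof (intro ballI allI impI)
      fix G z
      assume G: "G \<in> \<S> (omul \<alpha> n)" and z: "\<forall>i\<in>G. z i \<in> span (range u) \<and> psupp u (z i) \<subseteq> {i..}"
        and ord: "ordered_on G (\<lambda>i. psupp u (z i))"
      have "c * d ^ n * (\<Sum>i\<in>G. norm (z i)) = d ^ n * (\<Sum>i\<in>G. c * norm (z i))"
        by (simp add: sum_distrib_left mult_ac)
      also have "\<dots> \<le> d ^ n * (\<Sum>i\<in>G. N (z i))"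
        using d(1) z u_sub cC by (intro mult_left_mono sum_mono) auto
      also have "\<dots> \<le> N (\<Sum>i\<in>G. z i)"
        by (rule lower_estimateD[OF est_N G]) (use z ord in auto)
      also have "\<dots> \<le> C * norm (\<Sum>i\<in>G. z i)"
        using cC u_sub z by (metis (no_types, lifting) span_sum subsetD)
      finally show "c / C * d ^ n * (\<Sum>i\<in>G. norm (z i)) \<le> norm (\<Sum>i\<in>G. z i)"
        using C by (simp add: field_simps)
    qed
    then have "c / C * d ^ n \<le> delta a (omul \<alpha> n) norm u"
      using le_delta_iff[OF u.projections_axioms equivalent_norm_on_norm] c C d(1) by simp
    moreover have "block_basis (\<lambda>i. y (i + M)) u"
    proof (rule y.block_basis_tail)
      show "block_basis y u" unfolding u_def by (rule y.block_basis_subseq[OF x \<phi>])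
      show "supp y (u i) \<subseteq> {M..}" for i
        using y.block_basis_supp_ge[OF x, of "\<phi> i"] by (force simp: u_def \<phi>_def)
    qed
    ultimately show "\<exists>u. block_basis (\<lambda>i. y (i + M)) u \<and> c / C * d ^ n \<le> delta a (omul \<alpha> n) norm u"
      by blast
  qed
  then show ?thesis using c C by (intro exI[of _ "c / C"]) simp
qed

end

section \<open>Renorming\<close>

text \<open>Reduces a bound on a sum of suprema to simultaneous choices of one element from each
  set. It will be applied to independent choices of intervals for each vector of an admissible
  sequence.\<close>

lemma sum_cSup_le:
  fixes C :: "'i \<Rightarrow> real set"
  assumes "finite I" "\<And>i. i \<in> I \<Longrightarrow> C i \<noteq> {}"
    and "\<And>c. (\<And>i. i \<in> I \<Longrightarrow> c i \<in> C i) \<Longrightarrow> (\<Sum>i\<in>I. c i) \<le> B"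
  shows "(\<Sum>i\<in>I. Sup (C i)) \<le> B"
  using assms
proof (induction I arbitrary: B rule: finite_induct)
  case empty
  then show ?case by simp
next
  case (insert i I)
  have "(\<Sum>j\<in>I. Sup (C j)) \<le> B - b" if b: "b \<in> C i" for b
  proof (rule insert.IH)
    fix c assume "\<And>j. j \<in> I \<Longrightarrow> c j \<in> C j"
    then have "(\<Sum>j\<in>insert i I. (c(i := b)) j) \<le> B"
      using b by (intro insert.prems(2)) auto
    moreover have "(\<Sum>j\<in>I. (c(i := b)) j) = (\<Sum>j\<in>I. c j)"
      by (rule sum.cong) (use insert.hyps in auto)
    ultimately show "(\<Sum>j\<in>I. c j) \<le> B - b"
      using insert.hyps by simp
  qed (use insert.prems in auto)
  then have "Sup (C i) \<le> B - (\<Sum>j\<in>I. Sup (C j))"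
    using insert.prems(1)[of i] by (intro cSup_least) (auto simp: algebra_simps)
  then show ?case using insert.hyps by simp
qed

section \<open>Seminorms and their suprema\<close>

definition seminorm :: "('a::real_vector \<Rightarrow> real) \<Rightarrow> bool" where
  "seminorm \<phi> \<longleftrightarrow> (\<forall>u v. \<phi> (u + v) \<le> \<phi> u + \<phi> v) \<and> (\<forall>c v. \<phi> (c *\<^sub>R v) = \<bar>c\<bar> * \<phi> v)"

lemma seminorm_triangle: "seminorm \<phi> \<Longrightarrow> \<phi> (u + v) \<le> \<phi> u + \<phi> v"
  and seminorm_scale: "seminorm \<phi> \<Longrightarrow> \<phi> (c *\<^sub>R v) = \<bar>c\<bar> * \<phi> v"
  by (simp_all add: seminorm_def)

lemma seminorm_nonneg: "seminorm \<phi> \<Longrightarrow> 0 \<le> \<phi> v"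
  using seminorm_triangle[of \<phi> v "- 1 *\<^sub>R v"] seminorm_scale[of \<phi> "- 1" v] seminorm_scale[of \<phi> 0 v]
  by simp

lemma subspace_closure:
  fixes S :: "'a::real_normed_vector set"
  assumes "subspace S"
  shows "subspace (closure S)"
proof (rule subspaceI)
  show "0 \<in> closure S"
    using subspace_0[OF assms] closure_subset by blast
  show "u + v \<in> closure S" if uv: "u \<in> closure S" "v \<in> closure S" for u v
  proof -
    obtain f g where "\<forall>n. f n \<in> S" "f \<longlonglongrightarrow> u" "\<forall>n. g n \<in> S" "g \<longlonglongrightarrow> v"
      using uv unfolding closure_sequential by blast
    then show ?thesis
      unfolding closure_sequential using subspace_add[OF assms] tendsto_add
      by (intro exI[of _ "\<lambda>n. f n + g n"]) blast
  qed
  show "c *\<^sub>R v \<in> closure S" if v: "v \<in> closure S" for c v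
  proof -
    obtain f where "\<forall>n. f n \<in> S" "f \<longlonglongrightarrow> v"
      using v unfolding closure_sequential by blast
    then show ?thesis
      unfolding closure_sequential using subspace_scale[OF assms] tendsto_scaleR[OF tendsto_const]
      by (intro exI[of _ "\<lambda>n. c *\<^sub>R f n"]) blast
  qed
qed

text \<open>The real supremum is controlled only where the family is bounded, hence the restriction
  to \<open>V\<close>. Homogeneity follows from one inequality applied to both \<open>c\<close> and
  \<open>inverse c\<close>.\<close>

lemma
  fixes V :: "'a::real_normed_vector set"
  assumes ne: "\<Phi> \<noteq> {}" and "\<forall>\<phi>\<in>\<Phi>. seminorm \<phi>" and V: "subspace V"
    and bound: "\<forall>\<phi>\<in>\<Phi>. \<forall>v\<in>V. \<phi> v \<le> B * norm v"
  shows SUP_seminorm_upper: "\<phi> \<in> \<Phi> \<Longrightarrow> v \<in> V \<Longrightarrow> \<phi> v \<le> (SUP \<phi>\<in>\<Phi>. \<phi> v)"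
    and SUP_seminorm_bound: "v \<in> V \<Longrightarrow> (SUP \<phi>\<in>\<Phi>. \<phi> v) \<le> B * norm v"
    and SUP_seminorm_triangle: "u \<in> V \<Longrightarrow> v \<in> V \<Longrightarrow>
      (SUP \<phi>\<in>\<Phi>. \<phi> (u + v)) \<le> (SUP \<phi>\<in>\<Phi>. \<phi> u) + (SUP \<phi>\<in>\<Phi>. \<phi> v)"
    and SUP_seminorm_scale: "v \<in> V \<Longrightarrow> (SUP \<phi>\<in>\<Phi>. \<phi> (c *\<^sub>R v)) = \<bar>c\<bar> * (SUP \<phi>\<in>\<Phi>. \<phi> v)"
proof -
  have sn: "seminorm \<phi>" if "\<phi> \<in> \<Phi>" for \<phi>
    using assms(2) that by blast
  show upper: "\<phi> v \<le> (SUP \<phi>\<in>\<Phi>. \<phi> v)" if "\<phi> \<in> \<Phi>" "v \<in> V" for \<phi> v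
    by (rule cSUP_upper) (use that bound in \<open>auto intro!: bdd_aboveI\<close>)
  show "(SUP \<phi>\<in>\<Phi>. \<phi> v) \<le> B * norm v" if "v \<in> V" for v
    by (rule cSUP_least) (use that ne bound in auto)
  show "(SUP \<phi>\<in>\<Phi>. \<phi> (u + v)) \<le> (SUP \<phi>\<in>\<Phi>. \<phi> u) + (SUP \<phi>\<in>\<Phi>. \<phi> v)" if "u \<in> V" "v \<in> V" for u v
  proof (rule cSUP_least[OF ne])
    fix \<phi> assume "\<phi> \<in> \<Phi>"
    then show "\<phi> (u + v) \<le> (SUP \<phi>\<in>\<Phi>. \<phi> u) + (SUP \<phi>\<in>\<Phi>. \<phi> v)"
      using seminorm_triangle[OF sn, of \<phi> u v] upper that by (meson add_mono order_trans)
  qed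
  have le: "(SUP \<phi>\<in>\<Phi>. \<phi> (c *\<^sub>R v)) \<le> \<bar>c\<bar> * (SUP \<phi>\<in>\<Phi>. \<phi> v)" if "v \<in> V" for c v
  proof (rule cSUP_least[OF ne])
    fix \<phi> assume \<phi>: "\<phi> \<in> \<Phi>"
    show "\<phi> (c *\<^sub>R v) \<le> \<bar>c\<bar> * (SUP \<phi>\<in>\<Phi>. \<phi> v)"
      using mult_left_mono[OF upper[OF \<phi> that], of "\<bar>c\<bar>"] by (simp add: seminorm_scale[OF sn[OF \<phi>]])
  qed
  show "(SUP \<phi>\<in>\<Phi>. \<phi> (c *\<^sub>R v)) = \<bar>c\<bar> * (SUP \<phi>\<in>\<Phi>. \<phi> v)" if v: "v \<in> V" for v
  proof (cases "c = 0")
    case True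
    have "\<phi> 0 = 0" if "\<phi> \<in> \<Phi>" for \<phi>
      using seminorm_scale[OF sn[OF that], of 0 0] by simp
    then have "(\<lambda>\<phi>. \<phi> 0) ` \<Phi> = {0}" using ne by force
    then show ?thesis using True by simp
  next
    case False
    have "(SUP \<phi>\<in>\<Phi>. \<phi> v) \<le> \<bar>inverse c\<bar> * (SUP \<phi>\<in>\<Phi>. \<phi> (c *\<^sub>R v))"
      using le[OF subspace_scale[OF V v], of "inverse c" c] False by simp
    then have "\<bar>c\<bar> * (SUP \<phi>\<in>\<Phi>. \<phi> v) \<le> (SUP \<phi>\<in>\<Phi>. \<phi> (c *\<^sub>R v))"
      using False by (simp add: field_simps)
    then show ?thesis using le[OF v, of c] by simp
  qed
qed

text \<open>The points \<open>m \<in> F\<close> are the left ends of disjoint intervals \<open>[m, r m)\<close> of positive integers,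
  numbered as in \<^const>\<open>psupp\<close>; subtracting 1 turns them into indices of projections.\<close>

definition interval_family :: "nat set \<Rightarrow> (nat \<Rightarrow> nat) \<Rightarrow> bool" where
  "interval_family F r \<longleftrightarrow> (\<forall>m\<in>F. m \<le> r m) \<and> (\<forall>m\<in>F. \<forall>m'\<in>F. m < m' \<longrightarrow> r m \<le> m')"

definition interval_sum :: "(nat \<Rightarrow> 'a \<Rightarrow> 'a::real_normed_vector) \<Rightarrow> nat set \<Rightarrow> (nat \<Rightarrow> nat) \<Rightarrow> 'a \<Rightarrow> real" where
  "interval_sum Q F r v = (\<Sum>m\<in>F. norm (Q (r m - 1) v - Q (m - 1) v))"

text \<open>The gaps are closed by moving each right end to the next left end, and the last one to
  \<open>L\<close>; the sum then telescopes.\<close>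

lemma interval_family_partition:
  fixes t :: "nat \<Rightarrow> 'b::ab_group_add"
  assumes "finite F" "F \<noteq> {}" "interval_family F r" "\<And>m. m \<in> F \<Longrightarrow> r m \<le> L"
  shows "\<exists>s. (\<forall>m\<in>F. r m \<le> s m) \<and> interval_family F s \<and> (\<Sum>m\<in>F. t (s m) - t m) = t L - t (Min F)"
  using assms
proof (induction F rule: finite_linorder_min_induct)
  case (insert b A)
  have b: "b \<notin> A" using insert.hyps by auto
  show ?case
  proof (cases "A = {}")
    case True
    then show ?thesis
      using insert.prems by (intro exI[of _ "\<lambda>_. L"]) (auto simp: interval_family_def)
  next
    case False
    then obtain s where s: "\<forall>m\<in>A. r m \<le> s m" "interval_family A s"
      "(\<Sum>m\<in>A. t (s m) - t m) = t L - t (Min A)"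
      using insert.IH insert.prems by (auto simp: interval_family_def)
    have Min: "Min A \<in> A" "\<And>m. m \<in> A \<Longrightarrow> Min A \<le> m" "b < Min A"
      using False insert.hyps by auto
    have 1: "\<forall>m\<in>insert b A. r m \<le> (s(b := Min A)) m"
      using insert.prems(2) Min s(1) by (auto simp: interval_family_def)
    have 2: "interval_family (insert b A) (s(b := Min A))"
      using s(2) Min insert.hyps by (auto simp: interval_family_def dest: less_asym)
    have "(\<Sum>m\<in>A. t ((s(b := Min A)) m) - t m) = (\<Sum>m\<in>A. t (s m) - t m)"
      by (rule sum.cong) (use b in auto)
    moreover have "Min (insert b A) = b"
      using insert.hyps by (intro Min_eqI) auto
    ultimately have 3: "(\<Sum>m\<in>insert b A. t ((s(b := Min A)) m) - t m) = t L - t (Min (insert b A))"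
      using b insert.hyps(1) s(3) by simp
    show ?thesis using 1 2 3 by blast
  qed
qed simp

section \<open>Sums of norms over disjoint intervals\<close>

context projections
begin

lemma Q_Q: "v \<in> span (range x) \<Longrightarrow> Q m (Q n v) = Q (min m n) v"
proof -
  assume v: "v \<in> span (range x)"
  have "linear (\<lambda>v. Q m (Q n v))"
    using linear_compose[OF linear_Q linear_Q, of m n] by (simp add: o_def)
  then show "Q m (Q n v) = Q (min m n) v"
    by (rule linear_eq_on_span[OF _ linear_Q _ v]) (auto simp: Q_basis linear_0[OF linear_Q])
qed

lemma Q_diff_eq_0:
  assumes "v \<in> span (range x)" "m \<le> r" "psupp x v \<subseteq> {..<m} \<or> psupp x v \<subseteq> {r..}"
  shows "Q (r - 1) v - Q (m - 1) v = 0"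
  using assms(3)
proof
  assume *: "psupp x v \<subseteq> {..<m}"
  have "supp x v \<subseteq> {..<m - 1}" using * by (force simp: psupp_def)
  then have "supp x v \<subseteq> {..<m - 1}" "supp x v \<subseteq> {..<r - 1}" using assms(2) by auto
  then show ?thesis using assms(1) by (simp add: Q_eq_self)
next
  assume *: "psupp x v \<subseteq> {r..}"
  have "supp x v \<subseteq> {r - 1..}" using * by (force simp: psupp_def)
  then have "supp x v \<subseteq> {m - 1..}" "supp x v \<subseteq> {r - 1..}" using assms(2) by auto
  then show ?thesis using assms(1) by (simp add: Q_eq_0)
qed

lemma seminorm_interval_sum: "seminorm (interval_sum Q F r)"
proof -
  have "norm (Q i (u + v) - Q j (u + v)) \<le> norm (Q i u - Q j u) + norm (Q i v - Q j v)" for i j u v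
    unfolding linear_add[OF linear_Q] add_diff_add by (rule norm_triangle_ineq)
  moreover have "norm (Q i (c *\<^sub>R v) - Q j (c *\<^sub>R v)) = \<bar>c\<bar> * norm (Q i v - Q j v)" for i j c v
    by (simp add: linear_cmul[OF linear_Q] flip: scaleR_diff_right)
  ultimately show ?thesis
    by (auto simp: seminorm_def interval_sum_def sum_distrib_left simp flip: sum.distrib intro: sum_mono)
qed

text \<open>For a conditional basis the restriction of \<open>s\<close> to separated intervals is
  not controlled by its norm, so the intervals are first enlarged until they touch. The enlarged
  pieces add up to \<open>s - Q (Min F - 1) s\<close>, which costs the factor \<open>1 + K\<close>;
  cutting each piece back to its original interval costs the factor \<open>K\<close>.\<close>

lemma interval_sum_le:
  assumes est: "lower_estimate norm x (\<lambda>i. i) \<F> \<delta>" and \<delta>: "\<delta> > 0"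
    and F: "F \<in> \<F>" "finite F" and r: "interval_family F r" and s: "s \<in> span (range x)"
  shows "\<delta> * interval_sum Q F r s \<le> K * (1 + K) * norm s"
proof (cases "F = {}")
  case True
  then show ?thesis using K_ge_1 by (simp add: interval_sum_def)
next
  case False
  obtain L0 where L0: "supp x s \<subseteq> {..<L0}"
    using finite_supp[OF s] finite_nat_iff_bounded by blast
  \<comment> \<open>Beyond all right ends and beyond the support of \<open>s\<close>, so that the
    last projection fixes \<open>s\<close>.\<close>
  define L where "L = Suc L0 + (\<Sum>m\<in>F. r m)"
  have rL: "r m \<le> L" if "m \<in> F" for m
    using member_le_sum[OF that, of r] F(2) by (simp add: L_def)
  obtain q where q: "\<forall>m\<in>F. r m \<le> q m" "interval_family F q"
    and tele: "(\<Sum>m\<in>F. Q (q m - 1) s - Q (m - 1) s) = Q (L - 1) s - Q (Min F - 1) s"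
    using interval_family_partition[OF F(2) False r rL, of "\<lambda>m. Q (m - 1) s"] by blast
  define z where "z m = Q (q m - 1) s - Q (m - 1) s" for m
  have mr: "m \<le> r m" "m \<le> q m" if "m \<in> F" for m
    using r q(2) that by (auto simp: interval_family_def)
  have z_span: "z m \<in> span (range x)" for m
    unfolding z_def by (intro span_diff Q_in_span s)
  have z_supp: "psupp x (z m) \<subseteq> {m..<q m}" if "m \<in> F" for m
    using supp_Q_diff[OF s, of "m - 1" "q m - 1"] mr[OF that]
    by (fastforce simp: psupp_def z_def)
  have "\<delta> * (\<Sum>m\<in>F. norm (z m)) \<le> norm (\<Sum>m\<in>F. z m)"
  proof (rule lower_estimateD[OF est F(1) z_span])
    show "psupp x (z m) \<subseteq> {m..}" if "m \<in> F" for m using z_supp[OF that] by auto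
    show "ordered_on F (\<lambda>m. psupp x (z m))"
      unfolding ordered_on_def
    proof (intro ballI impI)
      fix m m' assume m: "m \<in> F" "m' \<in> F" "m < m'"
      then have "q m \<le> m'" using q(2) by (auto simp: interval_family_def)
      then have "set_before {m..<q m} {m'..<q m'}" by (auto simp: set_before_def)
      then show "set_before (psupp x (z m)) (psupp x (z m'))"
        by (rule set_before_mono) (use z_supp m in auto)
    qed
  qed
  also have "(\<Sum>m\<in>F. z m) = s - Q (Min F - 1) s"
    using L0 unfolding z_def tele by (subst Q_eq_self[OF s]) (auto simp: L_def)
  also have "norm \<dots> \<le> norm s + K * norm s"
    using norm_triangle_ineq4[of s "Q (Min F - 1) s"] norm_Q[of "Min F - 1" s] by linarith
  finally have le: "\<delta> * (\<Sum>m\<in>F. norm (z m)) \<le> (1 + K) * norm s" by (simp add: algebra_simps)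
  have "norm (Q (r m - 1) s - Q (m - 1) s) \<le> K * norm (z m)" if m: "m \<in> F" for m
  proof -
    have "min (r m - 1) (q m - 1) = r m - 1" "min (r m - 1) (m - 1) = m - 1"
      using mr[OF m] q(1) m by auto
    then have "Q (r m - 1) (z m) = Q (r m - 1) s - Q (m - 1) s"
      unfolding z_def linear_diff[OF linear_Q] Q_Q[OF s] by simp
    then show ?thesis using norm_Q[of "r m - 1" "z m"] by simp
  qed
  then have "interval_sum Q F r s \<le> K * (\<Sum>m\<in>F. norm (z m))"
    unfolding interval_sum_def sum_distrib_left by (rule sum_mono)
  then have "\<delta> * interval_sum Q F r s \<le> K * (\<delta> * (\<Sum>m\<in>F. norm (z m)))"
    using mult_left_mono[of _ _ \<delta>] \<delta> by (simp add: mult.left_commute)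
  also have "\<dots> \<le> K * ((1 + K) * norm s)"
    using le K_ge_1 by (intro mult_left_mono) auto
  finally show ?thesis by (simp add: mult.assoc)
qed

text \<open>Intervals are intersected with the hull of the support, and those that miss it are
  discarded. The sum does not change, and left ends move only to the right. Clipping keeps the
  intervals chosen for successive blocks apart.\<close>

lemma interval_sum_clip:
  assumes \<F>: "regular_family \<F>" and F: "F \<in> \<F>" "F \<subseteq> {p..}" and r: "interval_family F r"
    and v: "v \<in> span (range x)"
  shows "\<exists>F' r'. F' \<in> \<F> \<and> F' \<subseteq> {p..} \<and> interval_family F' r' \<and>
    (\<forall>m\<in>F'. \<exists>k\<in>psupp x v. k \<le> m) \<and> (\<forall>m\<in>F'. \<exists>k\<in>psupp x v. m \<le> k) \<and>
    (\<forall>m\<in>F'. \<exists>k\<in>psupp x v. r' m \<le> Suc k) \<and> interval_sum Q F' r' v = interval_sum Q F r v"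
proof (cases "v = 0")
  case True
  then show ?thesis
    using regular_family_empty[OF \<F>]
    by (intro exI[of _ "{}"] exI[of _ r])
      (simp add: interval_family_def interval_sum_def linear_0[OF linear_Q])
next
  case False
  then have S: "finite (psupp x v)" "psupp x v \<noteq> {}"
    using finite_supp[OF v] supp_empty_iff[OF v] by (auto simp: psupp_def)
  define a where "a = Min (psupp x v)"
  define l where "l = Max (psupp x v)"
  have al: "a \<in> psupp x v" "l \<in> psupp x v" "a \<le> l" "psupp x v \<subseteq> {a..}" "psupp x v \<subseteq> {..<Suc l}"
    using S by (auto simp: a_def l_def less_Suc_eq_le)
  \<comment> \<open>Intervals are half-open, so \<open>r m \<le> a\<close> means that the interval
    ends before the support. For \<open>m < m'\<close> in \<open>H\<close> one has
    \<open>a < r m \<le> m'\<close>; thus at most the first left end is moved by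
    \<open>\<phi>\<close>, which makes \<open>\<phi>\<close> strictly monotone on
    \<open>H\<close>.\<close>
  define H where "H = {m \<in> F. a < r m \<and> m \<le> l}"
  define \<phi> where "\<phi> m = max m a" for m
  have HF: "H \<subseteq> F" by (auto simp: H_def)
  have mono: "strict_mono_on H \<phi>"
    using r by (fastforce simp: strict_mono_on_def \<phi>_def H_def interval_family_def)
  then have inj: "inj_on \<phi> H" by (rule strict_mono_on_imp_inj_on)
  define r' where "r' n = min (r (inv_into H \<phi> n)) (Suc l)" for n
  have r': "r' (\<phi> m) = min (r m) (Suc l)" if "m \<in> H" for m
    using inj that by (simp add: r'_def)
  have fin: "finite F" using regular_family_finite[OF \<F> F(1)] .
  have "\<phi> ` H \<in> \<F>"
    by (rule regular_family_spread[OF \<F> F(1) HF mono]) (simp add: \<phi>_def)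
  moreover have "\<phi> ` H \<subseteq> {p..}" using F(2) HF by (force simp: \<phi>_def)
  moreover have "interval_family (\<phi> ` H) r'"
    unfolding interval_family_def
  proof (intro conjI ballI impI)
    fix n assume "n \<in> \<phi> ` H"
    then obtain m where m: "m \<in> H" "n = \<phi> m" by blast
    have "\<phi> m \<le> min (r m) (Suc l)"
      using r al(3) m(1) by (auto simp: \<phi>_def H_def interval_family_def)
    then show "n \<le> r' n" using m by (simp add: r')
    fix n' assume "n' \<in> \<phi> ` H" and "n < n'"
    then obtain m' where m': "m' \<in> H" "n' = \<phi> m'" by blast
    then have "m < m'"
      using \<open>n < n'\<close> m by (auto simp: \<phi>_def split: if_splits)
    then have "r m \<le> m'" using r m(1) m'(1) by (auto simp: interval_family_def H_def)
    then have "min (r m) (Suc l) \<le> \<phi> m'" by (auto simp: \<phi>_def)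
    then show "r' n \<le> n'" using m m' by (simp add: r')
  qed
  moreover have "\<forall>m\<in>\<phi> ` H. \<exists>k\<in>psupp x v. k \<le> m"
    using al(1) by (auto simp: \<phi>_def intro: max.cobounded2)
  moreover have "\<forall>m\<in>\<phi> ` H. \<exists>k\<in>psupp x v. m \<le> k"
    using al(2,3) by (intro ballI bexI[of _ l]) (auto simp: \<phi>_def H_def)
  moreover have "\<forall>m\<in>\<phi> ` H. \<exists>k\<in>psupp x v. r' m \<le> Suc k"
    using al(2) by (intro ballI bexI[of _ l]) (auto simp: r'_def)
  moreover have "interval_sum Q (\<phi> ` H) r' v = interval_sum Q F r v"
  proof -
    have self: "Q (n - 1) v = v" if "l < n" for n
    proof -
      have "supp x v \<subseteq> {..<n - 1}" using al(5) that by (force simp: psupp_def)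
      then show ?thesis using v by (simp add: Q_eq_self)
    qed
    have zero: "Q (n - 1) v = 0" if "n \<le> a" for n
    proof -
      have "supp x v \<subseteq> {n - 1..}" using al(4) that by (force simp: psupp_def)
      then show ?thesis using v by (simp add: Q_eq_0)
    qed
    have "interval_sum Q (\<phi> ` H) r' v = (\<Sum>m\<in>H. norm (Q (r' (\<phi> m) - 1) v - Q (\<phi> m - 1) v))"
      unfolding interval_sum_def by (simp add: sum.reindex[OF inj])
    also have "\<dots> = (\<Sum>m\<in>H. norm (Q (r m - 1) v - Q (m - 1) v))"
    proof (rule sum.cong[OF refl])
      fix m assume m: "m \<in> H"
      have "Q (r' (\<phi> m) - 1) v = Q (r m - 1) v"
        using self[of "r m"] self[of "Suc l"] by (simp add: r'[OF m] min_def)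
      moreover have "Q (\<phi> m - 1) v = Q (m - 1) v"
        using zero[of m] zero[of a] by (simp add: \<phi>_def max_def)
      ultimately show "norm (Q (r' (\<phi> m) - 1) v - Q (\<phi> m - 1) v) = norm (Q (r m - 1) v - Q (m - 1) v)"
        by simp
    qed
    also have "\<dots> = interval_sum Q F r v"
      unfolding interval_sum_def
    proof (rule sum.mono_neutral_left[OF fin HF], intro ballI)
      fix m assume m: "m \<in> F - H"
      then have mr: "m \<le> r m" using r by (auto simp: interval_family_def)
      have "psupp x v \<subseteq> {..<m} \<or> psupp x v \<subseteq> {r m..}"
        using m al(4,5) by (force simp: H_def)
      then show "norm (Q (r m - 1) v - Q (m - 1) v) = 0"
        using Q_diff_eq_0[OF v mr] by simp
    qed
    finally show ?thesis .
  qed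
  ultimately show ?thesis by blast
qed

end

section \<open>Superadditivity along admissible families\<close>

context schreier_classes
begin

text \<open>After clipping, the intervals chosen for \<open>z i\<close> lie in the hull of its
  support. The families are then ordered like the vectors and start beyond \<open>h i\<close>, so
  their union has the class \<open>\<beta> + \<alpha>\<close>, and each interval sees a single
  summand of the total.\<close>

lemma interval_sum_superadditive:
  assumes "projections x Q K"
    and h: "\<And>I G. I \<in> \<S> \<alpha> \<Longrightarrow> (\<And>i. i \<in> I \<Longrightarrow> G i \<in> \<S> \<beta> \<and> G i \<subseteq> {h i..}) \<Longrightarrow> ordered_on I G \<Longrightarrow>
      (\<Union>i\<in>I. G i) \<in> \<S> (\<beta> + \<alpha>)"
    and I: "I \<in> \<S> \<alpha>"
    and z: "\<And>i. i \<in> I \<Longrightarrow> z i \<in> span (range x)" "\<And>i. i \<in> I \<Longrightarrow> psupp x (z i) \<subseteq> {h i..}"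
    and ord: "ordered_on I (\<lambda>i. psupp x (z i))"
    and F: "\<And>i. i \<in> I \<Longrightarrow> F i \<in> \<S> \<beta>" "\<And>i. i \<in> I \<Longrightarrow> F i \<subseteq> {p..}" "\<And>i. i \<in> I \<Longrightarrow> interval_family (F i) (r i)"
  shows "\<exists>F' r'. F' \<in> \<S> (\<beta> + \<alpha>) \<and> F' \<subseteq> {p..} \<and> interval_family F' r' \<and>
    (\<Sum>i\<in>I. interval_sum Q (F i) (r i) (z i)) = interval_sum Q F' r' (\<Sum>i\<in>I. z i)"
proof -
  interpret projections x Q K by fact
  have "\<forall>i\<in>I. \<exists>F' r'. F' \<in> \<S> \<beta> \<and> F' \<subseteq> {p..} \<and> interval_family F' r' \<and>
    (\<forall>m\<in>F'. \<exists>k\<in>psupp x (z i). k \<le> m) \<and> (\<forall>m\<in>F'. \<exists>k\<in>psupp x (z i). m \<le> k) \<and>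
    (\<forall>m\<in>F'. \<exists>k\<in>psupp x (z i). r' m \<le> Suc k) \<and>
    interval_sum Q F' r' (z i) = interval_sum Q (F i) (r i) (z i)"
    by (intro ballI interval_sum_clip regular_schreier F z)
  then obtain E s where Es: "\<forall>i\<in>I. E i \<in> \<S> \<beta> \<and> E i \<subseteq> {p..} \<and> interval_family (E i) (s i) \<and>
    (\<forall>m\<in>E i. \<exists>k\<in>psupp x (z i). k \<le> m) \<and> (\<forall>m\<in>E i. \<exists>k\<in>psupp x (z i). m \<le> k) \<and>
    (\<forall>m\<in>E i. \<exists>k\<in>psupp x (z i). s i m \<le> Suc k) \<and>
    interval_sum Q (E i) (s i) (z i) = interval_sum Q (F i) (r i) (z i)"
    unfolding bchoice_iff by (elim exE) (rule that)
  have E: "E i \<in> \<S> \<beta>" "E i \<subseteq> {p..}" "interval_family (E i) (s i)"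
    "interval_sum Q (E i) (s i) (z i) = interval_sum Q (F i) (r i) (z i)" if "i \<in> I" for i
    using Es that by blast+
  have lower: "\<exists>k\<in>psupp x (z i). k \<le> m" and upper: "\<exists>k\<in>psupp x (z i). m \<le> k"
    and s_upper: "\<exists>k\<in>psupp x (z i). s i m \<le> Suc k" and s_ge: "m \<le> s i m"
    if "i \<in> I" "m \<in> E i" for i m
    using Es that by (auto simp: interval_family_def)
  have before: "k < k'" if "i \<in> I" "j \<in> I" "i < j" "k \<in> psupp x (z i)" "k' \<in> psupp x (z j)" for i j k k'
    using ordered_onD[OF ord that(1-3)] that(4,5) by (auto simp: set_before_def)
  have s_le: "s i m \<le> k" if "i \<in> I" "j \<in> I" "i < j" "m \<in> E i" "k \<in> psupp x (z j)" for i j m k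
    using s_upper[OF that(1,4)] before[OF that(1-3) _ that(5)] by (meson Suc_leI order_trans)
  have le_E: "k < m" if "i \<in> I" "j \<in> I" "i < j" "m \<in> E j" "k \<in> psupp x (z i)" for i j m k
    using lower[OF that(2,4)] before[OF that(1-3) that(5)] by (meson less_le_trans)
  have E_less: "m < m'" if "i \<in> I" "j \<in> I" "i < j" "m \<in> E i" "m' \<in> E j" for i j m m'
    using upper[OF that(1,4)] le_E[OF that(1-3,5)] by (meson le_less_trans)
  have sE: "s i m \<le> m'" if "i \<in> I" "j \<in> I" "i < j" "m \<in> E i" "m' \<in> E j" for i j m m'
    using lower[OF that(2,5)] s_le[OF that(1-4)] by (meson order_trans)
  have ordE: "ordered_on I E"
    unfolding ordered_on_def set_before_def using E_less by blast
  define \<iota> where "\<iota> m = (SOME i. i \<in> I \<and> m \<in> E i)" for m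
  have \<iota>: "\<iota> m = i" if "i \<in> I" "m \<in> E i" for i m
    unfolding \<iota>_def
  proof (rule some_equality)
    show "j = i" if j: "j \<in> I \<and> m \<in> E j" for j
      using E_less[of i j m m] E_less[of j i m m] j \<open>i \<in> I\<close> \<open>m \<in> E i\<close> by (metis less_irrefl linorder_neqE_nat)
  qed (use that in simp)
  define F' where "F' = (\<Union>i\<in>I. E i)"
  define r' where "r' m = s (\<iota> m) m" for m
  have r': "r' m = s i m" if "i \<in> I" "m \<in> E i" for i m
    using \<iota>[OF that] by (simp add: r'_def)
  have "F' \<in> \<S> (\<beta> + \<alpha>)"
    unfolding F'_def
  proof (rule h[OF I _ ordE])
    fix i assume i: "i \<in> I"
    have "h i \<le> m" if "m \<in> E i" for m
      using lower[OF i that] z(2)[OF i] by auto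
    then show "E i \<in> \<S> \<beta> \<and> E i \<subseteq> {h i..}" using E(1)[OF i] by auto
  qed
  moreover have "F' \<subseteq> {p..}" using E(2) by (auto simp: F'_def)
  moreover have "interval_family F' r'"
    unfolding interval_family_def
  proof (intro conjI ballI impI)
    fix m assume "m \<in> F'"
    then obtain i where i: "i \<in> I" "m \<in> E i" by (auto simp: F'_def)
    then show "m \<le> r' m" using s_ge by (simp add: r')
    fix m' assume "m' \<in> F'" and less: "m < m'"
    then obtain j where j: "j \<in> I" "m' \<in> E j" by (auto simp: F'_def)
    consider "i < j" | "i = j" | "j < i" by linarith
    then show "r' m \<le> m'"
    proof cases
      case 1
      then show ?thesis using sE i j by (simp add: r')
    next
      case 2
      then show ?thesis using E(3)[OF i(1)] i j less by (auto simp: r' interval_family_def)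
    next
      case 3
      then show ?thesis using E_less[of j i m' m] i j less by simp
    qed
  qed
  moreover have "(\<Sum>i\<in>I. interval_sum Q (F i) (r i) (z i)) = interval_sum Q F' r' (\<Sum>i\<in>I. z i)"
  proof -
    have finI: "finite I" using schreier_finite[OF I] .
    have finE: "finite (E i)" if "i \<in> I" for i using schreier_finite[OF E(1)[OF that]] .
    \<comment> \<open>An interval chosen for \<open>z i\<close> starts after the supports of the
      earlier vectors and ends before those of the later ones, so every other summand contributes
      zero.\<close>
    have eq: "Q (r' m - 1) (\<Sum>j\<in>I. z j) - Q (m - 1) (\<Sum>j\<in>I. z j) = Q (s i m - 1) (z i) - Q (m - 1) (z i)"
      if i: "i \<in> I" and m: "m \<in> E i" for i m
    proof -
      have "Q (r' m - 1) (\<Sum>j\<in>I. z j) - Q (m - 1) (\<Sum>j\<in>I. z j) =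
          (\<Sum>j\<in>I. Q (s i m - 1) (z j) - Q (m - 1) (z j))"
        by (simp add: r'[OF i m] linear_sum[OF linear_Q] sum_subtractf)
      also have "\<dots> = (\<Sum>j\<in>{i}. Q (s i m - 1) (z j) - Q (m - 1) (z j))"
      proof (rule sum.mono_neutral_right[OF finI], use i in simp, intro ballI)
        fix j assume "j \<in> I - {i}"
        then have j: "j \<in> I" "j < i \<or> i < j" by auto
        then have "psupp x (z j) \<subseteq> {..<m} \<or> psupp x (z j) \<subseteq> {s i m..}"
          using s_le[OF i j(1) _ m] le_E[OF j(1) i _ m] by auto
        then show "Q (s i m - 1) (z j) - Q (m - 1) (z j) = 0"
          by (rule Q_diff_eq_0[OF z(1)[OF j(1)] s_ge[OF i m]])
      qed
      finally show ?thesis by simp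
    qed
    have "interval_sum Q F' r' (\<Sum>i\<in>I. z i) =
        (\<Sum>i\<in>I. \<Sum>m\<in>E i. norm (Q (r' m - 1) (\<Sum>j\<in>I. z j) - Q (m - 1) (\<Sum>j\<in>I. z j)))"
      unfolding interval_sum_def F'_def by (rule sum_UN_ordered[OF finI finE ordE])
    also have "\<dots> = (\<Sum>i\<in>I. interval_sum Q (E i) (s i) (z i))"
      unfolding interval_sum_def by (intro sum.cong refl) (simp only: eq)
    also have "\<dots> = (\<Sum>i\<in>I. interval_sum Q (F i) (r i) (z i))"
      by (rule sum.cong) (simp_all add: E(4))
    finally show ?thesis by simp
  qed
  ultimately show ?thesis by blast
qed

end

section \<open>Construction of the new norm\<close>

context schreier_classes
begin

text \<open>The factor \<open>K * (1 + K)\<close> in the hypothesis is the loss in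
  \<open>interval_sum_le\<close>. It is paid once, at level \<open>n\<close>, and not at each of the
  \<open>n\<close> steps.\<close>

lemma renorming:
  assumes "projections y Q K" and d: "0 < d" and n: "0 < n"
    and large: "K * (1 + K) * d ^ n \<le> delta a (omul \<alpha> n) norm (\<lambda>i. y (i + M))"
  shows "d \<le> delta_ddot a \<alpha> y"
proof -
  interpret y: projections y Q K by fact
  define w where "w = (\<lambda>i. y (i + M))"
  define R where "R k = Q (k + M)" for k
  interpret w: projections w R K
    unfolding w_def R_def by (rule y.projections_subseq) (simp add: strict_mono_def)
  define \<delta> where "\<delta> = delta a (omul \<alpha> n) norm w"
  have K: "1 \<le> K" by (rule w.K_ge_1)
  have \<delta>: "K * (1 + K) * d ^ n \<le> \<delta>" "0 < \<delta>"
  proof -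
    show *: "K * (1 + K) * d ^ n \<le> \<delta>" using large by (simp add: \<delta>_def w_def)
    have "0 < K * (1 + K) * d ^ n" using K d by simp
    with * show "0 < \<delta>" by linarith
  qed
  have est: "lower_estimate norm w (\<lambda>i. i) (\<S> (omul \<alpha> n)) \<delta>"
    using le_delta_iff[OF w.projections_axioms equivalent_norm_on_norm, of \<delta> "omul \<alpha> n"] \<delta>(2)
    by (simp add: \<delta>_def)
  have "\<exists>p. \<forall>F\<in>\<S> (omul \<alpha> j). F \<subseteq> {p..} \<longrightarrow> F \<in> \<S> (omul \<alpha> n)" if "j \<le> n" for j
    by (rule schreier_almost_mono[OF omul_mono[OF that]])
  then obtain p' where p': "\<And>j F. j \<le> n \<Longrightarrow> F \<in> \<S> (omul \<alpha> j) \<Longrightarrow> F \<subseteq> {p' j..} \<Longrightarrow> F \<in> \<S> (omul \<alpha> n)"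
    by metis
  \<comment> \<open>Beyond \<open>p\<close>, the classes of all levels \<open>j \<le> n\<close> are
    contained in the top class, for which the estimate \<open>est\<close> is available. The
    \<open>Suc\<close> makes \<open>p\<close> positive, so that \<open>{p}\<close> is a Schreier
    set.\<close>
  define p where "p = Suc (\<Sum>j\<le>n. p' j)"
  have p: "F \<in> \<S> (omul \<alpha> n)" if "j \<le> n" "F \<in> \<S> (omul \<alpha> j)" "F \<subseteq> {p..}" for j F
  proof (rule p'[OF that(1,2)])
    have "p' j \<le> p" using member_le_sum[of j "{..n}" p'] that(1) by (simp add: p_def)
    then show "F \<subseteq> {p' j..}" using that(3) by auto
  qed
  define \<Phi> where "\<Phi> j = {interval_sum R F r |F r. F \<in> \<S> (omul \<alpha> j) \<and> F \<subseteq> {p..} \<and> interval_family F r}" for j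
  have \<Phi>_ne: "\<Phi> j \<noteq> {}" for j
    using schreier_empty[of "omul \<alpha> j"] by (force simp: \<Phi>_def interval_family_def)
  have \<Phi>_sn: "seminorm \<phi>" if "\<phi> \<in> \<Phi> j" for \<phi> j
    using that w.seminorm_interval_sum by (auto simp: \<Phi>_def)
  have \<Phi>_w: "\<delta> * \<phi> s \<le> K * (1 + K) * norm s" if "\<phi> \<in> \<Phi> j" "j \<le> n" "s \<in> span (range w)" for \<phi> s j
    using that p schreier_finite by (auto simp: \<Phi>_def intro!: w.interval_sum_le[OF est \<delta>(2)])
  define V where "V = closed_span y"
  have V: "subspace V"
    unfolding V_def by (intro subspace_closure subspace_span)
  define B where "B = K * (1 + K) * (1 + K) / \<delta>"
  \<comment> \<open>The estimate is known only on the span of the tail \<open>w\<close>. Subtracting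
    \<open>Q M s\<close> changes no interval sum formed with \<open>R\<close> and costs the extra
    factor \<open>1 + K\<close>.\<close>
  have \<Phi>_span: "\<phi> s \<le> B * norm s" if \<phi>: "\<phi> \<in> \<Phi> j" "j \<le> n" and s: "s \<in> span (range y)" for \<phi> s j
  proof -
    define s' where "s' = s - Q M s"
    obtain L where L: "supp y s \<subseteq> {..<L}"
      using y.finite_supp[OF s] finite_nat_iff_bounded by blast
    have "Q (L + M) s = s" by (rule y.Q_eq_self[OF s]) (use L in auto)
    then have "supp y s' \<subseteq> {M..}"
      using y.supp_Q_diff[OF s, of M "L + M"] by (auto simp: s'_def)
    then have s'_w: "s' \<in> span (range w)"
      unfolding w_def by (intro y.span_tail) (auto simp: s'_def intro: span_diff s y.Q_in_span)
    have "R k s' = R k s - Q M s" for k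
      using y.Q_Q[OF s, of "k + M" M] by (simp add: s'_def R_def linear_diff[OF y.linear_Q])
    then have "interval_sum R F r s = interval_sum R F r s'" for F r
      by (simp add: interval_sum_def)
    then have "\<phi> s = \<phi> s'" using \<phi>(1) by (auto simp: \<Phi>_def)
    then have "\<delta> * \<phi> s \<le> K * (1 + K) * norm s'"
      using \<Phi>_w[OF \<phi> s'_w] by simp
    also have "\<dots> \<le> K * (1 + K) * ((1 + K) * norm s)"
      using K norm_triangle_ineq4[of s "Q M s"] y.norm_Q[of M s]
      by (intro mult_left_mono) (auto simp: s'_def algebra_simps)
    finally show ?thesis using \<delta>(2) by (simp add: B_def field_simps)
  qed
  \<comment> \<open>Interval sums are continuous, so the bound extends from the span to its
    closure.\<close>
  have bound: "\<phi> v \<le> B * norm v" if \<phi>: "\<phi> \<in> \<Phi> j" "j \<le> n" and v: "v \<in> V" for \<phi> v j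
  proof -
    obtain F r where \<phi>_eq: "\<phi> = interval_sum R F r" using \<phi>(1) by (auto simp: \<Phi>_def)
    have "closed {v. \<phi> v \<le> B * norm v}"
      unfolding \<phi>_eq interval_sum_def
      by (intro closed_Collect_le continuous_intros linear_continuous_on w.bounded_linear_Q)
    moreover have "span (range y) \<subseteq> {v. \<phi> v \<le> B * norm v}"
      using \<Phi>_span[OF \<phi>] by blast
    ultimately have "V \<subseteq> {v. \<phi> v \<le> B * norm v}"
      unfolding V_def by (rule closure_minimal[rotated])
    then show ?thesis using v by blast
  qed
  have \<Phi>_sn': "\<forall>\<phi>\<in>\<Phi> j. seminorm \<phi>" for j
    using \<Phi>_sn by blast
  have bound': "\<forall>\<phi>\<in>\<Phi> j. \<forall>v\<in>V. \<phi> v \<le> B * norm v" if "j \<le> n" for j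
    using bound that by blast
  define A where "A j v = (SUP \<phi>\<in>\<Phi> j. \<phi> v)" for j v
  have A_upper: "\<phi> v \<le> A j v" if "j \<le> n" "\<phi> \<in> \<Phi> j" "v \<in> V" for j \<phi> v
    unfolding A_def by (rule SUP_seminorm_upper[where \<Phi>="\<Phi> j" and V=V and B=B, OF \<Phi>_ne \<Phi>_sn' V bound'[OF that(1)]])
      (use that in auto)
  have A_bound: "A j v \<le> B * norm v" if "j \<le> n" "v \<in> V" for j v
    unfolding A_def by (rule SUP_seminorm_bound[where \<Phi>="\<Phi> j" and V=V and B=B, OF \<Phi>_ne \<Phi>_sn' V bound'[OF that(1)]])
      (use that in auto)
  have A_triangle: "A j (u + v) \<le> A j u + A j v" if "j \<le> n" "u \<in> V" "v \<in> V" for j u v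
    unfolding A_def by (rule SUP_seminorm_triangle[where \<Phi>="\<Phi> j" and V=V and B=B, OF \<Phi>_ne \<Phi>_sn' V bound'[OF that(1)]])
      (use that in auto)
  have A_scale: "A j (c *\<^sub>R v) = \<bar>c\<bar> * A j v" if "j \<le> n" "v \<in> V" for j c v
    unfolding A_def by (rule SUP_seminorm_scale[where \<Phi>="\<Phi> j" and V=V and B=B, OF \<Phi>_ne \<Phi>_sn' V bound'[OF that(1)]])
      (use that in auto)
  have A_nonneg: "0 \<le> A j v" if "j \<le> n" "v \<in> V" for j v
    using A_upper[OF that(1) _ that(2)] seminorm_nonneg[OF \<Phi>_sn] \<Phi>_ne[of j] by (meson ex_in_conv order_trans)
  \<comment> \<open>The set \<open>{p}\<close> belongs to the class of level 0, and one long
    interval starting at \<open>p\<close> captures everything beyond the initial part. Since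
    \<open>v\<close> is only in the closed span, the right end is chosen for an approximating vector
    \<open>s\<close>, and the error is removed at the end.\<close>
  have norm_le: "norm v \<le> norm (R (p - 1) v) + A 0 v" if v: "v \<in> V" for v
  proof -
    have approx: "norm v \<le> norm (R (p - 1) v) + A 0 v + (1 + K) * e" if e: "e > 0" for e
    proof -
      obtain s where s: "s \<in> span (range y)" "dist s v < e"
        using v e unfolding V_def closure_approachable by blast
      obtain L where L: "supp y s \<subseteq> {..<L}"
        using y.finite_supp[OF s(1)] finite_nat_iff_bounded by blast
      define r where "r = Suc (L + p)"
      have Rs: "R (r - 1) s = s"
        unfolding R_def by (rule y.Q_eq_self[OF s(1)]) (use L in \<open>auto simp: r_def\<close>)
      have "norm (R (r - 1) (v - s)) \<le> K * norm (v - s)" by (rule w.norm_Q)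
      also have "\<dots> \<le> K * e"
        using s(2) K by (intro mult_left_mono) (auto simp: dist_norm norm_minus_commute)
      finally have 1: "norm (R (r - 1) v - s) \<le> K * e"
        unfolding linear_diff[OF w.linear_Q] Rs .
      have "interval_sum R {p} (\<lambda>_. r) \<in> \<Phi> 0"
        unfolding \<Phi>_def
      proof (intro CollectI exI conjI)
        show "{p} \<in> \<S> (omul \<alpha> 0)" using schreier_singleton[of p 0] by (simp add: p_def)
      qed (auto simp: interval_family_def r_def)
      then have "norm (R (r - 1) v - R (p - 1) v) \<le> A 0 v"
        using A_upper[of 0 _ v] v by (force simp: interval_sum_def)
      moreover have "norm v \<le> norm (v - s) + (norm (R (r - 1) v - s)
          + (norm (R (r - 1) v - R (p - 1) v) + norm (R (p - 1) v)))"
      proof -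
        have "norm (a1 - a2 + a3 + a4) \<le> norm a1 + (norm a2 + (norm a3 + norm a4))" for a1 a2 a3 a4 :: 'a
          using norm_triangle_ineq[of "a1 - a2 + a3" a4] norm_triangle_ineq[of "a1 - a2" a3]
            norm_triangle_ineq4[of a1 a2] by linarith
        from this[of "v - s" "R (r - 1) v - s" "R (r - 1) v - R (p - 1) v" "R (p - 1) v"]
        show ?thesis by simp
      qed
      moreover have "norm (v - s) \<le> e" using s(2) by (simp add: dist_norm norm_minus_commute)
      ultimately show ?thesis using 1 unfolding distrib_right mult_1 by linarith
    qed
    have "norm v \<le> norm (R (p - 1) v) + A 0 v + e" if "e > 0" for e
    proof -
      have "(1 + K) * (e / (1 + K)) = e" "0 < e / (1 + K)" using that K by auto
      then show ?thesis using approx[of "e / (1 + K)"] by simp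
    qed
    then show ?thesis by (rule field_le_epsilon)
  qed
  \<comment> \<open>The extra term controls the initial part, which no interval starting beyond
    \<open>p\<close> sees. It will vanish on the span of the subsequence \<open>x\<close>.\<close>
  define N where "N v = norm (R (p - 1) v) + (\<Sum>j<n. d ^ j * A j v)" for v
  have N_norm: "equivalent_norm_on V N"
    unfolding equivalent_norm_on_def
  proof (intro conjI ballI allI)
    fix u v assume uv: "u \<in> V" "v \<in> V"
    have "norm (R (p - 1) (u + v)) \<le> norm (R (p - 1) u) + norm (R (p - 1) v)"
      by (simp add: linear_add[OF w.linear_Q] norm_triangle_ineq)
    moreover have "(\<Sum>j<n. d ^ j * A j (u + v)) \<le> (\<Sum>j<n. d ^ j * A j u + d ^ j * A j v)"
      using A_triangle[OF _ uv] d by (intro sum_mono) (simp flip: distrib_left)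
    ultimately show "N (u + v) \<le> N u + N v" by (simp add: N_def sum.distrib)
  next
    fix c v assume v: "v \<in> V"
    show "N (c *\<^sub>R v) = \<bar>c\<bar> * N v"
      using A_scale[OF _ v] by (simp add: N_def linear_cmul[OF w.linear_Q] distrib_left sum_distrib_left mult.left_commute)
  next
    have "1 * norm v \<le> N v \<and> N v \<le> (K + (\<Sum>j<n. d ^ j * B)) * norm v" if v: "v \<in> V" for v
    proof
      have "d ^ 0 * A 0 v \<le> (\<Sum>j<n. d ^ j * A j v)"
        by (rule member_le_sum) (use n d v A_nonneg in auto)
      then show "1 * norm v \<le> N v" using norm_le[OF v] by (simp add: N_def)
      have "(\<Sum>j<n. d ^ j * A j v) \<le> (\<Sum>j<n. d ^ j * B * norm v)"
        using A_bound[OF _ v] d by (intro sum_mono) (simp add: mult.assoc)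
      then show "N v \<le> (K + (\<Sum>j<n. d ^ j * B)) * norm v"
        using w.norm_Q[of "p - 1" v] by (simp add: N_def distrib_right sum_distrib_right)
    qed
    then show "\<exists>c>0. \<exists>C. \<forall>v\<in>V. c * norm v \<le> N v \<and> N v \<le> C * norm v"
      by (intro exI[of _ "1::real"] exI[of _ "K + (\<Sum>j<n. d ^ j * B)"]) auto
  qed
  have "\<forall>j. \<exists>h. \<forall>I\<in>\<S> \<alpha>. \<forall>G. (\<forall>i\<in>I. G i \<in> \<S> (omul \<alpha> j) \<and> G i \<subseteq> {h i..}) \<longrightarrow> ordered_on I G \<longrightarrow>
      (\<Union>i\<in>I. G i) \<in> \<S> (omul \<alpha> j + \<alpha>)"
    using family_comp_schreier_subset by blast
  then obtain h where h_all: "\<forall>j. \<forall>I\<in>\<S> \<alpha>. \<forall>G. (\<forall>i\<in>I. G i \<in> \<S> (omul \<alpha> j) \<and> G i \<subseteq> {h j i..}) \<longrightarrow>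
      ordered_on I G \<longrightarrow> (\<Union>i\<in>I. G i) \<in> \<S> (omul \<alpha> j + \<alpha>)"
    unfolding choice_iff by (elim exE) (rule that)
  have h: "(\<Union>i\<in>I. G i) \<in> \<S> (omul \<alpha> j + \<alpha>)"
    if "I \<in> \<S> \<alpha>" "\<And>i. i \<in> I \<Longrightarrow> G i \<in> \<S> (omul \<alpha> j) \<and> G i \<subseteq> {h j i..}" "ordered_on I G" for j I G
    using h_all that by simp
  \<comment> \<open>The summand \<open>p\<close> makes \<open>R (p - 1)\<close> vanish on the
    subsequence, and the double sum absorbs the starting conditions \<open>h j\<close> of all levels
    \<open>j < n\<close> at once.\<close>
  define \<psi> where "\<psi> i = p + i + (\<Sum>k\<le>Suc i. \<Sum>j<n. h j k)" for i
  have \<psi>: "strict_mono \<psi>" by (auto simp: strict_mono_Suc_iff \<psi>_def)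
  have h\<psi>: "h j i \<le> Suc (\<psi> k)" if "j < n" "i \<le> Suc k" for i j k
  proof -
    have "h j i \<le> (\<Sum>j<n. h j i)"
      using that(1) by (intro member_le_sum) auto
    also have "\<dots> \<le> (\<Sum>k\<le>Suc k. \<Sum>j<n. h j k)"
      using that(2) by (intro member_le_sum[of i]) auto
    finally show ?thesis by (simp add: \<psi>_def)
  qed
  define x where "x = (\<lambda>i. w (\<psi> i))"
  interpret x: projections x "\<lambda>m. R (\<psi> m)" K
    unfolding x_def by (rule w.projections_subseq[OF \<psi>])
  have x_blk: "block_basis y x"
    unfolding x_def w_def
    by (rule y.block_basis_subseq[OF y.block_basis_self]) (use \<psi> in \<open>simp add: strict_mono_def\<close>)
  have x_w: "span (range x) \<subseteq> span (range w)"
    unfolding x_def by (rule w.span_subseq)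
  have x_V: "span (range x) \<subseteq> V"
    using y.block_basis_span[OF x_blk] closure_subset unfolding V_def by blast
  have R_zero: "R (p - 1) z = 0" if z: "z \<in> span (range x)" for z
  proof (rule w.Q_eq_0)
    show "z \<in> span (range w)" using z x_w by blast
    show "supp w z \<subseteq> {p - 1..}"
      using w.supp_subseq[OF \<psi> z[unfolded x_def]] by (auto simp: \<psi>_def)
  qed
  have N_x: "N z = (\<Sum>j<n. d ^ j * A j z)" if "z \<in> span (range x)" for z
    using R_zero[OF that] by (simp add: N_def)
  have "lower_estimate N x (\<lambda>i. i) (\<S> \<alpha>) d"
    unfolding lower_estimate_def
  proof (intro ballI allI impI)
    fix I z
    assume I: "I \<in> \<S> \<alpha>" and z: "\<forall>i\<in>I. z i \<in> span (range x) \<and> psupp x (z i) \<subseteq> {i..}"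
      and ord: "ordered_on I (\<lambda>i. psupp x (z i))"
    have z_x: "z i \<in> span (range x)"
      and z_w: "z i \<in> span (range w)" if "i \<in> I" for i
      using z that x_w by auto
    have z_h: "psupp w (z i) \<subseteq> {h j i..}" if "i \<in> I" "j < n" for i j
      using z that(1) unfolding x_def by (intro w.psupp_subseq[OF \<psi> h\<psi>[OF that(2)]]) auto
    have ord_w: "ordered_on I (\<lambda>i. psupp w (z i))"
      using z_x ord unfolding x_def by (rule w.ordered_on_psupp_subseq[OF \<psi>])
    define Z where "Z = (\<Sum>i\<in>I. z i)"
    have Z: "Z \<in> span (range x)" "Z \<in> span (range w)" "Z \<in> V"
      using span_sum[of I z "range x"] z_x x_w x_V by (auto simp: Z_def)
    \<comment> \<open>Any families of level \<open>j\<close>, one for each \<open>z i\<close>, merge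
      into a single family of level \<open>Suc j\<close> for \<open>Z\<close>.\<close>
    have step: "(\<Sum>i\<in>I. A j (z i)) \<le> A (Suc j) Z" if j: "j < n" for j
      unfolding A_def[of j]
    proof (rule sum_cSup_le[OF schreier_finite[OF I]])
      show "(\<lambda>\<phi>. \<phi> (z i)) ` \<Phi> j \<noteq> {}" for i using \<Phi>_ne by simp
      fix c assume "\<And>i. i \<in> I \<Longrightarrow> c i \<in> (\<lambda>\<phi>. \<phi> (z i)) ` \<Phi> j"
      then have "\<forall>i\<in>I. \<exists>F r. F \<in> \<S> (omul \<alpha> j) \<and> F \<subseteq> {p..} \<and> interval_family F r \<and> c i = interval_sum R F r (z i)"
        by (fastforce simp: \<Phi>_def)
      then obtain F r where Fr: "\<forall>i\<in>I. F i \<in> \<S> (omul \<alpha> j) \<and> F i \<subseteq> {p..} \<and> interval_family (F i) (r i) \<and>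
          c i = interval_sum R (F i) (r i) (z i)"
        unfolding bchoice_iff by (elim exE) (rule that)
      have "\<exists>F' r'. F' \<in> \<S> (omul \<alpha> j + \<alpha>) \<and> F' \<subseteq> {p..} \<and> interval_family F' r' \<and>
          (\<Sum>i\<in>I. interval_sum R (F i) (r i) (z i)) = interval_sum R F' r' (\<Sum>i\<in>I. z i)"
        by (rule interval_sum_superadditive[OF w.projections_axioms h I z_w z_h[OF _ j] ord_w]) (use Fr in auto)
      then obtain F' r' where F': "F' \<in> \<S> (omul \<alpha> (Suc j))" "F' \<subseteq> {p..}" "interval_family F' r'"
        and eq: "(\<Sum>i\<in>I. interval_sum R (F i) (r i) (z i)) = interval_sum R F' r' Z"
        by (auto simp: Z_def)
      have "(\<Sum>i\<in>I. c i) = interval_sum R F' r' Z"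
        using Fr by (simp flip: eq)
      also have "\<dots> \<le> A (Suc j) Z"
        by (rule A_upper) (use j F' Z in \<open>auto simp: \<Phi>_def\<close>)
      finally show "(\<Sum>i\<in>I. c i) \<le> A (Suc j) Z" .
    qed
    \<comment> \<open>This is where the size of \<open>\<delta>\<close> enters: the factor
      \<open>K * (1 + K)\<close> cancels.\<close>
    have last: "d ^ n * A n Z \<le> norm Z"
    proof -
      have "A n Z \<le> norm Z / d ^ n"
        unfolding A_def
      proof (rule cSUP_least[OF \<Phi>_ne])
        fix \<phi> assume \<phi>: "\<phi> \<in> \<Phi> n"
        have "K * (1 + K) * d ^ n * \<phi> Z \<le> \<delta> * \<phi> Z"
          using \<delta>(1) seminorm_nonneg[OF \<Phi>_sn[OF \<phi>]] by (intro mult_right_mono) auto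
        also have "\<dots> \<le> K * (1 + K) * norm Z"
          by (rule \<Phi>_w[OF \<phi> order_refl Z(2)])
        finally have "(K * (1 + K)) * (d ^ n * \<phi> Z) \<le> (K * (1 + K)) * norm Z"
          by (simp only: mult.assoc)
        moreover have "0 < K * (1 + K)" using K by simp
        ultimately have "d ^ n * \<phi> Z \<le> norm Z" by (simp only: mult_le_cancel_left_pos)
        then show "\<phi> Z \<le> norm Z / d ^ n" using d by (simp add: field_simps)
      qed
      then show ?thesis using d by (simp add: field_simps)
    qed
    have first: "norm Z \<le> A 0 Z"
      using norm_le[OF Z(3)] R_zero[OF Z(1)] by simp
    have "d * (\<Sum>i\<in>I. N (z i)) = d * (\<Sum>i\<in>I. \<Sum>j<n. d ^ j * A j (z i))"
      by (simp add: N_x z_x cong: sum.cong)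
    also have "\<dots> = (\<Sum>j<n. d ^ Suc j * (\<Sum>i\<in>I. A j (z i)))"
      by (subst sum.swap) (simp add: sum_distrib_left mult.assoc)
    also have "\<dots> \<le> (\<Sum>j<n. d ^ Suc j * A (Suc j) Z)"
      using step d by (intro sum_mono mult_left_mono) auto
    \<comment> \<open>The shift of levels loses \<open>A 0 Z\<close> and gains
      \<open>d ^ n * A n Z\<close>. The exchange goes in the right direction because the gained term
      is at most \<open>norm Z\<close>, which is at most \<open>A 0 Z\<close>.\<close>
    also have "\<dots> = (\<Sum>j<Suc n. d ^ j * A j Z) - A 0 Z"
      by (subst sum.lessThan_Suc_shift) simp
    also have "\<dots> \<le> (\<Sum>j<n. d ^ j * A j Z)"
      using first last by simp
    also have "\<dots> = N Z" by (simp add: N_x Z)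
    finally show "d * (\<Sum>i\<in>I. N (z i)) \<le> N (\<Sum>i\<in>I. z i)" by (simp add: Z_def)
  qed
  then have "d \<le> delta a \<alpha> N x"
    using le_delta_iff[OF x.projections_axioms equivalent_norm_on_subset[OF N_norm x_V]] d by simp
  also have "\<dots> \<le> delta_ddot a \<alpha> y"
    using N_norm unfolding V_def by (intro delta_le_delta_ddot[OF y.projections_axioms _ x_blk])
  finally show ?thesis .
qed

text \<open>The iteration bounds \<open>\<gamma>\<close> from below by \<open>c * d ^ n\<close>, the
  renorming bounds it from above by \<open>K * (1 + K) * d ^ n\<close>. These constants do not
  depend on \<open>n\<close>, so their roots tend to 1, and convergence is obtained together with
  the value of the limit.\<close>

lemma root_gamma_tendsto:
  assumes stab: "Delta_stabilizes a y \<gamma>" and "projections y Q K"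
  shows "(\<lambda>n. root n (\<gamma> (omul \<alpha> n))) \<longlonglongrightarrow> delta_ddot a \<alpha> y"
proof (rule order_tendstoI)
  interpret y: projections y Q K by fact
  define D where "D = delta_ddot a \<alpha> y"
  fix t
  show "\<forall>\<^sub>F n in sequentially. t < root n (\<gamma> (omul \<alpha> n))" if t: "t < delta_ddot a \<alpha> y"
  proof -
    obtain N x where N: "equivalent_norm_on (closed_span y) N" and x: "block_basis y x"
      and less: "t < delta a \<alpha> N x"
      using less_delta_ddotE[OF assms(2) t] .
    define d where "d = delta a \<alpha> N x"
    have d0: "0 \<le> d" unfolding d_def by (rule delta_block_basis_bounds[OF assms(2) N x])
    obtain c where c: "c > 0" "\<And>n. c * d ^ n \<le> \<gamma> (omul \<alpha> n)"
      using Delta_stabilizes_ge_power[OF stab assms(2) N x d0] by (auto simp: d_def)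
    have "(\<lambda>n. root n c * d) \<longlonglongrightarrow> 1 * d"
      by (intro tendsto_mult LIMSEQ_root_const[OF c(1)] tendsto_const)
    then have "\<forall>\<^sub>F n in sequentially. t < root n c * d"
      using less by (intro order_tendstoD(1)) (auto simp: d_def)
    then show ?thesis
      using eventually_gt_at_top[of 0]
    proof eventually_elim
      case (elim n)
      have "root n c * d = root n (c * d ^ n)"
        using elim(2) d0 by (simp add: real_root_mult real_root_power_cancel)
      also have "\<dots> \<le> root n (\<gamma> (omul \<alpha> n))"
        using c(2) elim(2) by simp
      finally show ?case using elim(1) by simp
    qed
  qed
  show "\<forall>\<^sub>F n in sequentially. root n (\<gamma> (omul \<alpha> n)) < t" if t: "delta_ddot a \<alpha> y < t"
  proof -
    have "0 \<le> delta a \<alpha> norm y"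
      by (rule delta_nonneg[OF assms(2) equivalent_norm_on_norm])
    also have "\<dots> \<le> D"
      unfolding D_def by (rule delta_le_delta_ddot[OF assms(2) equivalent_norm_on_norm y.block_basis_self])
    finally have D: "0 \<le> D" .
    \<comment> \<open>Strictly above \<open>D\<close>, so that the conclusion
      \<open>d \<le> D\<close> of the renorming is a contradiction; strictly below \<open>t\<close>,
      so that the roots end up below \<open>t\<close>; positive because \<open>D\<close> is
      nonnegative.\<close>
    define d where "d = (D + t) / 2"
    have d: "0 < d" "D < d" "d < t" using t D by (auto simp: d_def D_def)
    have K: "0 < K * (1 + K)" using y.K_ge_1 by simp
    have le: "\<gamma> (omul \<alpha> n) \<le> K * (1 + K) * d ^ n" if "0 < n" for n
    proof (rule ccontr)
      assume "\<not> ?thesis"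
      then obtain M where "K * (1 + K) * d ^ n < delta a (omul \<alpha> n) norm (\<lambda>i. y (i + M))"
        using Delta_stabilizes_lessE[OF stab assms(2), of "K * (1 + K) * d ^ n" "omul \<alpha> n"] by (auto simp: not_le)
      then have "d \<le> D"
        unfolding D_def by (intro renorming[OF assms(2) d(1) \<open>0 < n\<close>, of \<alpha> M]) simp
      then show False using d(2) by simp
    qed
    have "(\<lambda>n. root n (K * (1 + K)) * d) \<longlonglongrightarrow> 1 * d"
      by (intro tendsto_mult LIMSEQ_root_const[OF K] tendsto_const)
    then have "\<forall>\<^sub>F n in sequentially. root n (K * (1 + K)) * d < t"
      using d(3) by (intro order_tendstoD(2)) auto
    then show ?thesis
      using eventually_gt_at_top[of 0]
    proof eventually_elim
      case (elim n)
      have "root n (\<gamma> (omul \<alpha> n)) \<le> root n (K * (1 + K) * d ^ n)"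
        using le[OF elim(2)] elim(2) by simp
      also have "\<dots> = root n (K * (1 + K)) * d"
        using elim(2) d(1) by (simp only: real_root_mult) (simp add: real_root_power_cancel)
      finally show ?case using elim(1) by simp
    qed
  qed
qed

end

theorem proposition4p15:
  fixes a :: "omega1 \<Rightarrow> nat \<Rightarrow> omega1"
    and e :: "nat \<Rightarrow> 'a::banach"
    and \<gamma> :: "omega1 \<Rightarrow> real"
  assumes "fundamental_sequences a"
    and "schauder_basis e"
    and "\<gamma> \<in> Delta a e"
  shows "\<exists>y. block_basis e y \<and> Delta_stabilizes a y \<gamma> \<and>
    (\<forall>\<alpha>. (\<lambda>n. root n (\<gamma> (omul \<alpha> n))) \<longlonglongrightarrow> delta_ddot a \<alpha> y)"
proof -
  interpret schreier_classes a by (rule schreier_classes.intro) fact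
  obtain Q K where "projections e Q K"
    using schauder_basis_projections[OF assms(2)] .
  then interpret projections e Q K .
  obtain y where y: "block_basis e y" "Delta_stabilizes a y \<gamma>"
    using assms(3) by (auto simp: Delta_def)
  with root_gamma_tendsto[OF y(2) projections_block_basis[OF y(1)]] show ?thesis by blast
qed

end
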